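(* Let $R$ be a right noetherian ring, and let $M$ be a right $R$-module with an affiliated series $0\subsetneq U\subsetneq M$, where $U$ is an essential submodule of $M$, with corresponding affiliated primes $Q$ (for $U$) and $P$ (for $M/U$). Then one of the following two situations occurs, and they are mutually exclusive: (i) $P\subsetneq Q$, and $\mathrm{ann}_U(P)\subsetneq \mathrm{ann}_M(P)$. (ii) $M/U$ embeds into $\mathrm{Ext}^1_R(R/P,\mathrm{ann}_E(Q))$, where $E$ is the injective hull of $M$. There is an indecomposable summand $E'$ of $E$, with assassinator $Q$, such that $\mathrm{Ext}^1_R(R/P,\mathrm{ann}_{E'}(Q))$ contains a nonzero fully faithful $R/P$-module. In this case, if $U$ is a torsionfree $R/Q$-module, then $M/U$ is a torsionfree $R/P$-module.
   Context: Rings are associative with unit; modules are right modules. For an ideal $I$ and a module $M$, $\mathrm{ann}_M(I)=\{x\in M: xI=0\}$. For a two-sided ideal $I$, $\mathrm{Ext}^i_R(R/I,M)$ is a right $R/I$-module via the left action of $R$ on $R/I$ (for $i=0$ it is $\mathrm{ann}_M(I)$). An affiliated submodule of a nonzero module $M$ is a submodule $\mathrm{ann}_M(Q)$ where $Q$ is an ideal maximal among annihilators of nonzero submodules of $M$ (such $Q$ is prime, and is the corresponding affiliated prime). An affiliated series $0\subsetneq U\subsetneq M$ with affiliated primes $Q,P$ means: $U=\mathrm{ann}_M(Q)$ is an affiliated submodule of $M$ with affiliated prime $Q$, and $M/U=\mathrm{ann}_{M/U}(P)$ is an affiliated submodule of $M/U$ with affiliated prime $P$. A module over a ring is fully faithful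 if each of its nonzero submodules is faithful. For a prime ideal $P$, torsion and torsionfree for $R/P$-modules are with respect to the regular elements of the prime right Goldie ring $R/P$. The assassinator of a uniform module is its unique associated prime.
   Formalization: In (ii), "M/U embeds into Ext^1_R(R/P, ann_E(Q))" is taken to mean that the natural (connecting) map from M/U to this Ext module is injective; with an arbitrary embedding, (i) and (ii) would not be mutually exclusive in general. *)

theory Defs
  imports "HOL-Algebra.Module" "HOL-Algebra.QuotRing"
begin

section \<open>Right modules over a not necessarily commutative ring\<close>

text \<open>As for the record of left modules in \<^theory>\<open>HOL-Algebra.Module\<close>, the multiplicative
  fields inherited from the ring record carry no meaning.\<close>

record ('r, 'm) rmod = "'m ring" +
  act :: "'m \<Rightarrow> 'r \<Rightarrow> 'm" (infixl \<open>\<cdot>\<index>\<close> 70)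

locale right_module = R?: ring R + M?: abelian_group M for R (structure) and M (structure) +
  assumes act_closed [simp, intro]:
      "\<lbrakk>x \<in> carrier M; a \<in> carrier R\<rbrakk> \<Longrightarrow> x \<cdot>\<^bsub>M\<^esub> a \<in> carrier M"
    and act_r_distr:
      "\<lbrakk>x \<in> carrier M; a \<in> carrier R; b \<in> carrier R\<rbrakk> \<Longrightarrow>
        x \<cdot>\<^bsub>M\<^esub> (a \<oplus>\<^bsub>R\<^esub> b) = x \<cdot>\<^bsub>M\<^esub> a \<oplus>\<^bsub>M\<^esub> x \<cdot>\<^bsub>M\<^esub> b"
    and act_l_distr:
      "\<lbrakk>x \<in> carrier M; y \<in> carrier M; a \<in> carrier R\<rbrakk> \<Longrightarrow>
        (x \<oplus>\<^bsub>M\<^esub> y) \<cdot>\<^bsub>M\<^esub> a = x \<cdot>\<^bsub>M\<^esub> a \<oplus>\<^bsub>M\<^esub> y \<cdot>\<^bsub>M\<^esub> a"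
    and act_assoc:
      "\<lbrakk>x \<in> carrier M; a \<in> carrier R; b \<in> carrier R\<rbrakk> \<Longrightarrow>
        x \<cdot>\<^bsub>M\<^esub> (a \<otimes>\<^bsub>R\<^esub> b) = (x \<cdot>\<^bsub>M\<^esub> a) \<cdot>\<^bsub>M\<^esub> b"
    and act_one [simp]:
      "x \<in> carrier M \<Longrightarrow> x \<cdot>\<^bsub>M\<^esub> \<one>\<^bsub>R\<^esub> = x"

definition rsubmodule ::
    "('r, 'x) ring_scheme \<Rightarrow> ('r, 'm, 'y) rmod_scheme \<Rightarrow> 'm set \<Rightarrow> bool" where
  "rsubmodule R M N \<longleftrightarrow>
     additive_subgroup N M \<and> (\<forall>x\<in>N. \<forall>r\<in>carrier R. x \<cdot>\<^bsub>M\<^esub> r \<in> N)"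

definition rhom ::
    "('r, 'x) ring_scheme \<Rightarrow> ('r, 'm, 'y) rmod_scheme \<Rightarrow> ('r, 'n, 'z) rmod_scheme \<Rightarrow> ('m \<Rightarrow> 'n) set"
  where
  "rhom R M N = {f. f \<in> carrier M \<rightarrow> carrier N \<and>
     (\<forall>x\<in>carrier M. \<forall>y\<in>carrier M. f (x \<oplus>\<^bsub>M\<^esub> y) = f x \<oplus>\<^bsub>N\<^esub> f y) \<and>
     (\<forall>x\<in>carrier M. \<forall>r\<in>carrier R. f (x \<cdot>\<^bsub>M\<^esub> r) = f x \<cdot>\<^bsub>N\<^esub> r)}"

definition rembedding ::
    "('r, 'x) ring_scheme \<Rightarrow> ('r, 'm, 'y) rmod_scheme \<Rightarrow> ('r, 'n, 'z) rmod_scheme \<Rightarrow> ('m \<Rightarrow> 'n) \<Rightarrow> bool"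
  where
  "rembedding R M N f \<longleftrightarrow> f \<in> rhom R M N \<and> inj_on f (carrier M)"

definition sub_rmod :: "('r, 'm) rmod \<Rightarrow> 'm set \<Rightarrow> ('r, 'm) rmod" where
  "sub_rmod M N = M\<lparr>carrier := N\<rparr>"

definition quot_rmod :: "('r, 'm) rmod \<Rightarrow> 'm set \<Rightarrow> ('r, 'm set) rmod" where
  "quot_rmod M N =
     \<lparr>carrier = a_rcosets\<^bsub>M\<^esub> N, mult = undefined, one = undefined, zero = N, add = set_add M,
      act = (\<lambda>X r. \<Union>x\<in>X. N +>\<^bsub>M\<^esub> (x \<cdot>\<^bsub>M\<^esub> r))\<rparr>"

text \<open>The ring as a right module over itself; its submodules are the right ideals.\<close>

definition regular_rmod :: "('r, 'x) ring_scheme \<Rightarrow> ('r, 'r) rmod" where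
  "regular_rmod R =
     \<lparr>carrier = carrier R, mult = undefined, one = undefined, zero = \<zero>\<^bsub>R\<^esub>, add = add R,
      act = (\<lambda>x r. x \<otimes>\<^bsub>R\<^esub> r)\<rparr>"

definition right_noetherian :: "('r, 'x) ring_scheme \<Rightarrow> bool" where
  "right_noetherian R \<longleftrightarrow> ring R \<and>
     (\<forall>I :: nat \<Rightarrow> 'r set.
        (\<forall>n. rsubmodule R (regular_rmod R) (I n) \<and> I n \<subseteq> I (Suc n)) \<longrightarrow>
        (\<exists>n. \<forall>m\<ge>n. I m = I n))"

section \<open>Annihilators, affiliated series, torsion\<close>

definition ann_mod :: "('r, 'm, 'y) rmod_scheme \<Rightarrow> 'r set \<Rightarrow> 'm set" where
  "ann_mod M I = {x \<in> carrier M. \<forall>r\<in>I. x \<cdot>\<^bsub>M\<^esub> r = \<zero>\<^bsub>M\<^esub>}"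

definition ann_ring ::
    "('r, 'x) ring_scheme \<Rightarrow> ('r, 'm, 'y) rmod_scheme \<Rightarrow> 'm set \<Rightarrow> 'r set" where
  "ann_ring R M N = {r \<in> carrier R. \<forall>x\<in>N. x \<cdot>\<^bsub>M\<^esub> r = \<zero>\<^bsub>M\<^esub>}"

definition nonzero_submodule ::
    "('r, 'x) ring_scheme \<Rightarrow> ('r, 'm, 'y) rmod_scheme \<Rightarrow> 'm set \<Rightarrow> bool" where
  "nonzero_submodule R M N \<longleftrightarrow> rsubmodule R M N \<and> N \<noteq> {\<zero>\<^bsub>M\<^esub>}"

definition affiliated_prime ::
    "('r, 'x) ring_scheme \<Rightarrow> ('r, 'm, 'y) rmod_scheme \<Rightarrow> 'r set \<Rightarrow> bool" where
  "affiliated_prime R M Q \<longleftrightarrow> ideal Q R \<and>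
     (\<exists>N. nonzero_submodule R M N \<and> Q = ann_ring R M N) \<and>
     (\<forall>N. nonzero_submodule R M N \<and> Q \<subseteq> ann_ring R M N \<longrightarrow> ann_ring R M N = Q)"

definition affiliated_submodule ::
    "('r, 'x) ring_scheme \<Rightarrow> ('r, 'm, 'y) rmod_scheme \<Rightarrow> 'm set \<Rightarrow> 'r set \<Rightarrow> bool" where
  "affiliated_submodule R M U Q \<longleftrightarrow> affiliated_prime R M Q \<and> U = ann_mod M Q"

text \<open>An affiliated series \<open>0 \<subset> U \<subset> M\<close> with affiliated primes \<open>Q\<close> (of \<open>U\<close>) and \<open>P\<close> (of \<open>M/U\<close>).\<close>

definition affiliated_series2 ::
    "('r, 'x) ring_scheme \<Rightarrow> ('r, 'm) rmod \<Rightarrow> 'm set \<Rightarrow> 'r set \<Rightarrow> 'r set \<Rightarrow> bool" where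
  "affiliated_series2 R M U Q P \<longleftrightarrow> {\<zero>\<^bsub>M\<^esub>} \<subset> U \<and> U \<subset> carrier M \<and>
     affiliated_submodule R M U Q \<and>
     affiliated_submodule R (quot_rmod M U) (carrier (quot_rmod M U)) P"

definition essential_submodule ::
    "('r, 'x) ring_scheme \<Rightarrow> ('r, 'm, 'y) rmod_scheme \<Rightarrow> 'm set \<Rightarrow> bool" where
  "essential_submodule R M U \<longleftrightarrow> rsubmodule R M U \<and>
     (\<forall>V. nonzero_submodule R M V \<longrightarrow> U \<inter> V \<noteq> {\<zero>\<^bsub>M\<^esub>})"

definition fully_faithful :: "('r, 'x) ring_scheme \<Rightarrow> ('r, 'm, 'y) rmod_scheme \<Rightarrow> bool" where
  "fully_faithful R M \<longleftrightarrow> (\<forall>N. nonzero_submodule R M N \<longrightarrow> ann_ring R M N = {\<zero>\<^bsub>R\<^esub>})"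

text \<open>A module \<open>X\<close> annihilated by \<open>I\<close>, regarded as a module over \<open>R/I\<close>: the coset \<open>C\<close> acts as any of
  its elements does.\<close>

definition over_quot :: "'r set \<Rightarrow> ('r, 'm) rmod \<Rightarrow> ('r set, 'm) rmod" where
  "over_quot I X =
     \<lparr>carrier = carrier X, mult = undefined, one = undefined, zero = \<zero>\<^bsub>X\<^esub>, add = add X,
      act = (\<lambda>x C. the_elem ((\<lambda>r. x \<cdot>\<^bsub>X\<^esub> r) ` C))\<rparr>"

definition regular_elements :: "('r, 'x) ring_scheme \<Rightarrow> 'r set" where
  "regular_elements R = {c \<in> carrier R. \<forall>x\<in>carrier R.
     (c \<otimes>\<^bsub>R\<^esub> x = \<zero>\<^bsub>R\<^esub> \<longrightarrow> x = \<zero>\<^bsub>R\<^esub>) \<and> (x \<otimes>\<^bsub>R\<^esub> c = \<zero>\<^bsub>R\<^esub> \<longrightarrow> x = \<zero>\<^bsub>R\<^esub>)}"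

definition torsion_elements ::
    "('r, 'x) ring_scheme \<Rightarrow> ('r, 'm, 'y) rmod_scheme \<Rightarrow> 'm set" where
  "torsion_elements R M = {x \<in> carrier M. \<exists>c\<in>regular_elements R. x \<cdot>\<^bsub>M\<^esub> c = \<zero>\<^bsub>M\<^esub>}"

definition torsionfree :: "('r, 'x) ring_scheme \<Rightarrow> ('r, 'm, 'y) rmod_scheme \<Rightarrow> bool" where
  "torsionfree R M \<longleftrightarrow> torsion_elements R M = {\<zero>\<^bsub>M\<^esub>}"

section \<open>Assassinators and indecomposable summands\<close>

definition nc_prime_ideal :: "'r set \<Rightarrow> ('r, 'x) ring_scheme \<Rightarrow> bool" where
  "nc_prime_ideal P R \<longleftrightarrow> ideal P R \<and> P \<noteq> carrier R \<and>
     (\<forall>I J. ideal I R \<and> ideal J R \<and> (\<forall>a\<in>I. \<forall>b\<in>J. a \<otimes>\<^bsub>R\<^esub> b \<in> P) \<longrightarrow> I \<subseteq> P \<or> J \<subseteq> P)"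

text \<open>The module \<open>N\<close> below is annihilated by \<open>P\<close> and fully faithful over \<open>R/P\<close>.\<close>

definition associated_prime ::
    "('r, 'x) ring_scheme \<Rightarrow> ('r, 'm, 'y) rmod_scheme \<Rightarrow> 'r set \<Rightarrow> bool" where
  "associated_prime R M P \<longleftrightarrow> nc_prime_ideal P R \<and>
     (\<exists>N. nonzero_submodule R M N \<and>
        (\<forall>N'. nonzero_submodule R M N' \<and> N' \<subseteq> N \<longrightarrow> ann_ring R M N' = P))"

definition uniform_module :: "('r, 'x) ring_scheme \<Rightarrow> ('r, 'm, 'y) rmod_scheme \<Rightarrow> bool" where
  "uniform_module R M \<longleftrightarrow> carrier M \<noteq> {\<zero>\<^bsub>M\<^esub>} \<and>
     (\<forall>V. nonzero_submodule R M V \<longrightarrow> essential_submodule R M V)"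

definition has_assassinator ::
    "('r, 'x) ring_scheme \<Rightarrow> ('r, 'm, 'y) rmod_scheme \<Rightarrow> 'r set \<Rightarrow> bool" where
  "has_assassinator R M Q \<longleftrightarrow> uniform_module R M \<and> {P. associated_prime R M P} = {Q}"

definition direct_sum_decomp ::
    "('r, 'x) ring_scheme \<Rightarrow> ('r, 'm, 'y) rmod_scheme \<Rightarrow> 'm set \<Rightarrow> 'm set \<Rightarrow> bool" where
  "direct_sum_decomp R M V W \<longleftrightarrow> rsubmodule R M V \<and> rsubmodule R M W \<and>
     V \<inter> W = {\<zero>\<^bsub>M\<^esub>} \<and> V <+>\<^bsub>M\<^esub> W = carrier M"

definition direct_summand ::
    "('r, 'x) ring_scheme \<Rightarrow> ('r, 'm, 'y) rmod_scheme \<Rightarrow> 'm set \<Rightarrow> bool" where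
  "direct_summand R M V \<longleftrightarrow> (\<exists>W. direct_sum_decomp R M V W)"

definition indecomposable :: "('r, 'x) ring_scheme \<Rightarrow> ('r, 'm, 'y) rmod_scheme \<Rightarrow> bool" where
  "indecomposable R M \<longleftrightarrow> carrier M \<noteq> {\<zero>\<^bsub>M\<^esub>} \<and>
     (\<forall>V W. direct_sum_decomp R M V W \<longrightarrow> V = {\<zero>\<^bsub>M\<^esub>} \<or> W = {\<zero>\<^bsub>M\<^esub>})"

section \<open>Injective modules\<close>

text \<open>A definition cannot quantify over types, so the modules \<open>A\<close> and \<open>B\<close> in the extension property
  have their carriers in the type of the ring. This is no restriction: right ideals and the ring
  itself are among them, so by Baer's criterion the property holds for \<open>A\<close> and \<open>B\<close> of all types
  (lemma \<open>injective_rmod_extend\<close> below).\<close>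

definition injective_rmod :: "('r, 'x) ring_scheme \<Rightarrow> ('r, 'e) rmod \<Rightarrow> bool" where
  "injective_rmod R E \<longleftrightarrow> right_module R E \<and>
     (\<forall>(A :: ('r, 'r) rmod) (B :: ('r, 'r) rmod) f g.
        right_module R A \<and> right_module R B \<and> rembedding R A B f \<and> g \<in> rhom R A E \<longrightarrow>
        (\<exists>h\<in>rhom R B E. \<forall>x\<in>carrier A. h (f x) = g x))"

definition injective_hull ::
    "('r, 'x) ring_scheme \<Rightarrow> ('r, 'm) rmod \<Rightarrow> ('r, 'e) rmod \<Rightarrow> ('m \<Rightarrow> 'e) \<Rightarrow> bool" where
  "injective_hull R M E j \<longleftrightarrow> injective_rmod R E \<and> rembedding R M E j \<and>
     essential_submodule R E (j ` carrier M)"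

section \<open>Ext as a right derived functor\<close>

text \<open>If \<open>lact :: 's \<Rightarrow> 'a \<Rightarrow> 'a\<close> is a left action on the right module \<open>A\<close>, then \<open>Hom\<^sub>R(A, N)\<close> is a
  right module via \<open>(f \<cdot> s) x = f (s x)\<close>. Homomorphisms are extensional here, so that equal maps on
  \<open>A\<close> are equal elements.\<close>

definition hom_rmod ::
    "('r, 'x) ring_scheme \<Rightarrow> ('s \<Rightarrow> 'a \<Rightarrow> 'a) \<Rightarrow> ('r, 'a) rmod \<Rightarrow> ('r, 'n) rmod \<Rightarrow> ('s, 'a \<Rightarrow> 'n) rmod"
  where
  "hom_rmod R lact A N =
     \<lparr>carrier = rhom R A N \<inter> extensional (carrier A), mult = undefined, one = undefined,
      zero = (\<lambda>x\<in>carrier A. \<zero>\<^bsub>N\<^esub>), add = (\<lambda>f g. \<lambda>x\<in>carrier A. f x \<oplus>\<^bsub>N\<^esub> g x),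
      act = (\<lambda>f s. \<lambda>x\<in>carrier A. f (lact s x))\<rparr>"

text \<open>A coresolution \<open>0 \<rightarrow> N \<rightarrow> I\<^sup>0 \<rightarrow> I\<^sup>1 \<rightarrow> \<dots>\<close>.\<close>

record ('r, 'n, 'i) coresolution =
  obj :: "nat \<Rightarrow> ('r, 'i) rmod"
  diff :: "nat \<Rightarrow> 'i \<Rightarrow> 'i"
  aug :: "'n \<Rightarrow> 'i"

definition injective_resolution ::
    "('r, 'x) ring_scheme \<Rightarrow> ('r, 'n) rmod \<Rightarrow> ('r, 'n, 'i) coresolution \<Rightarrow> bool" where
  "injective_resolution R N J \<longleftrightarrow>
     (\<forall>n. injective_rmod R (obj J n)) \<and>
     (\<forall>n. diff J n \<in> rhom R (obj J n) (obj J (Suc n))) \<and>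
     rembedding R N (obj J 0) (aug J) \<and>
     aug J ` carrier N = a_kernel (obj J 0) (obj J 1) (diff J 0) \<and>
     (\<forall>n. diff J n ` carrier (obj J n) =
           a_kernel (obj J (Suc n)) (obj J (Suc (Suc n))) (diff J (Suc n)))"

text \<open>Cocycles and coboundaries of the complex \<open>Hom\<^sub>R(A, I\<^sup>\<bullet>)\<close>.\<close>

definition cocycles ::
    "('r, 'x) ring_scheme \<Rightarrow> ('r, 'a) rmod \<Rightarrow> ('r, 'n, 'i) coresolution \<Rightarrow> nat \<Rightarrow> ('a \<Rightarrow> 'i) set"
  where
  "cocycles R A J n = {f \<in> rhom R A (obj J n) \<inter> extensional (carrier A).
     \<forall>x\<in>carrier A. diff J n (f x) = \<zero>\<^bsub>obj J (Suc n)\<^esub>}"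

fun coboundaries ::
    "('r, 'x) ring_scheme \<Rightarrow> ('r, 'a) rmod \<Rightarrow> ('r, 'n, 'i) coresolution \<Rightarrow> nat \<Rightarrow> ('a \<Rightarrow> 'i) set"
  where
  "coboundaries R A J 0 = {\<lambda>x\<in>carrier A. \<zero>\<^bsub>obj J 0\<^esub>}"
| "coboundaries R A J (Suc n) =
     (\<lambda>g. \<lambda>x\<in>carrier A. diff J n (g x)) ` (rhom R A (obj J n) \<inter> extensional (carrier A))"

text \<open>\<open>Ext\<^sup>n\<^sub>R(A, N)\<close>, computed from an injective resolution \<open>J\<close> of \<open>N\<close>, with the right action induced
  by the left action \<open>lact\<close> on \<open>A\<close>.\<close>

definition Ext ::
    "('r, 'x) ring_scheme \<Rightarrow> ('s \<Rightarrow> 'a \<Rightarrow> 'a) \<Rightarrow> ('r, 'a) rmod \<Rightarrow> ('r, 'n, 'i) coresolution \<Rightarrow> nat \<Rightarrow>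
     ('s, ('a \<Rightarrow> 'i) set) rmod" where
  "Ext R lact A J n =
     quot_rmod (sub_rmod (hom_rmod R lact A (obj J n)) (cocycles R A J n)) (coboundaries R A J n)"

text \<open>\<open>Ext\<^sup>n\<^sub>R(R/I, N)\<close> as a right module over the ring \<open>R/I\<close>, by left multiplication on \<open>R/I\<close>.\<close>

definition Ext_quot ::
    "('r, 'x) ring_scheme \<Rightarrow> 'r set \<Rightarrow> ('r, 'n, 'i) coresolution \<Rightarrow> nat \<Rightarrow>
     ('r set, ('r set \<Rightarrow> 'i) set) rmod" where
  "Ext_quot R I J n =
     Ext R (\<lambda>C D. C \<otimes>\<^bsub>R Quot I\<^esub> D) (quot_rmod (regular_rmod R) I) J n"

text \<open>The connecting homomorphism \<open>Hom\<^sub>R(A, B/N) \<rightarrow> Ext\<^sup>1\<^sub>R(A, N)\<close> of \<open>0 \<rightarrow> N \<rightarrow> B \<rightarrow> B/N \<rightarrow> 0\<close>: extend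
  \<open>aug J : N \<rightarrow> I\<^sup>0\<close> to \<open>h : B \<rightarrow> I\<^sup>0\<close>; then \<open>diff J 0 \<circ> h\<close> factors through \<open>B/N\<close>, and \<open>\<phi>\<close> is sent to the
  class of its composition with this map \<open>B/N \<rightarrow> I\<^sup>1\<close>.\<close>

definition connecting ::
    "('r, 'x) ring_scheme \<Rightarrow> ('s \<Rightarrow> 'a \<Rightarrow> 'a) \<Rightarrow> ('r, 'a) rmod \<Rightarrow> ('r, 'b) rmod \<Rightarrow> 'b set \<Rightarrow>
     ('r, 'b, 'i) coresolution \<Rightarrow> ('a \<Rightarrow> 'b set) \<Rightarrow> ('a \<Rightarrow> 'i) set" where
  "connecting R lact A B N J \<phi> =
     (let h = (SOME h. h \<in> rhom R B (obj J 0) \<and> (\<forall>x\<in>N. h x = aug J x))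
      in coboundaries R A J 1 +>\<^bsub>hom_rmod R lact A (obj J 1)\<^esub>
           (\<lambda>a\<in>carrier A. the_elem ((\<lambda>b. diff J 0 (h b)) ` \<phi> a)))"

text \<open>Let \<open>j : M \<rightarrow> E\<close> map the submodule \<open>U\<close> into \<open>N\<close>, and let \<open>(M/U)P = 0\<close>. Then \<open>j\<close> induces
  \<open>M/U \<rightarrow> E/N\<close>, and the natural map \<open>M/U \<rightarrow> Ext\<^sup>1\<^sub>R(R/P, N)\<close> is the composition
  \<open>M/U \<cong> Hom\<^sub>R(R/P, M/U) \<rightarrow> Hom\<^sub>R(R/P, E/N) \<rightarrow> Ext\<^sup>1\<^sub>R(R/P, N)\<close>, the last map being the connecting
  homomorphism. By naturality this is also the composition of the connecting homomorphism
  \<open>Hom\<^sub>R(R/P, M/U) \<rightarrow> Ext\<^sup>1\<^sub>R(R/P, U)\<close> of \<open>0 \<rightarrow> U \<rightarrow> M \<rightarrow> M/U \<rightarrow> 0\<close> with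
  \<open>Ext\<^sup>1\<^sub>R(R/P, U) \<rightarrow> Ext\<^sup>1\<^sub>R(R/P, N)\<close>.\<close>

definition quot_map :: "('r, 'e) rmod \<Rightarrow> 'e set \<Rightarrow> ('m \<Rightarrow> 'e) \<Rightarrow> 'm set \<Rightarrow> 'e set" where
  "quot_map E N j Y = the_elem ((\<lambda>x. N +>\<^bsub>E\<^esub> j x) ` Y)"

definition natural_map ::
    "('r, 'x) ring_scheme \<Rightarrow> 'r set \<Rightarrow> ('r, 'm) rmod \<Rightarrow> 'm set \<Rightarrow> ('r, 'e) rmod \<Rightarrow> ('m \<Rightarrow> 'e) \<Rightarrow>
     'e set \<Rightarrow> ('r, 'e, 'i) coresolution \<Rightarrow> 'm set \<Rightarrow> ('r set \<Rightarrow> 'i) set" where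
  "natural_map R P M U E j N J Y =
     connecting R (\<lambda>C D. C \<otimes>\<^bsub>R Quot P\<^esub> D) (quot_rmod (regular_rmod R) P) E N J
       (\<lambda>C\<in>carrier (R Quot P). quot_map E N j (Y \<cdot>\<^bsub>over_quot P (quot_rmod M U)\<^esub> C))"

section \<open>Basic facts\<close>

context right_module begin

lemma zero_act [simp]: "a \<in> carrier R \<Longrightarrow> \<zero>\<^bsub>M\<^esub> \<cdot>\<^bsub>M\<^esub> a = \<zero>\<^bsub>M\<^esub>"
proof -
  assume a: "a \<in> carrier R"
  have "\<zero>\<^bsub>M\<^esub> \<cdot>\<^bsub>M\<^esub> a \<oplus>\<^bsub>M\<^esub> \<zero>\<^bsub>M\<^esub> \<cdot>\<^bsub>M\<^esub> a = (\<zero>\<^bsub>M\<^esub> \<oplus>\<^bsub>M\<^esub> \<zero>\<^bsub>M\<^esub>) \<cdot>\<^bsub>M\<^esub> a"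
    using a by (subst act_l_distr) auto
  then show ?thesis using a by (metis M.l_zero M.zero_closed act_closed M.add.l_cancel_one)
qed

lemma act_zero [simp]: "x \<in> carrier M \<Longrightarrow> x \<cdot>\<^bsub>M\<^esub> \<zero>\<^bsub>R\<^esub> = \<zero>\<^bsub>M\<^esub>"
  by (metis R.l_zero R.zero_closed act_closed act_r_distr M.add.l_cancel_one)

lemma act_minus: "\<lbrakk>x \<in> carrier M; a \<in> carrier R\<rbrakk> \<Longrightarrow> x \<cdot>\<^bsub>M\<^esub> (\<ominus>\<^bsub>R\<^esub> a) = \<ominus>\<^bsub>M\<^esub> (x \<cdot>\<^bsub>M\<^esub> a)"
  by (metis M.minus_equality R.a_inv_closed R.l_neg act_closed act_r_distr act_zero)

lemma minus_one_act: "x \<in> carrier M \<Longrightarrow> x \<cdot>\<^bsub>M\<^esub> (\<ominus>\<^bsub>R\<^esub> \<one>\<^bsub>R\<^esub>) = \<ominus>\<^bsub>M\<^esub> x"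
  by (simp add: act_minus)

lemma minus_act:
  assumes "x \<in> carrier M" "a \<in> carrier R" shows "(\<ominus>\<^bsub>M\<^esub> x) \<cdot>\<^bsub>M\<^esub> a = \<ominus>\<^bsub>M\<^esub> (x \<cdot>\<^bsub>M\<^esub> a)"
proof -
  have "x \<cdot>\<^bsub>M\<^esub> ((\<ominus>\<^bsub>R\<^esub> \<one>\<^bsub>R\<^esub>) \<otimes>\<^bsub>R\<^esub> a) = x \<cdot>\<^bsub>M\<^esub> (\<ominus>\<^bsub>R\<^esub> a)" using assms by (simp add: R.l_minus)
  then show ?thesis using assms by (simp add: act_assoc act_minus)
qed

lemma rsubmoduleI:
  assumes "N \<subseteq> carrier M" "\<zero>\<^bsub>M\<^esub> \<in> N"
    "\<And>x y. x \<in> N \<Longrightarrow> y \<in> N \<Longrightarrow> x \<oplus>\<^bsub>M\<^esub> y \<in> N"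
    "\<And>x r. x \<in> N \<Longrightarrow> r \<in> carrier R \<Longrightarrow> x \<cdot>\<^bsub>M\<^esub> r \<in> N"
  shows "rsubmodule R M N"
  unfolding rsubmodule_def
proof (intro conjI)
  have "\<ominus>\<^bsub>M\<^esub> x \<in> N" if "x \<in> N" for x
    using assms(4)[OF that, of "\<ominus>\<^bsub>R\<^esub> \<one>\<^bsub>R\<^esub>"] assms(1) that by (auto simp: minus_one_act)
  then show "additive_subgroup N M"
    using assms by (intro additive_subgroup.intro M.add.subgroupI) (auto simp: a_inv_def)
qed (use assms in auto)

lemma rsubmoduleD:
  assumes "rsubmodule R M N"
  shows "N \<subseteq> carrier M" "\<zero>\<^bsub>M\<^esub> \<in> N" "\<And>x y. x \<in> N \<Longrightarrow> y \<in> N \<Longrightarrow> x \<oplus>\<^bsub>M\<^esub> y \<in> N"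
    "\<And>x r. x \<in> N \<Longrightarrow> r \<in> carrier R \<Longrightarrow> x \<cdot>\<^bsub>M\<^esub> r \<in> N" "\<And>x. x \<in> N \<Longrightarrow> \<ominus>\<^bsub>M\<^esub> x \<in> N"
proof -
  have sub: "additive_subgroup N M" and act: "\<And>x r. x \<in> N \<Longrightarrow> r \<in> carrier R \<Longrightarrow> x \<cdot>\<^bsub>M\<^esub> r \<in> N"
    using assms by (auto simp: rsubmodule_def)
  show N: "N \<subseteq> carrier M" "\<zero>\<^bsub>M\<^esub> \<in> N" "\<And>x y. x \<in> N \<Longrightarrow> y \<in> N \<Longrightarrow> x \<oplus>\<^bsub>M\<^esub> y \<in> N"
    "\<And>x r. x \<in> N \<Longrightarrow> r \<in> carrier R \<Longrightarrow> x \<cdot>\<^bsub>M\<^esub> r \<in> N"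
    using additive_subgroup.a_subset[OF sub] additive_subgroup.zero_closed[OF sub]
      additive_subgroup.a_closed[OF sub] act by auto
  show "\<ominus>\<^bsub>M\<^esub> x \<in> N" if "x \<in> N" for x
    using act[OF that, of "\<ominus>\<^bsub>R\<^esub> \<one>\<^bsub>R\<^esub>"] N(1) that by (auto simp: minus_one_act)
qed

end

lemma right_module_sub_rmod:
  assumes "right_module R M" "rsubmodule R M N"
  shows "right_module R (sub_rmod M N)"
proof -
  interpret right_module R M by fact
  note N = rsubmoduleD[OF assms(2)]
  show ?thesis
  proof (intro right_module.intro abelian_groupI right_module_axioms.intro)
    show "\<exists>y\<in>carrier (sub_rmod M N). y \<oplus>\<^bsub>sub_rmod M N\<^esub> x = \<zero>\<^bsub>sub_rmod M N\<^esub>"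
      if "x \<in> carrier (sub_rmod M N)" for x
      using that N by (intro bexI[of _ "\<ominus>\<^bsub>M\<^esub> x"]) (auto simp: sub_rmod_def M.l_neg)
  qed (use N(1) in \<open>auto simp: sub_rmod_def N M.a_ac subset_iff R.ring_axioms
        act_r_distr act_l_distr act_assoc\<close>)
qed

lemma right_module_regular:
  assumes "ring R" shows "right_module R (regular_rmod R)"
proof -
  interpret ring R by fact
  show ?thesis
  proof (intro right_module.intro abelian_groupI right_module_axioms.intro)
    show "\<exists>y\<in>carrier (regular_rmod R). y \<oplus>\<^bsub>regular_rmod R\<^esub> x = \<zero>\<^bsub>regular_rmod R\<^esub>"
      if "x \<in> carrier (regular_rmod R)" for x
      using that by (intro bexI[of _ "\<ominus>\<^bsub>R\<^esub> x"]) (auto simp: regular_rmod_def l_neg)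
  qed (auto simp: regular_rmod_def a_ac ring_axioms l_distr r_distr m_assoc)
qed

lemma rhom_props:
  assumes "right_module R M" "right_module R N" "f \<in> rhom R M N"
  shows "\<And>x. x \<in> carrier M \<Longrightarrow> f x \<in> carrier N"
    "\<And>x y. x \<in> carrier M \<Longrightarrow> y \<in> carrier M \<Longrightarrow> f (x \<oplus>\<^bsub>M\<^esub> y) = f x \<oplus>\<^bsub>N\<^esub> f y"
    "\<And>x r. x \<in> carrier M \<Longrightarrow> r \<in> carrier R \<Longrightarrow> f (x \<cdot>\<^bsub>M\<^esub> r) = f x \<cdot>\<^bsub>N\<^esub> r"
    "f \<zero>\<^bsub>M\<^esub> = \<zero>\<^bsub>N\<^esub>"
proof -
  interpret M: right_module R M by fact
  interpret N: right_module R N by fact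
  show a: "\<And>x. x \<in> carrier M \<Longrightarrow> f x \<in> carrier N"
    "\<And>x y. x \<in> carrier M \<Longrightarrow> y \<in> carrier M \<Longrightarrow> f (x \<oplus>\<^bsub>M\<^esub> y) = f x \<oplus>\<^bsub>N\<^esub> f y"
    "\<And>x r. x \<in> carrier M \<Longrightarrow> r \<in> carrier R \<Longrightarrow> f (x \<cdot>\<^bsub>M\<^esub> r) = f x \<cdot>\<^bsub>N\<^esub> r"
    using assms(3) by (auto simp: rhom_def)
  show "f \<zero>\<^bsub>M\<^esub> = \<zero>\<^bsub>N\<^esub>"
    using a(3)[of "\<zero>\<^bsub>M\<^esub>" "\<zero>\<^bsub>R\<^esub>"] a(1)[of "\<zero>\<^bsub>M\<^esub>"] by simp
qed

lemma baer_step: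
  assumes E: "injective_rmod R E"
    and I: "rsubmodule R (regular_rmod R) I" and g: "g \<in> rhom R (sub_rmod (regular_rmod R) I) E"
  obtains e where "e \<in> carrier E" "\<And>r. r \<in> I \<Longrightarrow> g r = e \<cdot>\<^bsub>E\<^esub> r"
proof -
  interpret right_module R E using E by (simp add: injective_rmod_def)
  let ?B = "regular_rmod R" let ?A = "sub_rmod ?B I"
  interpret B: right_module R ?B by (rule right_module_regular) (rule R.ring_axioms)
  have A: "right_module R ?A" by (rule right_module_sub_rmod[OF B.right_module_axioms I])
  have IR: "I \<subseteq> carrier R" using B.rsubmoduleD(1)[OF I] by (simp add: regular_rmod_def)
  have "rembedding R ?A ?B (\<lambda>x. x)"
    using IR by (auto simp: rembedding_def rhom_def sub_rmod_def regular_rmod_def)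
  then obtain h where h: "h \<in> rhom R ?B E" "\<forall>x\<in>carrier ?A. h x = g x"
    using E A B.right_module_axioms g unfolding injective_rmod_def by blast
  note hp = rhom_props[OF B.right_module_axioms right_module_axioms h(1)]
  have "g r = h \<one>\<^bsub>R\<^esub> \<cdot>\<^bsub>E\<^esub> r" if "r \<in> I" for r
  proof -
    have "h (\<one>\<^bsub>R\<^esub> \<cdot>\<^bsub>?B\<^esub> r) = h \<one>\<^bsub>R\<^esub> \<cdot>\<^bsub>E\<^esub> r"
      using that IR by (intro hp) (auto simp: regular_rmod_def)
    moreover have "\<one>\<^bsub>R\<^esub> \<cdot>\<^bsub>?B\<^esub> r = r" using that IR by (auto simp: regular_rmod_def)
    ultimately show ?thesis using h(2) that by (simp add: sub_rmod_def)
  qed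
  moreover have "h \<one>\<^bsub>R\<^esub> \<in> carrier E" by (rule hp) (simp add: regular_rmod_def)
  ultimately show ?thesis using that by blast
qed

text \<open>Baer's criterion.\<close>

lemma injective_rmod_extend:
  fixes A :: "('r, 'a) rmod" and B :: "('r, 'b) rmod"
  assumes E: "injective_rmod R E" and A: "right_module R A" and B: "right_module R B"
    and f: "rembedding R A B f" and g: "g \<in> rhom R A E"
  shows "\<exists>h\<in>rhom R B E. \<forall>x\<in>carrier A. h (f x) = g x"
proof -
  have E': "right_module R E" using E by (simp add: injective_rmod_def)
  interpret E: right_module R E by fact
  interpret A: right_module R A by fact
  interpret B: right_module R B by fact
  have f': "f \<in> rhom R A B" and inj: "inj_on f (carrier A)" using f by (auto simp: rembedding_def)
  note fp = rhom_props[OF A B f'] and gp = rhom_props[OF A E' g]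
  define closed where "closed G \<longleftrightarrow> G \<subseteq> carrier B \<times> carrier E \<and>
     (\<forall>x y x' y'. (x, y) \<in> G \<longrightarrow> (x', y') \<in> G \<longrightarrow> (x \<oplus>\<^bsub>B\<^esub> x', y \<oplus>\<^bsub>E\<^esub> y') \<in> G) \<and>
     (\<forall>x y. \<forall>r\<in>carrier R. (x, y) \<in> G \<longrightarrow> (x \<cdot>\<^bsub>B\<^esub> r, y \<cdot>\<^bsub>E\<^esub> r) \<in> G) \<and>
     (\<forall>y. (\<zero>\<^bsub>B\<^esub>, y) \<in> G \<longrightarrow> y = \<zero>\<^bsub>E\<^esub>)" for G
  define G0 where "G0 = (\<lambda>x. (f x, g x)) ` carrier A"
  have G0: "closed G0"
    unfolding closed_def
  proof (intro conjI allI impI ballI)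
    show "G0 \<subseteq> carrier B \<times> carrier E" using fp(1) gp(1) by (auto simp: G0_def)
  next
    fix x y x' y' assume "(x, y) \<in> G0" "(x', y') \<in> G0"
    then obtain a b where "a \<in> carrier A" "b \<in> carrier A" "x = f a" "y = g a" "x' = f b" "y' = g b"
      by (auto simp: G0_def)
    then show "(x \<oplus>\<^bsub>B\<^esub> x', y \<oplus>\<^bsub>E\<^esub> y') \<in> G0"
      unfolding G0_def by (intro image_eqI[of _ _ "a \<oplus>\<^bsub>A\<^esub> b"]) (auto simp: fp gp)
  next
    fix x y r assume "(x, y) \<in> G0" and r: "r \<in> carrier R"
    then obtain a where "a \<in> carrier A" "x = f a" "y = g a"
      by (auto simp: G0_def)
    then show "(x \<cdot>\<^bsub>B\<^esub> r, y \<cdot>\<^bsub>E\<^esub> r) \<in> G0" using r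
      unfolding G0_def by (intro image_eqI[of _ _ "a \<cdot>\<^bsub>A\<^esub> r"]) (auto simp: fp gp)
  next
    fix y assume "(\<zero>\<^bsub>B\<^esub>, y) \<in> G0"
    then obtain a where a: "a \<in> carrier A" "f a = \<zero>\<^bsub>B\<^esub>" "y = g a"
      by (auto simp: G0_def)
    then have "a = \<zero>\<^bsub>A\<^esub>" using inj_onD[OF inj, of a "\<zero>\<^bsub>A\<^esub>"] fp(4) by simp
    then show "y = \<zero>\<^bsub>E\<^esub>" using a gp(4) by simp
  qed
  define Z where "Z = {G. closed G \<and> G0 \<subseteq> G}"
  have "\<exists>G\<in>Z. \<forall>X\<in>Z. G \<subseteq> X \<longrightarrow> X = G"
  proof (rule subset_Zorn_nonempty)
    show "Z \<noteq> {}" using G0 by (auto simp: Z_def)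
    fix \<C> assume ne: "\<C> \<noteq> {}" and ch: "subset.chain Z \<C>"
    then have sub: "\<C> \<subseteq> Z" and tot: "\<And>X Y. X \<in> \<C> \<Longrightarrow> Y \<in> \<C> \<Longrightarrow> X \<subseteq> Y \<or> Y \<subseteq> X"
      by (auto simp: subset.chain_def)
    have cl: "closed X" "G0 \<subseteq> X" if "X \<in> \<C>" for X using sub that by (auto simp: Z_def)
    have "closed (\<Union>\<C>)"
      unfolding closed_def
    proof (intro conjI allI impI ballI)
      show "\<Union>\<C> \<subseteq> carrier B \<times> carrier E" 
      proof (rule Union_least)
        show "X \<subseteq> carrier B \<times> carrier E" if "X \<in> \<C>" for X using cl(1)[OF that] by (simp add: closed_def)
      qed
    next
      fix x y x' y' assume "(x, y) \<in> \<Union>\<C>" "(x', y') \<in> \<Union>\<C>"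
      then obtain X where "X \<in> \<C>" "(x, y) \<in> X" "(x', y') \<in> X" using tot by blast
      then show "(x \<oplus>\<^bsub>B\<^esub> x', y \<oplus>\<^bsub>E\<^esub> y') \<in> \<Union>\<C>"
        using cl(1)[of X] unfolding closed_def by blast
    next
      fix x y r assume "(x, y) \<in> \<Union>\<C>" and r: "r \<in> carrier R"
      then show "(x \<cdot>\<^bsub>B\<^esub> r, y \<cdot>\<^bsub>E\<^esub> r) \<in> \<Union>\<C>" using cl(1) unfolding closed_def by blast
    next
      fix y assume "(\<zero>\<^bsub>B\<^esub>, y) \<in> \<Union>\<C>"
      then show "y = \<zero>\<^bsub>E\<^esub>" using cl(1) unfolding closed_def by blast
    qed
    then show "\<Union>\<C> \<in> Z" using ne cl(2) by (auto simp: Z_def)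
  qed
  then obtain G where GZ: "G \<in> Z" and maxZ: "\<forall>X\<in>Z. G \<subseteq> X \<longrightarrow> X = G" by blast
  have G: "closed G" "G0 \<subseteq> G" using GZ by (auto simp: Z_def)
  have max: "X = G" if "closed X" "G \<subseteq> X" for X
    using maxZ that G(2) by (auto simp: Z_def)
  have GD: "x \<in> carrier B" "y \<in> carrier E" if "(x, y) \<in> G" for x y
    using G(1) that unfolding closed_def by blast+
  have Gadd: "(x \<oplus>\<^bsub>B\<^esub> x', y \<oplus>\<^bsub>E\<^esub> y') \<in> G" if "(x, y) \<in> G" "(x', y') \<in> G" for x y x' y'
    using G(1) that unfolding closed_def by blast
  have Gact: "(x \<cdot>\<^bsub>B\<^esub> r, y \<cdot>\<^bsub>E\<^esub> r) \<in> G" if "(x, y) \<in> G" "r \<in> carrier R" for x y r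
    using G(1) that unfolding closed_def by blast
  have G0z: "y = \<zero>\<^bsub>E\<^esub>" if "(\<zero>\<^bsub>B\<^esub>, y) \<in> G" for y using G(1) that unfolding closed_def by blast
  have Gminus: "(\<ominus>\<^bsub>B\<^esub> x, \<ominus>\<^bsub>E\<^esub> y) \<in> G" if "(x, y) \<in> G" for x y
    using Gact[OF that, of "\<ominus>\<^bsub>R\<^esub> \<one>\<^bsub>R\<^esub>"] GD[OF that] by (simp add: B.minus_one_act E.minus_one_act)
  have Gun: "y = y'" if "(x, y) \<in> G" "(x, y') \<in> G" for x y y'
  proof -
    have "(x \<oplus>\<^bsub>B\<^esub> \<ominus>\<^bsub>B\<^esub> x, y \<oplus>\<^bsub>E\<^esub> \<ominus>\<^bsub>E\<^esub> y') \<in> G" using Gadd[OF that(1) Gminus[OF that(2)]] .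
    then have "y \<oplus>\<^bsub>E\<^esub> \<ominus>\<^bsub>E\<^esub> y' = \<zero>\<^bsub>E\<^esub>" using G0z GD[OF that(1)] by (simp add: B.M.r_neg)
    moreover have "y \<in> carrier E" "y' \<in> carrier E" using GD(2) that by auto
    ultimately show ?thesis by (metis E.M.minus_equality E.M.minus_minus E.M.a_inv_closed)
  qed
  have Gz: "(\<zero>\<^bsub>B\<^esub>, \<zero>\<^bsub>E\<^esub>) \<in> G"
  proof -
    have "(f \<zero>\<^bsub>A\<^esub>, g \<zero>\<^bsub>A\<^esub>) \<in> G0" by (auto simp: G0_def)
    then show ?thesis using G(2) fp(4) gp(4) by auto
  qed
  define h where "h x = (THE y. (x, y) \<in> G)" for x
  have hG: "(x, y) \<in> G \<Longrightarrow> h x = y" for x y unfolding h_def using Gun by blast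
  have dom: "\<exists>y. (b, y) \<in> G" if b: "b \<in> carrier B" for b
  proof -
    define I where "I = {r \<in> carrier R. \<exists>y. (b \<cdot>\<^bsub>B\<^esub> r, y) \<in> G}"
    interpret reg: right_module R "regular_rmod R"
      by (rule right_module_regular) (rule E.R.ring_axioms)
    have I: "rsubmodule R (regular_rmod R) I"
    proof (rule reg.rsubmoduleI)
      show "I \<subseteq> carrier (regular_rmod R)" by (auto simp: I_def regular_rmod_def)
      show "\<zero>\<^bsub>regular_rmod R\<^esub> \<in> I" using Gz b by (auto simp: I_def regular_rmod_def)
    next
      fix x y assume "x \<in> I" "y \<in> I"
      then show "x \<oplus>\<^bsub>regular_rmod R\<^esub> y \<in> I"
        using b Gadd by (force simp: I_def regular_rmod_def B.act_r_distr)
    next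
      fix x r assume "x \<in> I" "r \<in> carrier R"
      then show "x \<cdot>\<^bsub>regular_rmod R\<^esub> r \<in> I"
        using b Gact by (force simp: I_def regular_rmod_def B.act_assoc)
    qed
    have hI: "(b \<cdot>\<^bsub>B\<^esub> r, h (b \<cdot>\<^bsub>B\<^esub> r)) \<in> G" if "r \<in> I" for r
      using that hG by (auto simp: I_def)
    have "(\<lambda>r. h (b \<cdot>\<^bsub>B\<^esub> r)) \<in> rhom R (sub_rmod (regular_rmod R) I) E"
      unfolding rhom_def
    proof (intro CollectI conjI ballI Pi_I)
      fix x assume "x \<in> carrier (sub_rmod (regular_rmod R) I)"
      then show "h (b \<cdot>\<^bsub>B\<^esub> x) \<in> carrier E" using GD(2)[OF hI] by (simp add: sub_rmod_def)
    next
      fix x y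
      assume "x \<in> carrier (sub_rmod (regular_rmod R) I)" "y \<in> carrier (sub_rmod (regular_rmod R) I)"
      then have xy: "x \<in> I" "y \<in> I" by (auto simp: sub_rmod_def)
      then have "x \<in> carrier R" "y \<in> carrier R" by (auto simp: I_def)
      then show "h (b \<cdot>\<^bsub>B\<^esub> (x \<oplus>\<^bsub>sub_rmod (regular_rmod R) I\<^esub> y)) = h (b \<cdot>\<^bsub>B\<^esub> x) \<oplus>\<^bsub>E\<^esub> h (b \<cdot>\<^bsub>B\<^esub> y)"
        using b hG[OF Gadd[OF hI[OF xy(1)] hI[OF xy(2)]]]
        by (simp add: sub_rmod_def regular_rmod_def B.act_r_distr)
    next
      fix x r assume "x \<in> carrier (sub_rmod (regular_rmod R) I)" and r: "r \<in> carrier R"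
      then have x: "x \<in> I" by (auto simp: sub_rmod_def)
      then have "x \<in> carrier R" by (auto simp: I_def)
      then show "h (b \<cdot>\<^bsub>B\<^esub> (x \<cdot>\<^bsub>sub_rmod (regular_rmod R) I\<^esub> r)) = h (b \<cdot>\<^bsub>B\<^esub> x) \<cdot>\<^bsub>E\<^esub> r"
        using b r hG[OF Gact[OF hI[OF x] r]]
        by (simp add: sub_rmod_def regular_rmod_def B.act_assoc)
    qed
    then obtain e where e: "e \<in> carrier E" and eI: "\<And>r. r \<in> I \<Longrightarrow> h (b \<cdot>\<^bsub>B\<^esub> r) = e \<cdot>\<^bsub>E\<^esub> r"
      using baer_step[OF E I] by blast
    define G' where "G' = {(x \<oplus>\<^bsub>B\<^esub> b \<cdot>\<^bsub>B\<^esub> r, y \<oplus>\<^bsub>E\<^esub> e \<cdot>\<^bsub>E\<^esub> r) | x y r. (x, y) \<in> G \<and> r \<in> carrier R}"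
    have "closed G'"
      unfolding closed_def
    proof (intro conjI allI impI ballI)
      show "G' \<subseteq> carrier B \<times> carrier E" using GD b e by (auto simp: G'_def)
    next
      fix x y x' y' assume "(x, y) \<in> G'" "(x', y') \<in> G'"
      then obtain u v r u' v' r' where *: "(u, v) \<in> G" "r \<in> carrier R" "(u', v') \<in> G" "r' \<in> carrier R"
        "x = u \<oplus>\<^bsub>B\<^esub> b \<cdot>\<^bsub>B\<^esub> r" "y = v \<oplus>\<^bsub>E\<^esub> e \<cdot>\<^bsub>E\<^esub> r" "x' = u' \<oplus>\<^bsub>B\<^esub> b \<cdot>\<^bsub>B\<^esub> r'" "y' = v' \<oplus>\<^bsub>E\<^esub> e \<cdot>\<^bsub>E\<^esub> r'"
        unfolding G'_def by blast
      have "x \<oplus>\<^bsub>B\<^esub> x' = (u \<oplus>\<^bsub>B\<^esub> u') \<oplus>\<^bsub>B\<^esub> b \<cdot>\<^bsub>B\<^esub> (r \<oplus>\<^bsub>R\<^esub> r')"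
        using * GD[OF *(1)] GD[OF *(3)] b by (simp add: B.act_r_distr B.M.a_ac)
      moreover have "y \<oplus>\<^bsub>E\<^esub> y' = (v \<oplus>\<^bsub>E\<^esub> v') \<oplus>\<^bsub>E\<^esub> e \<cdot>\<^bsub>E\<^esub> (r \<oplus>\<^bsub>R\<^esub> r')"
        using * GD[OF *(1)] GD[OF *(3)] e by (simp add: E.act_r_distr E.M.a_ac)
      ultimately show "(x \<oplus>\<^bsub>B\<^esub> x', y \<oplus>\<^bsub>E\<^esub> y') \<in> G'"
        using Gadd[OF *(1,3)] * unfolding G'_def by blast
    next
      fix x y s assume "(x, y) \<in> G'" and s: "s \<in> carrier R"
      then obtain u v r where *: "(u, v) \<in> G" "r \<in> carrier R"
        "x = u \<oplus>\<^bsub>B\<^esub> b \<cdot>\<^bsub>B\<^esub> r" "y = v \<oplus>\<^bsub>E\<^esub> e \<cdot>\<^bsub>E\<^esub> r"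
        unfolding G'_def by blast
      have "x \<cdot>\<^bsub>B\<^esub> s = u \<cdot>\<^bsub>B\<^esub> s \<oplus>\<^bsub>B\<^esub> b \<cdot>\<^bsub>B\<^esub> (r \<otimes>\<^bsub>R\<^esub> s)" "y \<cdot>\<^bsub>E\<^esub> s = v \<cdot>\<^bsub>E\<^esub> s \<oplus>\<^bsub>E\<^esub> e \<cdot>\<^bsub>E\<^esub> (r \<otimes>\<^bsub>R\<^esub> s)"
        using * GD[OF *(1)] b e s
        by (simp_all add: B.act_l_distr B.act_assoc E.act_l_distr E.act_assoc)
      then show "(x \<cdot>\<^bsub>B\<^esub> s, y \<cdot>\<^bsub>E\<^esub> s) \<in> G'"
        using Gact[OF *(1) s] * s unfolding G'_def by blast
    next
      fix y assume "(\<zero>\<^bsub>B\<^esub>, y) \<in> G'"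
      then obtain u v r where *: "(u, v) \<in> G" "r \<in> carrier R"
        "\<zero>\<^bsub>B\<^esub> = u \<oplus>\<^bsub>B\<^esub> b \<cdot>\<^bsub>B\<^esub> r" "y = v \<oplus>\<^bsub>E\<^esub> e \<cdot>\<^bsub>E\<^esub> r"
        unfolding G'_def by blast
      have "b \<cdot>\<^bsub>B\<^esub> r = \<ominus>\<^bsub>B\<^esub> u" using * GD[OF *(1)] b
        by (metis B.M.minus_equality B.M.minus_minus B.act_closed B.M.a_comm)
      then have br: "(b \<cdot>\<^bsub>B\<^esub> r, \<ominus>\<^bsub>E\<^esub> v) \<in> G" using Gminus[OF *(1)] by simp
      then have "r \<in> I" using *(2) by (auto simp: I_def)
      then have "e \<cdot>\<^bsub>E\<^esub> r = \<ominus>\<^bsub>E\<^esub> v" using eI hG[OF br] by simp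
      then show "y = \<zero>\<^bsub>E\<^esub>" using * GD[OF *(1)] by (simp add: E.M.r_neg)
    qed
    moreover have "G \<subseteq> G'"
    proof
      fix p assume p: "p \<in> G"
      obtain x y where xy: "p = (x, y)" by force
      have "x \<oplus>\<^bsub>B\<^esub> b \<cdot>\<^bsub>B\<^esub> \<zero>\<^bsub>R\<^esub> = x" "y \<oplus>\<^bsub>E\<^esub> e \<cdot>\<^bsub>E\<^esub> \<zero>\<^bsub>R\<^esub> = y" using GD[of x y] p xy b e by auto
      then show "p \<in> G'" unfolding G'_def using p xy E.R.zero_closed by (smt (verit) mem_Collect_eq)
    qed
    ultimately have "G' = G" by (rule max)
    moreover have "(\<zero>\<^bsub>B\<^esub> \<oplus>\<^bsub>B\<^esub> b \<cdot>\<^bsub>B\<^esub> \<one>\<^bsub>R\<^esub>, \<zero>\<^bsub>E\<^esub> \<oplus>\<^bsub>E\<^esub> e \<cdot>\<^bsub>E\<^esub> \<one>\<^bsub>R\<^esub>) \<in> G'"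
      unfolding G'_def using Gz E.R.one_closed by blast
    ultimately show ?thesis using b e by auto
  qed
  have hB: "(b, h b) \<in> G" if "b \<in> carrier B" for b using dom[OF that] hG by auto
  have "h \<in> rhom R B E"
    unfolding rhom_def
  proof (intro CollectI conjI ballI Pi_I)
    show "h x \<in> carrier E" if "x \<in> carrier B" for x using hB[OF that] GD by blast
    show "h (x \<oplus>\<^bsub>B\<^esub> y) = h x \<oplus>\<^bsub>E\<^esub> h y" if "x \<in> carrier B" "y \<in> carrier B" for x y
      using hG[OF Gadd[OF hB hB]] that by blast
    show "h (x \<cdot>\<^bsub>B\<^esub> r) = h x \<cdot>\<^bsub>E\<^esub> r" if "x \<in> carrier B" "r \<in> carrier R" for x r
      using hG[OF Gact[OF hB]] that by blast
  qed
  moreover have "h (f x) = g x" if "x \<in> carrier A" for x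
    using hG G(2) that by (auto simp: G0_def)
  ultimately show ?thesis by blast
qed

lemma right_module_quot:
  assumes "right_module R M" and N: "rsubmodule R M N"
  shows "right_module R (quot_rmod M N)"
    and "\<And>x r. x \<in> carrier M \<Longrightarrow> r \<in> carrier R \<Longrightarrow>
        (N +>\<^bsub>M\<^esub> x) \<cdot>\<^bsub>quot_rmod M N\<^esub> r = N +>\<^bsub>M\<^esub> (x \<cdot>\<^bsub>M\<^esub> r)"
proof -
  interpret right_module R M by fact
  note Np = rsubmoduleD[OF N]
  interpret S: abelian_subgroup N M
    using N by (intro abelian_subgroupI3 M.abelian_group_axioms) (auto simp: rsubmodule_def)
  show act: "(N +>\<^bsub>M\<^esub> x) \<cdot>\<^bsub>quot_rmod M N\<^esub> r = N +>\<^bsub>M\<^esub> (x \<cdot>\<^bsub>M\<^esub> r)"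
    if "x \<in> carrier M" "r \<in> carrier R" for x r
  proof -
    have eq: "N +>\<^bsub>M\<^esub> (y \<cdot>\<^bsub>M\<^esub> r) = N +>\<^bsub>M\<^esub> (x \<cdot>\<^bsub>M\<^esub> r)" if "y \<in> N +>\<^bsub>M\<^esub> x" for y
    proof -
      from that obtain n where n: "n \<in> N" "y = n \<oplus>\<^bsub>M\<^esub> x" by (auto simp: a_r_coset_def')
      have nM: "n \<in> carrier M" using Np(1) n(1) by blast
      have yr: "y \<cdot>\<^bsub>M\<^esub> r = n \<cdot>\<^bsub>M\<^esub> r \<oplus>\<^bsub>M\<^esub> x \<cdot>\<^bsub>M\<^esub> r"
        unfolding n(2) using nM \<open>x \<in> carrier M\<close> \<open>r \<in> carrier R\<close> by (rule act_l_distr)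
      have nr: "n \<cdot>\<^bsub>M\<^esub> r \<in> N" using n(1) \<open>r \<in> carrier R\<close> by (rule Np(4))
      have "y \<cdot>\<^bsub>M\<^esub> r \<in> N +>\<^bsub>M\<^esub> (x \<cdot>\<^bsub>M\<^esub> r)"
        unfolding a_r_coset_def' UN_iff singleton_iff using yr nr by (rule bexI)
      then show ?thesis
        using S.a_repr_independence'[of "y \<cdot>\<^bsub>M\<^esub> r" "x \<cdot>\<^bsub>M\<^esub> r"] \<open>x \<in> carrier M\<close> \<open>r \<in> carrier R\<close> by simp
    qed
    have "x \<in> N +>\<^bsub>M\<^esub> x" using S.a_rcos_self that(1) .
    then have "(\<Union>y\<in>N +>\<^bsub>M\<^esub> x. N +>\<^bsub>M\<^esub> (y \<cdot>\<^bsub>M\<^esub> r)) = N +>\<^bsub>M\<^esub> (x \<cdot>\<^bsub>M\<^esub> r)"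
      by (rule UN_constant_eq) (intro ballI eq)
    then show ?thesis by (simp add: quot_rmod_def)
  qed
  have sum: "(N +>\<^bsub>M\<^esub> x) \<oplus>\<^bsub>quot_rmod M N\<^esub> (N +>\<^bsub>M\<^esub> y) = N +>\<^bsub>M\<^esub> (x \<oplus>\<^bsub>M\<^esub> y)"
    if "x \<in> carrier M" "y \<in> carrier M" for x y
    using S.a_rcos_sum that by (simp add: quot_rmod_def)
  have zero: "\<zero>\<^bsub>quot_rmod M N\<^esub> = N +>\<^bsub>M\<^esub> \<zero>\<^bsub>M\<^esub>"
    using Np(1) by (auto simp: quot_rmod_def a_r_coset_def' subset_iff)
  have car: "carrier (quot_rmod M N) = (\<lambda>x. N +>\<^bsub>M\<^esub> x) ` carrier M"
    by (auto simp: quot_rmod_def A_RCOSETS_def')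
  show "right_module R (quot_rmod M N)"
  proof (intro right_module.intro abelian_groupI right_module_axioms.intro)
    show "\<exists>y\<in>carrier (quot_rmod M N). y \<oplus>\<^bsub>quot_rmod M N\<^esub> x = \<zero>\<^bsub>quot_rmod M N\<^esub>"
      if "x \<in> carrier (quot_rmod M N)" for x
    proof -
      from that obtain a where a: "a \<in> carrier M" "x = N +>\<^bsub>M\<^esub> a" by (auto simp: car)
      then show ?thesis
        by (intro bexI[of _ "N +>\<^bsub>M\<^esub> (\<ominus>\<^bsub>M\<^esub> a)"]) (auto simp: car sum zero M.l_neg)
    qed
  qed (auto simp: car sum act zero R.ring_axioms M.a_ac act_r_distr act_l_distr act_assoc)
qed

lemma right_module_hom:
  assumes A: "right_module R A" and N: "right_module R N" and S: "ring S"
    and l: "\<And>s. s \<in> carrier S \<Longrightarrow> lact s \<in> rhom R A A"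
    and l1: "\<And>x. x \<in> carrier A \<Longrightarrow> lact \<one>\<^bsub>S\<^esub> x = x"
    and l2: "\<And>s t x. s \<in> carrier S \<Longrightarrow> t \<in> carrier S \<Longrightarrow> x \<in> carrier A \<Longrightarrow>
      lact (s \<otimes>\<^bsub>S\<^esub> t) x = lact s (lact t x)"
    and l3: "\<And>s t x. s \<in> carrier S \<Longrightarrow> t \<in> carrier S \<Longrightarrow> x \<in> carrier A \<Longrightarrow>
      lact (s \<oplus>\<^bsub>S\<^esub> t) x = lact s x \<oplus>\<^bsub>A\<^esub> lact t x"
  shows "right_module S (hom_rmod R lact A N)"
proof -
  interpret A: right_module R A by fact
  interpret N: right_module R N by fact
  interpret S: ring S by fact
  note lp = rhom_props[OF A A l]
  note hp = rhom_props[OF A N]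
  let ?H = "hom_rmod R lact A N"
  have car: "f \<in> carrier ?H \<longleftrightarrow> f \<in> rhom R A N \<and> f \<in> extensional (carrier A)" for f
    by (auto simp: hom_rmod_def)
  have ex: "f \<in> extensional (carrier A)" "\<And>x. x \<in> carrier A \<Longrightarrow> f x \<in> carrier N"
    "f \<in> rhom R A N" if "f \<in> carrier ?H" for f
    using that unfolding car by (auto simp: rhom_def)
  have addc: "f \<oplus>\<^bsub>?H\<^esub> g \<in> carrier ?H" if "f \<in> carrier ?H" "g \<in> carrier ?H" for f g
    using hp(1-3)[OF ex(3)[OF that(1)]] hp(1-3)[OF ex(3)[OF that(2)]] unfolding car
    by (simp add: hom_rmod_def rhom_def N.act_l_distr N.M.a_ac)
  have actc: "f \<cdot>\<^bsub>?H\<^esub> s \<in> carrier ?H" if "f \<in> carrier ?H" "s \<in> carrier S" for f s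
    using hp(1-3)[OF ex(3)[OF that(1)]] lp(1-3)[OF that(2)] unfolding car
    by (simp add: hom_rmod_def rhom_def)
  have zc: "\<zero>\<^bsub>?H\<^esub> \<in> carrier ?H" unfolding car by (auto simp: hom_rmod_def rhom_def)
  have ad: "(f \<oplus>\<^bsub>?H\<^esub> g) = (\<lambda>x\<in>carrier A. f x \<oplus>\<^bsub>N\<^esub> g x)" for f g by (simp add: hom_rmod_def)
  have ac: "(f \<cdot>\<^bsub>?H\<^esub> s) = (\<lambda>x\<in>carrier A. f (lact s x))" for f s by (simp add: hom_rmod_def)
  have z: "\<zero>\<^bsub>?H\<^esub> = (\<lambda>x\<in>carrier A. \<zero>\<^bsub>N\<^esub>)" by (simp add: hom_rmod_def)
  show ?thesis
  proof (intro right_module.intro abelian_groupI right_module_axioms.intro S)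
    fix f assume f: "f \<in> carrier ?H"
    have "(\<lambda>x\<in>carrier A. \<ominus>\<^bsub>N\<^esub> f x) \<in> carrier ?H"
      using hp[OF ex(3)[OF f]] unfolding car
      by (auto simp: rhom_def N.M.minus_add N.M.a_ac N.minus_act)
    moreover have "(\<lambda>x\<in>carrier A. \<ominus>\<^bsub>N\<^esub> f x) \<oplus>\<^bsub>?H\<^esub> f = \<zero>\<^bsub>?H\<^esub>"
      by (rule extensionalityI[where A="carrier A"]) (use ex[OF f] in \<open>auto simp: ad z N.M.l_neg\<close>)
    ultimately show "\<exists>y\<in>carrier ?H. y \<oplus>\<^bsub>?H\<^esub> f = \<zero>\<^bsub>?H\<^esub>" by blast
    show "f \<cdot>\<^bsub>?H\<^esub> \<one>\<^bsub>S\<^esub> = f" by (rule extensionalityI[where A="carrier A"]) (use ex[OF f] in \<open>auto simp: ac l1\<close>)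
    show "\<zero>\<^bsub>?H\<^esub> \<oplus>\<^bsub>?H\<^esub> f = f" by (rule extensionalityI[where A="carrier A"]) (use ex[OF f] in \<open>auto simp: ad z\<close>)
    fix g assume g: "g \<in> carrier ?H"
    show "f \<oplus>\<^bsub>?H\<^esub> g = g \<oplus>\<^bsub>?H\<^esub> f"
      by (rule extensionalityI[where A="carrier A"]) (use ex[OF f] ex[OF g] in \<open>auto simp: ad N.M.a_comm\<close>)
    show "(f \<oplus>\<^bsub>?H\<^esub> g) \<oplus>\<^bsub>?H\<^esub> h = f \<oplus>\<^bsub>?H\<^esub> (g \<oplus>\<^bsub>?H\<^esub> h)" if h: "h \<in> carrier ?H" for h
      by (rule extensionalityI[where A="carrier A"]) (use ex[OF f] ex[OF g] ex[OF h] in \<open>auto simp: ad N.M.a_assoc\<close>)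
    fix s assume s: "s \<in> carrier S"
    show "(f \<oplus>\<^bsub>?H\<^esub> g) \<cdot>\<^bsub>?H\<^esub> s = f \<cdot>\<^bsub>?H\<^esub> s \<oplus>\<^bsub>?H\<^esub> g \<cdot>\<^bsub>?H\<^esub> s"
      by (rule extensionalityI[where A="carrier A"]) (use lp(1)[OF s] in \<open>auto simp: ad ac\<close>)
  next
    fix f s t assume f: "f \<in> carrier ?H" and st: "s \<in> carrier S" "t \<in> carrier S"
    show "f \<cdot>\<^bsub>?H\<^esub> (s \<oplus>\<^bsub>S\<^esub> t) = f \<cdot>\<^bsub>?H\<^esub> s \<oplus>\<^bsub>?H\<^esub> f \<cdot>\<^bsub>?H\<^esub> t"
      by (rule extensionalityI[where A="carrier A"]) (use hp[OF ex(3)[OF f]] lp(1) st in \<open>auto simp: ad ac l3\<close>)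
    show "f \<cdot>\<^bsub>?H\<^esub> (s \<otimes>\<^bsub>S\<^esub> t) = (f \<cdot>\<^bsub>?H\<^esub> s) \<cdot>\<^bsub>?H\<^esub> t"
      by (rule extensionalityI[where A="carrier A"]) (use lp(1) st in \<open>auto simp: ac l2\<close>)
  qed (auto intro: addc actc zc)
qed

lemma right_module_Ext:
  fixes J :: "('r, 'n, 'i) coresolution"
  assumes A: "right_module R A" and S: "ring S"
    and l: "\<And>s. s \<in> carrier S \<Longrightarrow> lact s \<in> rhom R A A"
    and l1: "\<And>x. x \<in> carrier A \<Longrightarrow> lact \<one>\<^bsub>S\<^esub> x = x"
    and l2: "\<And>s t x. s \<in> carrier S \<Longrightarrow> t \<in> carrier S \<Longrightarrow> x \<in> carrier A \<Longrightarrow>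
      lact (s \<otimes>\<^bsub>S\<^esub> t) x = lact s (lact t x)"
    and l3: "\<And>s t x. s \<in> carrier S \<Longrightarrow> t \<in> carrier S \<Longrightarrow> x \<in> carrier A \<Longrightarrow>
      lact (s \<oplus>\<^bsub>S\<^esub> t) x = lact s x \<oplus>\<^bsub>A\<^esub> lact t x"
    and J: "injective_resolution R N J"
  shows "right_module S (Ext R lact A J n)"
proof -
  interpret A: right_module R A by fact
  have I: "right_module R (obj J k)" for k
    using J by (simp add: injective_resolution_def injective_rmod_def)
  have d: "diff J k \<in> rhom R (obj J k) (obj J (Suc k))" for k
    using J by (simp add: injective_resolution_def)
  note dp = rhom_props[OF I I d]
  note lp = rhom_props[OF A A l]
  note hp = rhom_props[OF A I]
  have dd: "diff J (Suc k) (diff J k x) = \<zero>\<^bsub>obj J (Suc (Suc k))\<^esub>" if "x \<in> carrier (obj J k)" for k x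
  proof -
    have "diff J k x \<in> a_kernel (obj J (Suc k)) (obj J (Suc (Suc k))) (diff J (Suc k))"
      using J that unfolding injective_resolution_def by blast
    then show ?thesis by (simp add: a_kernel_def kernel_def)
  qed
  let ?H = "\<lambda>k. hom_rmod R lact A (obj J k)"
  have H: "right_module S (?H k)" for k
    by (rule right_module_hom[OF A I S l l1 l2 l3])
  have Hc: "f \<in> carrier (?H k) \<longleftrightarrow> f \<in> rhom R A (obj J k) \<and> f \<in> extensional (carrier A)" for f k
    by (auto simp: hom_rmod_def)
  have Zc: "f \<in> cocycles R A J k \<longleftrightarrow> f \<in> carrier (?H k) \<and> (\<forall>x\<in>carrier A. diff J k (f x) = \<zero>\<^bsub>obj J (Suc k)\<^esub>)" for f k
    by (auto simp: cocycles_def Hc)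
  have ad: "(f \<oplus>\<^bsub>?H k\<^esub> g) = (\<lambda>x\<in>carrier A. f x \<oplus>\<^bsub>obj J k\<^esub> g x)" for f g k by (simp add: hom_rmod_def)
  have ac: "(f \<cdot>\<^bsub>?H k\<^esub> s) = (\<lambda>x\<in>carrier A. f (lact s x))" for f s k by (simp add: hom_rmod_def)
  have z: "\<zero>\<^bsub>?H k\<^esub> = (\<lambda>x\<in>carrier A. \<zero>\<^bsub>obj J k\<^esub>)" for k by (simp add: hom_rmod_def)
  have Z: "rsubmodule S (?H n) (cocycles R A J n)"
  proof (rule right_module.rsubmoduleI[OF H])
    interpret H: right_module S "?H n" by (rule H)
    interpret I: right_module R "obj J (Suc n)" by (rule I)
    show "cocycles R A J n \<subseteq> carrier (?H n)" using Zc by blast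
    show "\<zero>\<^bsub>?H n\<^esub> \<in> cocycles R A J n" unfolding Zc using H.M.zero_closed dp(4) by (simp add: z)
    show "f \<oplus>\<^bsub>?H n\<^esub> g \<in> cocycles R A J n" if "f \<in> cocycles R A J n" "g \<in> cocycles R A J n" for f g
    proof -
      note fc = iffD1[OF Zc that(1)] and gc = iffD1[OF Zc that(2)]
      note f = fc[THEN conjunct1] fc[THEN conjunct1, unfolded Hc, THEN conjunct1] fc[THEN conjunct2]
        and g = gc[THEN conjunct1] gc[THEN conjunct1, unfolded Hc, THEN conjunct1] gc[THEN conjunct2]
      have "diff J n ((f \<oplus>\<^bsub>?H n\<^esub> g) x) = \<zero>\<^bsub>obj J (Suc n)\<^esub>" if "x \<in> carrier A" for x
        using that f(3) g(3) hp(1)[OF f(2) that] hp(1)[OF g(2) that] by (simp add: ad dp)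
      then show ?thesis unfolding Zc using H.M.a_closed[OF f(1) g(1)] by blast
    qed
    show "f \<cdot>\<^bsub>?H n\<^esub> s \<in> cocycles R A J n" if "f \<in> cocycles R A J n" "s \<in> carrier S" for f s
    proof -
      note fc = iffD1[OF Zc that(1)]
      note f = fc[THEN conjunct1] fc[THEN conjunct2]
      have "diff J n ((f \<cdot>\<^bsub>?H n\<^esub> s) x) = \<zero>\<^bsub>obj J (Suc n)\<^esub>" if "x \<in> carrier A" for x
        using that f(2) lp(1)[OF \<open>s \<in> carrier S\<close> that] by (simp add: ac)
      then show ?thesis unfolding Zc using H.act_closed[OF f(1) that(2)] by blast
    qed
  qed
  let ?Z = "sub_rmod (?H n) (cocycles R A J n)"
  have Zm: "right_module S ?Z" by (rule right_module_sub_rmod[OF H Z])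
  have "rsubmodule S ?Z (coboundaries R A J n)"
  proof (cases n)
    case 0
    interpret Z: right_module S ?Z by (rule Zm)
    interpret I: right_module R "obj J n" by (rule I)
    have B: "coboundaries R A J n = {\<zero>\<^bsub>?Z\<^esub>}" using 0 by (simp add: z sub_rmod_def)
    show ?thesis unfolding B by (rule Z.rsubmoduleI) (use Z.M.zero_closed in auto)
  next
    case (Suc m)
    let ?D = "\<lambda>g. \<lambda>x\<in>carrier A. diff J m (g x)"
    have B: "coboundaries R A J n = ?D ` carrier (?H m)" using Suc by (simp add: hom_rmod_def)
    interpret H: right_module S "?H m" by (rule H)
    have DZ: "?D g \<in> cocycles R A J n" if "g \<in> carrier (?H m)" for g
    proof -
      have g: "g \<in> rhom R A (obj J m)" using that unfolding Hc by blast
      note gp = hp[OF g]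
      have "?D g \<in> rhom R A (obj J n)" unfolding rhom_def Suc using gp(1-3) by (auto simp: dp)
      then show ?thesis unfolding Zc Hc using gp(1) by (auto simp: Suc dd)
    qed
    show ?thesis
    proof (rule right_module.rsubmoduleI[OF Zm])
      show "coboundaries R A J n \<subseteq> carrier ?Z" using DZ unfolding B by (auto simp: sub_rmod_def)
      have "\<zero>\<^bsub>?Z\<^esub> = ?D \<zero>\<^bsub>?H m\<^esub>" using Suc by (auto simp: sub_rmod_def z dp)
      then show "\<zero>\<^bsub>?Z\<^esub> \<in> coboundaries R A J n" unfolding B using H.M.zero_closed by blast
    next
      fix f g assume "f \<in> coboundaries R A J n" "g \<in> coboundaries R A J n"
      then obtain f' g' where fg: "f = ?D f'" "g = ?D g'" "f' \<in> carrier (?H m)" "g' \<in> carrier (?H m)"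
        unfolding B by blast
      then have "f \<oplus>\<^bsub>?Z\<^esub> g = ?D (f' \<oplus>\<^bsub>?H m\<^esub> g')"
        using hp(1)[of f' m] hp(1)[of g' m] unfolding Suc Hc
        by (simp add: sub_rmod_def hom_rmod_def dp cong: restrict_cong)
      then show "f \<oplus>\<^bsub>?Z\<^esub> g \<in> coboundaries R A J n" unfolding B using fg by blast
    next
      fix f s assume "f \<in> coboundaries R A J n" and s: "s \<in> carrier S"
      then obtain f' where f: "f = ?D f'" "f' \<in> carrier (?H m)" unfolding B by blast
      then have "f \<cdot>\<^bsub>?Z\<^esub> s = ?D (f' \<cdot>\<^bsub>?H m\<^esub> s)"
        using lp(1)[OF s] by (auto simp: sub_rmod_def ac)
      then show "f \<cdot>\<^bsub>?Z\<^esub> s \<in> coboundaries R A J n" unfolding B using f s by blast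
    qed
  qed
  then show ?thesis unfolding Ext_def by (rule right_module_quot(1)[OF Zm])
qed

lemma right_module_Ext_quot:
  assumes "ideal I R" and J: "injective_resolution R N J"
  shows "right_module (R Quot I) (Ext_quot R I J n)"
proof -
  interpret ideal I R by fact
  interpret reg: right_module R "regular_rmod R" by (rule right_module_regular) (rule ring_axioms)
  let ?A = "quot_rmod (regular_rmod R) I"
  have I: "rsubmodule R (regular_rmod R) I"
    by (rule reg.rsubmoduleI) (auto simp: regular_rmod_def a_subset I_r_closed dest: a_Hcarr)
  note A = right_module_quot[OF reg.right_module_axioms I]
  interpret Q: ring "R Quot I" by (rule quotient_is_ring)
  have cos: "I +>\<^bsub>regular_rmod R\<^esub> x = I +>\<^bsub>R\<^esub> x" for x by (simp add: a_r_coset_def' regular_rmod_def)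
  have car: "carrier ?A = carrier (R Quot I)"
    by (simp add: quot_rmod_def FactRing_def A_RCOSETS_def' cos) (simp add: regular_rmod_def)
  have add: "add ?A = add (R Quot I)"
    by (intro ext) (simp add: quot_rmod_def FactRing_def set_add_def' regular_rmod_def)
  have act: "x \<cdot>\<^bsub>?A\<^esub> r = x \<otimes>\<^bsub>R Quot I\<^esub> (I +>\<^bsub>R\<^esub> r)" if "x \<in> carrier ?A" "r \<in> carrier R" for x r
  proof -
    from that obtain a where a: "a \<in> carrier R" "x = I +>\<^bsub>R\<^esub> a"
      by (auto simp: car FactRing_def A_RCOSETS_def')
    have c: "carrier (regular_rmod R) = carrier R" "a \<cdot>\<^bsub>regular_rmod R\<^esub> r = a \<otimes>\<^bsub>R\<^esub> r"
      by (simp_all add: regular_rmod_def)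
    have "x \<cdot>\<^bsub>?A\<^esub> r = I +>\<^bsub>R\<^esub> (a \<otimes>\<^bsub>R\<^esub> r)"
      using A(2)[of a r, unfolded cos c] a that(2) by simp
    also have "\<dots> = x \<otimes>\<^bsub>R Quot I\<^esub> (I +>\<^bsub>R\<^esub> r)"
      using rcoset_mult_add[OF a(1) that(2)] a(2) by (simp add: FactRing_def)
    finally show ?thesis .
  qed
  have r: "I +>\<^bsub>R\<^esub> r \<in> carrier (R Quot I)" if "r \<in> carrier R" for r
    using that by (auto simp: FactRing_def A_RCOSETS_def')
  show ?thesis unfolding Ext_quot_def
  proof (rule right_module_Ext[OF A(1) _ _ _ _ _ J])
    fix s assume s: "s \<in> carrier (R Quot I)"
    show "(\<lambda>D. s \<otimes>\<^bsub>R Quot I\<^esub> D) \<in> rhom R ?A ?A"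
      unfolding rhom_def using s r
      by (auto simp: car add act Q.r_distr Q.m_assoc)
  qed (auto simp: car add Q.ring_axioms Q.l_distr Q.m_assoc)
qed

end

theory Submission
  imports Defs
begin

text \<open>
  Let \<open>N\<close> be the annihilator of \<open>Q\<close> in \<open>E\<close>, and \<open>N'\<close> that of \<open>P\<close>. The natural map sends \<open>x + U\<close> to the class
  of the cocycle \<open>r + P \<mapsto> d(h(xr))\<close>, where \<open>h\<close> extends the augmentation of \<open>N\<close> to \<open>E\<close>. As \<open>N\<close> is essential
  in \<open>E\<close>, \<open>h\<close> is injective, and so the class vanishes iff \<open>x \<in> N + N'\<close>. Nonzero submodules of \<open>E\<close>
  meet \<open>U\<close>, so their annihilators lie inside \<open>Q\<close>. Hence \<open>N' = 0\<close> if \<open>P\<close> is not contained in \<open>Q\<close>, while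
  \<open>N \<subseteq> N'\<close> if \<open>P \<subseteq> Q\<close>. In the former case the natural map is injective. In the latter its kernel is
  \<open>ann\<^sub>M(P)/U\<close>, which is nonzero exactly in situation (i). So the natural map is an embedding iff (i) fails
  (\<open>natural_embedding_iff\<close>), and the two situations exclude each other.

  Suppose that (i) fails, and put \<open>T = P\<close> if \<open>P \<subseteq> Q\<close> and \<open>T = Q\<close> otherwise. Then \<open>U\<close> is the annihilator of
  \<open>T\<close> in \<open>M\<close>. Choose \<open>m\<close> such that \<open>(mR + U)/U\<close> is uniform. If \<open>E\<close> is split into finitely many summands,
  the elements of \<open>mR\<close> whose projection to a given summand is annihilated by \<open>T\<close> form a submodule, and
  these submodules intersect in \<open>mR \<inter> U\<close>. By uniformity one of them is \<open>mR \<inter> U\<close>. The corresponding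
  summand can be taken to be uniform (\<open>uniform_summand_separating\<close>). The argument for the natural
  map then embeds \<open>(mR + U)/U\<close> into the \<open>Ext\<close> module of this summand, and nonzero submodules of \<open>M/U\<close> are
  faithful over \<open>R/P\<close> (\<open>fully_faithful_summand\<close>).

  For the last claim, let \<open>xc \<in> U\<close> with \<open>c\<close> regular modulo \<open>P\<close>, and \<open>x \<notin> U\<close>. Consider the right ideals
  \<open>N \<subseteq> P\<close> that contain the annihilator \<open>A\<close> of \<open>M\<close> and some \<open>K(P \<inter> Q)\<close>, where \<open>K\<close> is a right ideal
  essential modulo \<open>P\<close>. As \<open>R\<close> has finite right rank, one of them contains all smaller ones as essential
  submodules modulo \<open>A\<close> (\<open>right_noetherian_essential_member\<close>). For each \<open>r\<close>, the right ideal
  \<open>{n \<in> N. xrn = 0}\<close> is of the same kind, because \<open>{k. xrk \<in> U}\<close> is essential modulo \<open>P\<close> and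
  \<open>U(P \<inter> Q) = 0\<close>. So \<open>xrN \<subseteq> U\<close> is singular over \<open>R/Q\<close>. If \<open>U\<close> is torsionfree, then it is nonsingular
  by Goldie's theorem on essential right ideals, and so \<open>xRK(P \<inter> Q) = 0\<close>. When (i) fails, \<open>P \<inter> Q\<close>
  annihilates no element outside \<open>U\<close>. Therefore \<open>xRK \<subseteq> U\<close>, which gives the contradiction \<open>K \<subseteq> P\<close>
  (\<open>torsion_mod_U\<close>).
\<close>


section \<open>Submodules and homomorphisms\<close>

lemma (in abelian_group) minus_eq_zero_iff:
  assumes "x \<in> carrier G" "y \<in> carrier G" shows "x \<ominus> y = \<zero> \<longleftrightarrow> x = y"
proof
  assume "x \<ominus> y = \<zero>"
  then have "x \<oplus> \<ominus> y = \<zero>" by (simp add: a_minus_def)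
  then have "\<ominus> (\<ominus> y) = x" using assms by (intro minus_equality) auto
  then show "x = y" using assms by simp
qed (use assms in \<open>simp add: a_minus_def r_neg\<close>)

abbreviation right_ideal :: "('r, 'x) ring_scheme \<Rightarrow> 'r set \<Rightarrow> bool" where
  "right_ideal R I \<equiv> rsubmodule R (regular_rmod R) I"

lemma rsubmodule_sub_rmod_iff:
  assumes "right_module R M" "rsubmodule R M N"
  shows "rsubmodule R (sub_rmod M N) V \<longleftrightarrow> rsubmodule R M V \<and> V \<subseteq> N"
proof -
  interpret right_module R M by fact
  interpret S: right_module R "sub_rmod M N" by (rule right_module_sub_rmod[OF assms])
  note N = rsubmoduleD[OF assms(2)]
  show ?thesis
  proof
    assume V: "rsubmodule R (sub_rmod M N) V"
    note V = S.rsubmoduleD[OF V]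
    show "rsubmodule R M V \<and> V \<subseteq> N"
      using V N(1) by (intro conjI rsubmoduleI) (auto simp: sub_rmod_def)
  next
    assume V: "rsubmodule R M V \<and> V \<subseteq> N"
    note V' = rsubmoduleD[OF V[THEN conjunct1]]
    show "rsubmodule R (sub_rmod M N) V"
      using V V'(2-4) by (intro S.rsubmoduleI) (auto simp: sub_rmod_def)
  qed
qed

lemma rhom_minus:
  assumes "right_module R M" "right_module R N" "f \<in> rhom R M N" "x \<in> carrier M" "y \<in> carrier M"
  shows "f (x \<ominus>\<^bsub>M\<^esub> y) = f x \<ominus>\<^bsub>N\<^esub> f y"
proof -
  interpret M: right_module R M by fact
  interpret N: right_module R N by fact
  note f = rhom_props[OF assms(1-3)]
  have "f (\<ominus>\<^bsub>M\<^esub> y) = \<ominus>\<^bsub>N\<^esub> f y"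
    using f(3)[OF assms(5), of "\<ominus>\<^bsub>R\<^esub> \<one>\<^bsub>R\<^esub>"] f(1) assms(5) by (simp add: M.minus_one_act N.minus_one_act)
  then show ?thesis using f(2) assms(4,5) by (simp add: a_minus_def)
qed

lemma rsubmodule_image:
  assumes M: "right_module R M" and N: "right_module R N" and f: "f \<in> rhom R M N"
    and V: "rsubmodule R M V"
  shows "rsubmodule R N (f ` V)"
proof -
  interpret M: right_module R M by fact
  interpret N: right_module R N by fact
  note Vi = M.rsubmoduleD[OF V] and fp = rhom_props[OF M N f]
  have VM: "x \<in> carrier M" if "x \<in> V" for x using that Vi(1) by blast
  show ?thesis
  proof (rule N.rsubmoduleI)
    show "f ` V \<subseteq> carrier N" using fp(1) VM by blast
    show "\<zero>\<^bsub>N\<^esub> \<in> f ` V" using fp(4) Vi(2) by (metis imageI)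
    show "x \<oplus>\<^bsub>N\<^esub> y \<in> f ` V" if "x \<in> f ` V" "y \<in> f ` V" for x y
      using that fp(2) VM Vi(3) by (auto simp flip: fp(2))
    show "x \<cdot>\<^bsub>N\<^esub> r \<in> f ` V" if "x \<in> f ` V" "r \<in> carrier R" for x r
      using that fp(3) VM Vi(4) by (auto simp flip: fp(3))
  qed
qed

lemma rsubmodule_preimage:
  assumes M: "right_module R M" and N: "right_module R N" and f: "f \<in> rhom R M N"
    and V: "rsubmodule R N V"
  shows "rsubmodule R M {x \<in> carrier M. f x \<in> V}"
proof -
  interpret M: right_module R M by fact
  interpret N: right_module R N by fact
  show ?thesis
    by (rule M.rsubmoduleI) (use N.rsubmoduleD[OF V] in \<open>auto simp: rhom_props[OF M N f]\<close>)
qed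

context right_module begin

lemma rsubmodule_minus:
  "rsubmodule R M N \<Longrightarrow> x \<in> N \<Longrightarrow> y \<in> N \<Longrightarrow> x \<ominus>\<^bsub>M\<^esub> y \<in> N"
  unfolding a_minus_def by (intro rsubmoduleD(3,5)) auto

lemma rsubmodule_carrier: "rsubmodule R M (carrier M)"
  by (rule rsubmoduleI) auto

lemma rsubmodule_zero: "rsubmodule R M {\<zero>\<^bsub>M\<^esub>}"
  by (rule rsubmoduleI) auto

lemma rsubmodule_Int:
  assumes "rsubmodule R M V" "rsubmodule R M W" shows "rsubmodule R M (V \<inter> W)"
  using rsubmoduleD[OF assms(1)] rsubmoduleD[OF assms(2)] by (intro rsubmoduleI) auto

lemma act_hom: "x \<in> carrier M \<Longrightarrow> (\<lambda>r. x \<cdot>\<^bsub>M\<^esub> r) \<in> rhom R (regular_rmod R) M"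
  by (auto simp: rhom_def regular_rmod_def act_r_distr act_assoc)

lemma rsubmodule_cyclic:
  assumes x: "x \<in> carrier M" shows "rsubmodule R M ((\<lambda>r. x \<cdot>\<^bsub>M\<^esub> r) ` carrier R)"
proof -
  interpret reg: right_module R "regular_rmod R" by (rule right_module_regular) (rule R.ring_axioms)
  show ?thesis
    using rsubmodule_image[OF reg.right_module_axioms right_module_axioms act_hom[OF x] reg.rsubmodule_carrier]
    by (simp add: regular_rmod_def)
qed

lemma right_ideal_preimage:
  assumes "rsubmodule R M V" "x \<in> carrier M"
  shows "right_ideal R {r \<in> carrier R. x \<cdot>\<^bsub>M\<^esub> r \<in> V}"
  using rsubmodule_preimage[OF right_module_regular[OF R.ring_axioms] right_module_axioms act_hom] assms
  by (simp add: regular_rmod_def)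

lemma rsubmodule_residual:
  assumes T: "ideal T R" and V: "rsubmodule R M V"
  shows "rsubmodule R M {x \<in> carrier M. \<forall>t\<in>T. x \<cdot>\<^bsub>M\<^esub> t \<in> V}" (is "rsubmodule R M ?W")
proof (rule rsubmoduleI)
  interpret T: ideal T R by fact
  note Vi = rsubmoduleD[OF V]
  show "\<zero>\<^bsub>M\<^esub> \<in> ?W" using Vi(2) T.Icarr by auto
  show "x \<oplus>\<^bsub>M\<^esub> y \<in> ?W" if "x \<in> ?W" "y \<in> ?W" for x y
    using that Vi(3) T.Icarr by (auto simp: act_l_distr)
  show "x \<cdot>\<^bsub>M\<^esub> r \<in> ?W" if "x \<in> ?W" "r \<in> carrier R" for x r
    using that T.Icarr T.I_l_closed by (auto simp: act_assoc[symmetric])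
qed auto

lemma rsubmodule_set_add:
  assumes V: "rsubmodule R M V" and W: "rsubmodule R M W"
  shows "rsubmodule R M (V <+>\<^bsub>M\<^esub> W)" "V \<subseteq> V <+>\<^bsub>M\<^esub> W" "W \<subseteq> V <+>\<^bsub>M\<^esub> W"
proof -
  note V = rsubmoduleD[OF V] and W = rsubmoduleD[OF W]
  have mem: "x \<in> V <+>\<^bsub>M\<^esub> W \<longleftrightarrow> (\<exists>v\<in>V. \<exists>w\<in>W. x = v \<oplus>\<^bsub>M\<^esub> w)" for x by (auto simp: set_add_def')
  show "V \<subseteq> V <+>\<^bsub>M\<^esub> W"
  proof
    fix v assume "v \<in> V"
    then show "v \<in> V <+>\<^bsub>M\<^esub> W" unfolding mem using V(1) W(2)
      by (intro bexI[of _ v] bexI[of _ "\<zero>\<^bsub>M\<^esub>"]) auto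
  qed
  show "W \<subseteq> V <+>\<^bsub>M\<^esub> W"
  proof
    fix w assume "w \<in> W"
    then show "w \<in> V <+>\<^bsub>M\<^esub> W" unfolding mem using W(1) V(2)
      by (intro bexI[of _ "\<zero>\<^bsub>M\<^esub>"] bexI[of _ w]) auto
  qed
  show "rsubmodule R M (V <+>\<^bsub>M\<^esub> W)"
  proof (rule rsubmoduleI)
    show "V <+>\<^bsub>M\<^esub> W \<subseteq> carrier M" using V(1) W(1) by (auto simp: mem subset_iff)
    show "\<zero>\<^bsub>M\<^esub> \<in> V <+>\<^bsub>M\<^esub> W" using \<open>V \<subseteq> V <+>\<^bsub>M\<^esub> W\<close> V(2) by blast
  next
    fix x y assume "x \<in> V <+>\<^bsub>M\<^esub> W" "y \<in> V <+>\<^bsub>M\<^esub> W"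
    then obtain v w v' w' where *: "v \<in> V" "w \<in> W" "v' \<in> V" "w' \<in> W"
      "x = v \<oplus>\<^bsub>M\<^esub> w" "y = v' \<oplus>\<^bsub>M\<^esub> w'" unfolding mem by blast
    then have "v \<in> carrier M" "w \<in> carrier M" "v' \<in> carrier M" "w' \<in> carrier M" using V(1) W(1) by auto
    then have "x \<oplus>\<^bsub>M\<^esub> y = (v \<oplus>\<^bsub>M\<^esub> v') \<oplus>\<^bsub>M\<^esub> (w \<oplus>\<^bsub>M\<^esub> w')" using * by (simp add: M.a_ac)
    then show "x \<oplus>\<^bsub>M\<^esub> y \<in> V <+>\<^bsub>M\<^esub> W" unfolding mem using * V(3) W(3) by blast
  next
    fix x r assume "x \<in> V <+>\<^bsub>M\<^esub> W" and r: "r \<in> carrier R"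
    then obtain v w where *: "v \<in> V" "w \<in> W" "x = v \<oplus>\<^bsub>M\<^esub> w" unfolding mem by blast
    then have "v \<in> carrier M" "w \<in> carrier M" using V(1) W(1) by auto
    then have "x \<cdot>\<^bsub>M\<^esub> r = v \<cdot>\<^bsub>M\<^esub> r \<oplus>\<^bsub>M\<^esub> w \<cdot>\<^bsub>M\<^esub> r" using * r by (simp add: act_l_distr)
    then show "x \<cdot>\<^bsub>M\<^esub> r \<in> V <+>\<^bsub>M\<^esub> W" unfolding mem using * V(4) W(4) r by blast
  qed
qed

end

section \<open>Right ideals and the ascending chain condition\<close>

lemma (in ring) right_ideal_iff:
  "right_ideal R I \<longleftrightarrow> I \<subseteq> carrier R \<and> \<zero> \<in> I \<and> (\<forall>x\<in>I. \<forall>y\<in>I. x \<oplus> y \<in> I) \<and>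
     (\<forall>x\<in>I. \<forall>r\<in>carrier R. x \<otimes> r \<in> I)"
proof -
  interpret reg: right_module R "regular_rmod R"
    by (rule right_module_regular) (rule ring_axioms)
  show ?thesis
  proof
    assume "right_ideal R I"
    from reg.rsubmoduleD[OF this] show "I \<subseteq> carrier R \<and> \<zero> \<in> I \<and> (\<forall>x\<in>I. \<forall>y\<in>I. x \<oplus> y \<in> I) \<and>
      (\<forall>x\<in>I. \<forall>r\<in>carrier R. x \<otimes> r \<in> I)" by (simp add: regular_rmod_def)
  next
    assume "I \<subseteq> carrier R \<and> \<zero> \<in> I \<and> (\<forall>x\<in>I. \<forall>y\<in>I. x \<oplus> y \<in> I) \<and>
      (\<forall>x\<in>I. \<forall>r\<in>carrier R. x \<otimes> r \<in> I)"
    then show "right_ideal R I" by (intro reg.rsubmoduleI) (auto simp: regular_rmod_def)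
  qed
qed

lemma (in ring) right_idealD:
  assumes "right_ideal R I"
  shows "\<And>x. x \<in> I \<Longrightarrow> x \<in> carrier R" "\<zero> \<in> I" "\<And>x y. x \<in> I \<Longrightarrow> y \<in> I \<Longrightarrow> x \<oplus> y \<in> I"
    "\<And>x r. x \<in> I \<Longrightarrow> r \<in> carrier R \<Longrightarrow> x \<otimes> r \<in> I"
    "\<And>x y. x \<in> I \<Longrightarrow> y \<in> I \<Longrightarrow> x \<ominus> y \<in> I"
proof -
  from assms show *: "\<And>x. x \<in> I \<Longrightarrow> x \<in> carrier R" "\<zero> \<in> I" "\<And>x y. x \<in> I \<Longrightarrow> y \<in> I \<Longrightarrow> x \<oplus> y \<in> I"
    "\<And>x r. x \<in> I \<Longrightarrow> r \<in> carrier R \<Longrightarrow> x \<otimes> r \<in> I" by (auto simp: right_ideal_iff)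
  show "x \<ominus> y \<in> I" if "x \<in> I" "y \<in> I" for x y
  proof -
    have "y \<otimes> (\<ominus> \<one>) = \<ominus> y" using *(1)[OF that(2)] by (simp add: r_minus)
    then show ?thesis using *(3)[OF that(1) *(4)[OF that(2), of "\<ominus> \<one>"]] by (simp add: a_minus_def)
  qed
qed

lemma (in ring) right_ideal_Int:
  "right_ideal R I \<Longrightarrow> right_ideal R I' \<Longrightarrow> right_ideal R (I \<inter> I')"
  unfolding right_ideal_iff by blast

lemma (in ring) right_ideal_principal:
  assumes "c \<in> carrier R" shows "right_ideal R ((\<lambda>r. c \<otimes> r) ` carrier R)"
  using right_module.rsubmodule_cyclic[OF right_module_regular[OF ring_axioms], of c] assms
  by (simp add: regular_rmod_def)

lemma (in ring) right_ideal_add_principal: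
  assumes D: "right_ideal R D" and c: "c \<in> carrier R"
  shows "right_ideal R {d \<oplus> c \<otimes> r | d r. d \<in> D \<and> r \<in> carrier R}" (is "right_ideal R ?D")
proof -
  have "?D = D <+>\<^bsub>regular_rmod R\<^esub> (\<lambda>r. c \<otimes> r) ` carrier R"
    by (auto simp: set_add_def' regular_rmod_def)
  then show ?thesis
    using right_module.rsubmodule_set_add(1)[OF right_module_regular[OF ring_axioms] D right_ideal_principal[OF c]]
    by simp
qed

lemma right_noetherian_maximal:
  assumes R: "right_noetherian R" and ne: "F \<noteq> {}" and F: "\<And>X. X \<in> F \<Longrightarrow> right_ideal R X"
  shows "\<exists>X\<in>F. \<forall>Y\<in>F. X \<subseteq> Y \<longrightarrow> Y = X"
proof (rule ccontr)
  assume "\<not> ?thesis"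
  then have "\<forall>X\<in>F. \<exists>Y. Y \<in> F \<and> X \<subset> Y" by blast
  then obtain nxt where nx: "\<And>X. X \<in> F \<Longrightarrow> nxt X \<in> F" "\<And>X. X \<in> F \<Longrightarrow> X \<subset> nxt X" by metis
  obtain X0 where X0: "X0 \<in> F" using ne by blast
  define I where "I n = (nxt ^^ n) X0" for n
  have IF: "I n \<in> F" for n by (induction n) (auto simp: I_def X0 nx)
  have strict: "I n \<subset> I (Suc n)" for n using nx(2)[OF IF[of n]] by (simp add: I_def)
  then have "\<forall>n. right_ideal R (I n) \<and> I n \<subseteq> I (Suc n)" using F[OF IF] by blast
  then obtain n where "\<forall>m\<ge>n. I m = I n" using R unfolding right_noetherian_def by blast
  then have "I (Suc n) = I n" using le_SucI[of n n] by blast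
  then show False using strict[of n] by simp
qed

text \<open>A right noetherian ring has no infinite direct sums of right ideals, so descending chains
  become stationary up to essential submodules. In this form: any nonempty family \<open>\<N>\<close> has a member
  \<open>N\<close> in which all smaller members are essential, everything modulo \<open>A\<close>. To find it, take \<open>D\<close>
  maximal among the right ideals that are independent of some member \<open>N\<close>. If \<open>c\<close> violated the claim
  for \<open>N' \<subseteq> N\<close>, then \<open>D + cR\<close> would be independent of \<open>N'\<close>.\<close>

lemma right_noetherian_essential_member:
  fixes R (structure)
  assumes R: "right_noetherian R" and A: "right_ideal R A"
    and ne: "\<N> \<noteq> {}" and \<N>: "\<And>N. N \<in> \<N> \<Longrightarrow> right_ideal R N"
    and AN: "\<And>N. N \<in> \<N> \<Longrightarrow> A \<subseteq> N"
  obtains N where "N \<in> \<N>"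
    "\<And>N' c. N' \<in> \<N> \<Longrightarrow> N' \<subseteq> N \<Longrightarrow> c \<in> N \<Longrightarrow> c \<notin> A \<Longrightarrow>
       \<exists>r\<in>carrier R. c \<otimes> r \<in> N' \<and> c \<otimes> r \<notin> A"
proof -
  interpret ring R using R by (simp add: right_noetherian_def)
  note A = right_idealD[OF A]
  define F where "F = {D. right_ideal R D \<and> (\<exists>N\<in>\<N>. D \<inter> N \<subseteq> A)}"
  have "{\<zero>} \<in> F" using ne A(2) by (auto simp: F_def right_ideal_iff)
  then have "F \<noteq> {}" by blast
  then have "\<exists>D\<in>F. \<forall>Y\<in>F. D \<subseteq> Y \<longrightarrow> Y = D"
    by (rule right_noetherian_maximal[OF R]) (simp add: F_def)
  then obtain D where D: "D \<in> F" and max: "\<And>Y. Y \<in> F \<Longrightarrow> D \<subseteq> Y \<Longrightarrow> Y = D" by blast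
  from D obtain N where N: "N \<in> \<N>" and DN: "D \<inter> N \<subseteq> A" and rD: "right_ideal R D"
    by (auto simp: F_def)
  note Di = right_idealD[OF rD] and Ni = right_idealD[OF \<N>[OF N]]
  have "\<exists>r\<in>carrier R. c \<otimes> r \<in> N' \<and> c \<otimes> r \<notin> A"
    if N': "N' \<in> \<N>" "N' \<subseteq> N" and c: "c \<in> N" "c \<notin> A" for N' c
  proof (rule ccontr)
    assume "\<not> ?thesis"
    then have ind: "\<And>r. r \<in> carrier R \<Longrightarrow> c \<otimes> r \<in> N' \<Longrightarrow> c \<otimes> r \<in> A" by blast
    note Ni' = right_idealD[OF \<N>[OF N'(1)]]
    have cR: "c \<in> carrier R" using Ni(1) c(1) .
    let ?D = "{d \<oplus> c \<otimes> r | d r. d \<in> D \<and> r \<in> carrier R}"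
    have "?D \<inter> N' \<subseteq> A"
    proof clarify
      fix d r assume d: "d \<in> D" and r: "r \<in> carrier R" and m: "d \<oplus> c \<otimes> r \<in> N'"
      have dR: "d \<in> carrier R" using Di(1) d .
      have "(d \<oplus> c \<otimes> r) \<ominus> c \<otimes> r \<in> N" using Ni(5) m N'(2) Ni(4)[OF c(1) r] by blast
      moreover have "(d \<oplus> c \<otimes> r) \<ominus> c \<otimes> r = d" using dR cR r by algebra
      ultimately have dA: "d \<in> A" using DN d by (metis IntI subsetD)
      have "(d \<oplus> c \<otimes> r) \<ominus> d \<in> N'"
        using Ni'(5)[OF m] AN[OF N'(1)] dA by blast
      moreover have "(d \<oplus> c \<otimes> r) \<ominus> d = c \<otimes> r" using dR cR r by algebra
      ultimately have "c \<otimes> r \<in> A" using ind[OF r] by simp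
      then show "d \<oplus> c \<otimes> r \<in> A" using A(3) dA by blast
    qed
    then have "?D \<in> F"
      unfolding F_def using right_ideal_add_principal[OF rD cR] N'(1)
      by (intro CollectI conjI bexI[of _ N'])
    moreover have "D \<subseteq> ?D"
    proof
      fix d assume "d \<in> D"
      then show "d \<in> ?D" using Di(1)[of d] cR by (intro CollectI exI[of _ d] exI[of _ \<zero>]) simp
    qed
    ultimately have "?D = D" by (rule max)
    moreover have "c \<in> ?D" using Di(2) cR by (intro CollectI exI[of _ \<zero>] exI[of _ \<one>]) simp
    ultimately have "c \<in> D" by (rule back_subst[where P="\<lambda>X. c \<in> X", rotated])
    then show False using DN c by blast
  qed
  then show thesis using N by (rule that[rotated])
qed

section \<open>Regular elements in essential right ideals\<close>

text \<open>If left multiplication by \<open>c\<close> is injective, it maps \<open>R\<close> onto \<open>cR\<close>, \<open>cR\<close> onto \<open>c\<^sup>2R\<close>, and so on. As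
  some \<open>c\<^sup>n\<^sup>+\<^sup>1R\<close> is essential in \<open>c\<^sup>nR\<close>, already \<open>cR\<close> is essential in \<open>R\<close>.\<close>

lemma essential_principal_right_ideal:
  fixes R (structure)
  assumes R: "right_noetherian R" and c: "c \<in> carrier R"
    and inj: "\<And>x. x \<in> carrier R \<Longrightarrow> c \<otimes> x = \<zero> \<Longrightarrow> x = \<zero>"
    and s: "s \<in> carrier R" "s \<noteq> \<zero>"
  shows "\<exists>r\<in>carrier R. \<exists>t\<in>carrier R. s \<otimes> r = c \<otimes> t \<and> s \<otimes> r \<noteq> \<zero>"
proof -
  interpret ring R using R by (simp add: right_noetherian_def)
  let ?N = "\<lambda>n::nat. (\<lambda>x. (c [^] n) \<otimes> x) ` carrier R"
  have p: "c [^] n \<in> carrier R" for n :: nat using c by simp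
  have inj_n: "x = \<zero>" if "x \<in> carrier R" "(c [^] n) \<otimes> x = \<zero>" for x and n :: nat
    using that
  proof (induction n)
    case (Suc n)
    then have "(c [^] n) \<otimes> (c \<otimes> x) = \<zero>" using c p by (simp add: m_assoc)
    have "c \<otimes> ((c [^] n) \<otimes> x) = \<zero>"
      using Suc.prems c p by (simp add: m_assoc[symmetric] nat_pow_Suc2[symmetric] del: nat_pow_Suc)
    then show ?case using inj Suc p by simp
  qed simp
  have ri: "right_ideal R (?N n)" for n by (rule right_ideal_principal[OF p])
  have Z: "right_ideal R {\<zero>}" by (simp add: right_ideal_iff)
  obtain N where N: "N \<in> range ?N"
    and ess: "\<And>N' x. N' \<in> range ?N \<Longrightarrow> N' \<subseteq> N \<Longrightarrow> x \<in> N \<Longrightarrow> x \<notin> {\<zero>} \<Longrightarrow>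
      \<exists>r\<in>carrier R. x \<otimes> r \<in> N' \<and> x \<otimes> r \<notin> {\<zero>}"
  proof (rule right_noetherian_essential_member[OF R Z, of "range ?N"])
    show "right_ideal R N" if "N \<in> range ?N" for N using that ri by blast
    then show "{\<zero>} \<subseteq> N" if "N \<in> range ?N" for N using that right_idealD(2) by blast
  qed auto
  from N obtain n where n: "N = ?N n" by blast
  have "?N (Suc n) \<subseteq> N"
  proof
    fix x assume "x \<in> ?N (Suc n)"
    then obtain a where "a \<in> carrier R" "x = (c [^] n) \<otimes> (c \<otimes> a)" using c p by (auto simp: m_assoc)
    then show "x \<in> N" unfolding n using c by blast
  qed
  moreover have "(c [^] n) \<otimes> s \<in> N" "(c [^] n) \<otimes> s \<notin> {\<zero>}" using n s inj_n by auto
  ultimately obtain r where r: "r \<in> carrier R" "(c [^] n) \<otimes> s \<otimes> r \<in> ?N (Suc n)" "(c [^] n) \<otimes> s \<otimes> r \<noteq> \<zero>"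
    using ess[OF rangeI] by (metis singleton_iff)
  from r(2) obtain t where t: "t \<in> carrier R" "(c [^] n) \<otimes> s \<otimes> r = (c [^] Suc n) \<otimes> t" by blast
  have "(c [^] n) \<otimes> (s \<otimes> r \<ominus> c \<otimes> t) = (c [^] n) \<otimes> s \<otimes> r \<ominus> (c [^] Suc n) \<otimes> t"
    using p[of n] c s r(1) t(1) by (simp add: m_assoc a_minus_def r_distr r_minus)
  also have "\<dots> = \<zero>" using t p[of "Suc n"] by (simp add: minus_eq_zero_iff del: nat_pow_Suc)
  finally have "s \<otimes> r \<ominus> c \<otimes> t = \<zero>" using inj_n c s r(1) t(1) by simp
  then have "s \<otimes> r = c \<otimes> t" using c s r(1) t(1) by (simp add: minus_eq_zero_iff)
  moreover have "s \<otimes> r \<noteq> \<zero>" using r p[of n] s by (auto simp: m_assoc)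
  ultimately show ?thesis using r(1) t(1) by blast
qed

text \<open>Primeness is stated for elements: \<open>aRb = 0\<close> only if \<open>a = 0\<close> or \<open>b = 0\<close>.\<close>

locale prime_right_noetherian = ring +
  assumes noetherian: "right_noetherian R"
    and prime: "\<lbrakk>a \<in> carrier R; b \<in> carrier R; \<And>s. s \<in> carrier R \<Longrightarrow> a \<otimes> s \<otimes> b = \<zero>\<rbrakk> \<Longrightarrow>
      a = \<zero> \<or> b = \<zero>"
begin

definition right_ann :: "'a \<Rightarrow> 'a set" where
  "right_ann a = {x \<in> carrier R. a \<otimes> x = \<zero>}"

lemma right_ideal_right_ann: "a \<in> carrier R \<Longrightarrow> right_ideal R (right_ann a)"
  unfolding right_ideal_iff right_ann_def by (auto simp: r_distr m_assoc[symmetric])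

lemma maximal_right_ann:
  assumes "a \<in> X" "X \<subseteq> carrier R"
  obtains b where "b \<in> X" "\<And>c. c \<in> X \<Longrightarrow> right_ann b \<subseteq> right_ann c \<Longrightarrow> right_ann c = right_ann b"
proof -
  have "\<exists>Y\<in>right_ann ` X. \<forall>Z\<in>right_ann ` X. Y \<subseteq> Z \<longrightarrow> Z = Y"
    by (rule right_noetherian_maximal[OF noetherian]) (use assms right_ideal_right_ann in auto)
  then show thesis using that by blast
qed

text \<open>Take \<open>a \<in> I\<close> nonzero with maximal right annihilator, and \<open>s\<close> with \<open>asa \<noteq> 0\<close>. Then \<open>asa\<close> and \<open>a\<close> have
  the same right annihilator, so \<open>b = as\<close> works: \<open>asast = 0\<close> gives \<open>ast = 0\<close>.\<close>

lemma right_ideal_nonnilpotent: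
  assumes I: "right_ideal R I" and ne: "x \<in> I" "x \<noteq> \<zero>"
  obtains b where "b \<in> I" "b \<noteq> \<zero>"
    "\<And>t. t \<in> carrier R \<Longrightarrow> b \<otimes> (b \<otimes> t) = \<zero> \<Longrightarrow> b \<otimes> t = \<zero>"
proof -
  note I = right_idealD[OF I]
  have "x \<in> I - {\<zero>}" "I - {\<zero>} \<subseteq> carrier R" using ne I(1) by auto
  then obtain a where a: "a \<in> I - {\<zero>}"
    and max: "\<And>c. c \<in> I - {\<zero>} \<Longrightarrow> right_ann a \<subseteq> right_ann c \<Longrightarrow> right_ann c = right_ann a"
    by (rule maximal_right_ann) blast
  have aR: "a \<in> carrier R" using a I(1) by blast
  then obtain s where s: "s \<in> carrier R" "a \<otimes> s \<otimes> a \<noteq> \<zero>" using prime[of a a] a by blast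
  have asa: "right_ann (a \<otimes> s \<otimes> a) = right_ann a"
  proof (rule max)
    show "a \<otimes> s \<otimes> a \<in> I - {\<zero>}" using a s aR I(4) by blast
    show "right_ann a \<subseteq> right_ann (a \<otimes> s \<otimes> a)" using aR s(1) by (auto simp: right_ann_def m_assoc)
  qed
  show thesis
  proof (rule that[of "a \<otimes> s"])
    show "a \<otimes> s \<in> I" using a s(1) I(4) by blast
    show "a \<otimes> s \<noteq> \<zero>" using s aR by auto
    fix t assume t: "t \<in> carrier R" "a \<otimes> s \<otimes> (a \<otimes> s \<otimes> t) = \<zero>"
    then have "s \<otimes> t \<in> right_ann (a \<otimes> s \<otimes> a)" using aR s(1) by (simp add: right_ann_def m_assoc)
    then have "s \<otimes> t \<in> right_ann a" unfolding asa .
    then show "a \<otimes> s \<otimes> t = \<zero>" using aR s(1) t(1) by (simp add: right_ann_def m_assoc)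
  qed
qed

text \<open>The right singular ideal is zero: among its nonzero elements take \<open>d\<close> with maximal right
  annihilator and \<open>s\<close> with \<open>dsd \<noteq> 0\<close>. The right annihilator of \<open>d\<close> meets \<open>sdR\<close>, so that of \<open>dsd\<close> is
  larger than that of \<open>d\<close>.\<close>

lemma right_nonsingular:
  assumes d: "d \<in> carrier R"
    and ess: "\<And>s. s \<in> carrier R \<Longrightarrow> s \<noteq> \<zero> \<Longrightarrow> \<exists>r\<in>carrier R. s \<otimes> r \<noteq> \<zero> \<and> d \<otimes> (s \<otimes> r) = \<zero>"
  shows "d = \<zero>"
proof (rule ccontr)
  assume "d \<noteq> \<zero>"
  define X where "X = {d \<in> carrier R. d \<noteq> \<zero> \<and>
    (\<forall>s\<in>carrier R. s \<noteq> \<zero> \<longrightarrow> (\<exists>r\<in>carrier R. s \<otimes> r \<noteq> \<zero> \<and> d \<otimes> (s \<otimes> r) = \<zero>))}"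
  have "d \<in> X" "X \<subseteq> carrier R" using d \<open>d \<noteq> \<zero>\<close> ess by (auto simp: X_def)
  then obtain a where a: "a \<in> X"
    and max: "\<And>c. c \<in> X \<Longrightarrow> right_ann a \<subseteq> right_ann c \<Longrightarrow> right_ann c = right_ann a"
    by (rule maximal_right_ann) blast
  have aR: "a \<in> carrier R" "a \<noteq> \<zero>"
    and ea: "\<And>s. s \<in> carrier R \<Longrightarrow> s \<noteq> \<zero> \<Longrightarrow> \<exists>r\<in>carrier R. s \<otimes> r \<noteq> \<zero> \<and> a \<otimes> (s \<otimes> r) = \<zero>"
    using a by (auto simp: X_def)
  obtain s where s: "s \<in> carrier R" "a \<otimes> s \<otimes> a \<noteq> \<zero>" using prime[of a a] aR by blast
  have "a \<otimes> s \<otimes> a \<in> X"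
    unfolding X_def
  proof (intro CollectI conjI ballI impI)
    fix u assume u: "u \<in> carrier R" "u \<noteq> \<zero>"
    then obtain r where r: "r \<in> carrier R" "u \<otimes> r \<noteq> \<zero>" "a \<otimes> (u \<otimes> r) = \<zero>" using ea by blast
    then have "a \<otimes> s \<otimes> a \<otimes> (u \<otimes> r) = \<zero>" using aR s(1) u(1) by (simp add: m_assoc)
    then show "\<exists>r\<in>carrier R. u \<otimes> r \<noteq> \<zero> \<and> a \<otimes> s \<otimes> a \<otimes> (u \<otimes> r) = \<zero>" using r by blast
  qed (use s aR in auto)
  then have eq: "right_ann (a \<otimes> s \<otimes> a) = right_ann a"
    by (rule max) (use aR s(1) in \<open>auto simp: right_ann_def m_assoc\<close>)
  have "s \<otimes> a \<noteq> \<zero>" using s aR by (auto simp: m_assoc)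
  then obtain r where r: "r \<in> carrier R" "s \<otimes> a \<otimes> r \<noteq> \<zero>" "a \<otimes> (s \<otimes> a \<otimes> r) = \<zero>"
    using ea s(1) aR(1) by (metis m_closed)
  have "r \<in> right_ann (a \<otimes> s \<otimes> a)" using r aR s(1) by (simp add: right_ann_def m_assoc)
  then have "a \<otimes> r = \<zero>" unfolding eq by (simp add: right_ann_def)
  then show False using r aR s(1) by (simp add: m_assoc)
qed

text \<open>Goldie's theorem on essential right ideals. Call \<open>c \<in> I\<close> good if \<open>c\<close> and \<open>c\<^sup>2\<close> have the same right
  annihilator, and take a good \<open>c\<close> such that the right annihilators of good elements inside that of
  \<open>c\<close> are essential in it. If some nonzero element of \<open>I\<close> were annihilated by \<open>c\<close>, there would be a good
  \<open>b \<noteq> 0\<close> with \<open>cb = 0\<close>. Then \<open>c + b\<close> is good, with right annihilator \<open>{x. bx = cx = 0}\<close>, and so \<open>bR\<close>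
  meets the right annihilator of \<open>b\<close>, which contradicts that \<open>b\<close> is good. As \<open>I\<close> is essential, the right
  annihilator of \<open>c\<close> is zero. Then \<open>cR\<close> is essential, so \<open>dc = 0\<close> only for singular \<open>d\<close>, that is, \<open>d = 0\<close>.\<close>

lemma essential_right_ideal_regular_element:
  assumes I: "right_ideal R I"
    and ess: "\<And>s. s \<in> carrier R \<Longrightarrow> s \<noteq> \<zero> \<Longrightarrow> \<exists>r\<in>carrier R. s \<otimes> r \<in> I \<and> s \<otimes> r \<noteq> \<zero>"
  shows "\<exists>c\<in>I. c \<in> regular_elements R"
proof -
  note Ii = right_idealD[OF I]
  define G where "G = {c \<in> I. \<forall>t\<in>carrier R. c \<otimes> (c \<otimes> t) = \<zero> \<longrightarrow> c \<otimes> t = \<zero>}"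
  have GR: "c \<in> carrier R" if "c \<in> G" for c using that Ii(1) by (auto simp: G_def)
  have "\<zero> \<in> G" using Ii(2) by (auto simp: G_def)
  have Z: "right_ideal R {\<zero>}" by (simp add: right_ideal_iff)
  obtain N where N: "N \<in> right_ann ` G"
    and en: "\<And>N' x. N' \<in> right_ann ` G \<Longrightarrow> N' \<subseteq> N \<Longrightarrow> x \<in> N \<Longrightarrow> x \<notin> {\<zero>} \<Longrightarrow>
      \<exists>r\<in>carrier R. x \<otimes> r \<in> N' \<and> x \<otimes> r \<notin> {\<zero>}"
  proof (rule right_noetherian_essential_member[OF noetherian Z, of "right_ann ` G"])
    show "right_ann ` G \<noteq> {}" using \<open>\<zero> \<in> G\<close> by blast
    show "right_ideal R N" if "N \<in> right_ann ` G" for N using that right_ideal_right_ann GR by blast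
    then show "{\<zero>} \<subseteq> N" if "N \<in> right_ann ` G" for N using that right_idealD(2) by blast
  qed auto
  from N obtain c where c: "c \<in> G" and Nc: "N = right_ann c" by blast
  have cI: "c \<in> I" and c2: "\<And>t. t \<in> carrier R \<Longrightarrow> c \<otimes> (c \<otimes> t) = \<zero> \<Longrightarrow> c \<otimes> t = \<zero>"
    using c by (auto simp: G_def)
  have cR: "c \<in> carrier R" using GR[OF c] .
  have inI: "x = \<zero>" if x: "x \<in> I" "c \<otimes> x = \<zero>" for x
  proof (rule ccontr)
    assume "x \<noteq> \<zero>"
    have "right_ideal R (right_ann c \<inter> I)"
      by (rule right_ideal_Int[OF right_ideal_right_ann[OF cR] I])
    moreover have "x \<in> right_ann c \<inter> I" using x Ii(1) by (auto simp: right_ann_def)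
    ultimately obtain b where b: "b \<in> right_ann c \<inter> I" "b \<noteq> \<zero>"
      and b2: "\<And>t. t \<in> carrier R \<Longrightarrow> b \<otimes> (b \<otimes> t) = \<zero> \<Longrightarrow> b \<otimes> t = \<zero>"
      using \<open>x \<noteq> \<zero>\<close> by (rule right_ideal_nonnilpotent) blast
    have bR: "b \<in> carrier R" and bI: "b \<in> I" and cb: "c \<otimes> b = \<zero>" using b by (auto simp: right_ann_def)
    have cbt: "c \<otimes> (b \<otimes> t) = \<zero>" if "t \<in> carrier R" for t
      using that bR cR cb by (simp add: m_assoc[symmetric])
    have sum: "c \<otimes> t = \<zero> \<and> b \<otimes> t = \<zero>" if t: "t \<in> carrier R" and "(c \<oplus> b) \<otimes> t = \<zero>" for t
    proof -
      have s: "c \<otimes> t \<oplus> b \<otimes> t = \<zero>" using that bR cR by (simp add: l_distr)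
      then have "c \<otimes> (c \<otimes> t \<oplus> b \<otimes> t) = \<zero>" using cR by simp
      then have "c \<otimes> (c \<otimes> t) = \<zero>" using t bR cR by (simp add: r_distr cbt)
      then have "c \<otimes> t = \<zero>" using c2 t by blast
      then show ?thesis using s t bR by simp
    qed
    have "c \<oplus> b \<in> G"
      unfolding G_def
    proof (intro CollectI conjI ballI impI)
      show "c \<oplus> b \<in> I" using cI bI Ii(3) by blast
      fix t assume t: "t \<in> carrier R" and "(c \<oplus> b) \<otimes> ((c \<oplus> b) \<otimes> t) = \<zero>"
      then have *: "c \<otimes> ((c \<oplus> b) \<otimes> t) = \<zero>" "b \<otimes> ((c \<oplus> b) \<otimes> t) = \<zero>" using sum cR bR by auto
      then have "c \<otimes> (c \<otimes> t) = \<zero>" using t bR cR by (simp add: r_distr l_distr cbt)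
      then have ct: "c \<otimes> t = \<zero>" using c2 t by blast
      then have "b \<otimes> (b \<otimes> t) = \<zero>" using *(2) t bR cR by (simp add: l_distr)
      then have "b \<otimes> t = \<zero>" using b2 t by blast
      then show "(c \<oplus> b) \<otimes> t = \<zero>" using ct t bR cR by (simp add: l_distr)
    qed
    moreover have "right_ann (c \<oplus> b) \<subseteq> N" unfolding Nc using sum by (auto simp: right_ann_def)
    moreover have "b \<in> N" using b Nc by blast
    ultimately obtain r where r: "r \<in> carrier R" "b \<otimes> r \<in> right_ann (c \<oplus> b)" "b \<otimes> r \<noteq> \<zero>"
      using en[OF imageI] b(2) by (metis singleton_iff)
    then have "b \<otimes> (b \<otimes> r) = \<zero>" using sum by (auto simp: right_ann_def)
    then show False using b2 r by blast
  qed
  have inj: "x = \<zero>" if x: "x \<in> carrier R" "c \<otimes> x = \<zero>" for x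
  proof (rule ccontr)
    assume "x \<noteq> \<zero>"
    then obtain r where r: "r \<in> carrier R" "x \<otimes> r \<in> I" "x \<otimes> r \<noteq> \<zero>" using ess x(1) by blast
    have "c \<otimes> (x \<otimes> r) = \<zero>" using x r(1) cR by (simp add: m_assoc[symmetric])
    then show False using inI r by blast
  qed
  have "d = \<zero>" if d: "d \<in> carrier R" "d \<otimes> c = \<zero>" for d
  proof (rule right_nonsingular[OF d(1)])
    fix s assume "s \<in> carrier R" "s \<noteq> \<zero>"
    then obtain r t where r: "r \<in> carrier R" "t \<in> carrier R" "s \<otimes> r = c \<otimes> t" "s \<otimes> r \<noteq> \<zero>"
      using essential_principal_right_ideal[OF noetherian cR inj] by blast
    have "d \<otimes> (c \<otimes> t) = (d \<otimes> c) \<otimes> t" using d(1) cR r(2) by (simp add: m_assoc)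
    then have "d \<otimes> (s \<otimes> r) = \<zero>" unfolding r(3) using d(2) r(2) by simp
    then show "\<exists>r\<in>carrier R. s \<otimes> r \<noteq> \<zero> \<and> d \<otimes> (s \<otimes> r) = \<zero>"
      using r(1,4) by blast
  qed
  then have "c \<in> regular_elements R" unfolding regular_elements_def using cR inj by blast
  then show ?thesis using cI by blast
qed

end

section \<open>Essential and uniform submodules, direct sums\<close>

context right_module begin

lemma essential_submodule_iff:
  "essential_submodule R M U \<longleftrightarrow> rsubmodule R M U \<and>
     (\<forall>x\<in>carrier M. x \<noteq> \<zero>\<^bsub>M\<^esub> \<longrightarrow> (\<exists>r\<in>carrier R. x \<cdot>\<^bsub>M\<^esub> r \<in> U \<and> x \<cdot>\<^bsub>M\<^esub> r \<noteq> \<zero>\<^bsub>M\<^esub>))"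
proof
  assume U: "essential_submodule R M U"
  then have rU: "rsubmodule R M U" by (simp add: essential_submodule_def)
  have "\<exists>r\<in>carrier R. x \<cdot>\<^bsub>M\<^esub> r \<in> U \<and> x \<cdot>\<^bsub>M\<^esub> r \<noteq> \<zero>\<^bsub>M\<^esub>" if x: "x \<in> carrier M" "x \<noteq> \<zero>\<^bsub>M\<^esub>" for x
  proof -
    let ?V = "(\<lambda>r. x \<cdot>\<^bsub>M\<^esub> r) ` carrier R"
    have "x \<in> ?V" using x by (intro image_eqI[of _ _ "\<one>\<^bsub>R\<^esub>"]) auto
    then have "nonzero_submodule R M ?V"
      using rsubmodule_cyclic[OF x(1)] x(2) unfolding nonzero_submodule_def by blast
    then have "U \<inter> ?V \<noteq> {\<zero>\<^bsub>M\<^esub>}" using U by (simp add: essential_submodule_def)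
    moreover have "\<zero>\<^bsub>M\<^esub> \<in> U \<inter> ?V" using rsubmoduleD(2) rU rsubmodule_cyclic[OF x(1)] by blast
    ultimately show ?thesis by blast
  qed
  then show "rsubmodule R M U \<and>
     (\<forall>x\<in>carrier M. x \<noteq> \<zero>\<^bsub>M\<^esub> \<longrightarrow> (\<exists>r\<in>carrier R. x \<cdot>\<^bsub>M\<^esub> r \<in> U \<and> x \<cdot>\<^bsub>M\<^esub> r \<noteq> \<zero>\<^bsub>M\<^esub>))"
    using rU by blast
next
  assume U: "rsubmodule R M U \<and>
     (\<forall>x\<in>carrier M. x \<noteq> \<zero>\<^bsub>M\<^esub> \<longrightarrow> (\<exists>r\<in>carrier R. x \<cdot>\<^bsub>M\<^esub> r \<in> U \<and> x \<cdot>\<^bsub>M\<^esub> r \<noteq> \<zero>\<^bsub>M\<^esub>))"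
  have "U \<inter> V \<noteq> {\<zero>\<^bsub>M\<^esub>}" if "nonzero_submodule R M V" for V
  proof -
    have V: "rsubmodule R M V" "V \<noteq> {\<zero>\<^bsub>M\<^esub>}" using that by (auto simp: nonzero_submodule_def)
    note Vi = rsubmoduleD[OF V(1)]
    obtain x where x: "x \<in> V" "x \<noteq> \<zero>\<^bsub>M\<^esub>" using V(2) Vi(2) by blast
    then obtain r where "r \<in> carrier R" "x \<cdot>\<^bsub>M\<^esub> r \<in> U" "x \<cdot>\<^bsub>M\<^esub> r \<noteq> \<zero>\<^bsub>M\<^esub>" using U Vi(1) by blast
    then show ?thesis using Vi(4)[OF x(1)] by blast
  qed
  then show "essential_submodule R M U" using U by (simp add: essential_submodule_def)
qed

lemma direct_sum_modular:
  assumes C: "direct_sum_decomp R M C F" and D: "direct_sum_decomp R M V D" and CD: "C \<subseteq> D"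
  shows "direct_sum_decomp R M (V <+>\<^bsub>M\<^esub> C) (D \<inter> F)" "D \<inter> (V <+>\<^bsub>M\<^esub> C) = C"
proof -
  have sub: "rsubmodule R M C" "rsubmodule R M F" "rsubmodule R M V" "rsubmodule R M D"
    and 0: "C \<inter> F = {\<zero>\<^bsub>M\<^esub>}" "V \<inter> D = {\<zero>\<^bsub>M\<^esub>}"
    and s: "carrier M = C <+>\<^bsub>M\<^esub> F" "carrier M = V <+>\<^bsub>M\<^esub> D"
    using C D by (auto simp: direct_sum_decomp_def)
  note Ci = rsubmoduleD[OF sub(1)] and Fi = rsubmoduleD[OF sub(2)]
    and Vi = rsubmoduleD[OF sub(3)] and Di = rsubmoduleD[OF sub(4)]
  have mem: "x \<in> A <+>\<^bsub>M\<^esub> B \<longleftrightarrow> (\<exists>v\<in>A. \<exists>w\<in>B. x = v \<oplus>\<^bsub>M\<^esub> w)" for x A B by (auto simp: set_add_def')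
  show mod: "D \<inter> (V <+>\<^bsub>M\<^esub> C) = C"
  proof
    show "C \<subseteq> D \<inter> (V <+>\<^bsub>M\<^esub> C)" using CD rsubmodule_set_add(3)[OF sub(3,1)] by blast
    show "D \<inter> (V <+>\<^bsub>M\<^esub> C) \<subseteq> C"
    proof
      fix x assume "x \<in> D \<inter> (V <+>\<^bsub>M\<^esub> C)"
      then obtain v c where x: "x \<in> D" "v \<in> V" "c \<in> C" "x = v \<oplus>\<^bsub>M\<^esub> c" unfolding mem Int_iff by blast
      have cc: "v \<in> carrier M" "c \<in> carrier M" using x Vi(1) Ci(1) by auto
      have "x \<ominus>\<^bsub>M\<^esub> c = v" using x(4) cc by (simp add: a_minus_def M.a_assoc M.r_neg)
      moreover have "x \<ominus>\<^bsub>M\<^esub> c \<in> D" using rsubmodule_minus[OF sub(4) x(1)] x(3) CD by blast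
      ultimately have "v = \<zero>\<^bsub>M\<^esub>" using 0(2) x(2) by blast
      then show "x \<in> C" using x cc by simp
    qed
  qed
  show "direct_sum_decomp R M (V <+>\<^bsub>M\<^esub> C) (D \<inter> F)"
    unfolding direct_sum_decomp_def
  proof (intro conjI)
    show vc: "rsubmodule R M (V <+>\<^bsub>M\<^esub> C)" by (rule rsubmodule_set_add(1)[OF sub(3,1)])
    show df: "rsubmodule R M (D \<inter> F)" by (rule rsubmodule_Int[OF sub(4,2)])
    show "(V <+>\<^bsub>M\<^esub> C) \<inter> (D \<inter> F) = {\<zero>\<^bsub>M\<^esub>}" using mod 0(1) by blast
    show "(V <+>\<^bsub>M\<^esub> C) <+>\<^bsub>M\<^esub> (D \<inter> F) = carrier M"
    proof
      show "(V <+>\<^bsub>M\<^esub> C) <+>\<^bsub>M\<^esub> (D \<inter> F) \<subseteq> carrier M" using rsubmodule_set_add(1)[OF vc df] rsubmoduleD(1) by blast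
      show "carrier M \<subseteq> (V <+>\<^bsub>M\<^esub> C) <+>\<^bsub>M\<^esub> (D \<inter> F)"
      proof
        fix x assume "x \<in> carrier M"
        then obtain v d where x: "v \<in> V" "d \<in> D" "x = v \<oplus>\<^bsub>M\<^esub> d" unfolding s(2) mem by blast
        have "d \<in> carrier M" using x Di(1) by blast
        then obtain c f where d: "c \<in> C" "f \<in> F" "d = c \<oplus>\<^bsub>M\<^esub> f" unfolding s(1) mem by blast
        have cc: "v \<in> carrier M" "c \<in> carrier M" "f \<in> carrier M" using x d Vi(1) Ci(1) Fi(1) by auto
        have "d \<ominus>\<^bsub>M\<^esub> c = (c \<oplus>\<^bsub>M\<^esub> \<ominus>\<^bsub>M\<^esub> c) \<oplus>\<^bsub>M\<^esub> f"
          using d(3) cc by (simp only: a_minus_def M.a_ac M.a_closed M.a_inv_closed)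
        then have "d \<ominus>\<^bsub>M\<^esub> c = f" using cc by (simp add: M.r_neg)
        then have "f \<in> D" using rsubmodule_minus[OF sub(4) x(2)] d(1) CD by auto
        moreover have "x = (v \<oplus>\<^bsub>M\<^esub> c) \<oplus>\<^bsub>M\<^esub> f" using x d cc by (simp add: M.a_assoc)
        moreover have "v \<oplus>\<^bsub>M\<^esub> c \<in> V <+>\<^bsub>M\<^esub> C" unfolding mem using x(1) d(1) by blast
        ultimately show "x \<in> (V <+>\<^bsub>M\<^esub> C) <+>\<^bsub>M\<^esub> (D \<inter> F)"
          unfolding mem[of _ "V <+>\<^bsub>M\<^esub> C"] using d(2) by blast
      qed
    qed
  qed
qed

lemma maximal_submodule:
  assumes ne: "\<F> \<noteq> {}" and sub: "\<And>V. V \<in> \<F> \<Longrightarrow> rsubmodule R M V"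
    and chain: "\<And>\<C>. \<C> \<subseteq> \<F> \<Longrightarrow> \<C> \<noteq> {} \<Longrightarrow> rsubmodule R M (\<Union>\<C>) \<Longrightarrow> \<Union>\<C> \<in> \<F>"
  obtains V where "V \<in> \<F>" "\<And>X. X \<in> \<F> \<Longrightarrow> V \<subseteq> X \<Longrightarrow> X = V"
proof -
  have "\<exists>V\<in>\<F>. \<forall>X\<in>\<F>. V \<subseteq> X \<longrightarrow> X = V"
  proof (rule subset_Zorn_nonempty[OF ne])
    fix \<C> assume \<C>: "\<C> \<noteq> {}" "subset.chain \<F> \<C>"
    then have F: "\<C> \<subseteq> \<F>" and tot: "\<And>X Y. X \<in> \<C> \<Longrightarrow> Y \<in> \<C> \<Longrightarrow> X \<subseteq> Y \<or> Y \<subseteq> X"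
      by (auto simp: subset.chain_def)
    have s: "rsubmodule R M X" if "X \<in> \<C>" for X using sub F that by blast
    have "rsubmodule R M (\<Union>\<C>)"
    proof (rule rsubmoduleI)
      show "\<Union>\<C> \<subseteq> carrier M" using s rsubmoduleD(1) by blast
      show "\<zero>\<^bsub>M\<^esub> \<in> \<Union>\<C>" using s rsubmoduleD(2) \<C>(1) by blast
      show "x \<oplus>\<^bsub>M\<^esub> y \<in> \<Union>\<C>" if xy: "x \<in> \<Union>\<C>" "y \<in> \<Union>\<C>" for x y
      proof -
        obtain X where "X \<in> \<C>" "x \<in> X" "y \<in> X" using tot xy by blast
        then show ?thesis using rsubmoduleD(3)[OF s] by blast
      qed
      show "x \<cdot>\<^bsub>M\<^esub> r \<in> \<Union>\<C>" if "x \<in> \<Union>\<C>" "r \<in> carrier R" for x r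
        using that rsubmoduleD(4)[OF s] by blast
    qed
    then show "\<Union>\<C> \<in> \<F>" using chain F \<C>(1) by blast
  qed
  then show thesis using that by blast
qed

end

lemma independent_sum_projection:
  fixes M :: "('r, 'm) rmod"
  assumes M: "right_module R M" and V: "rsubmodule R M V" and W: "rsubmodule R M W" and VW: "V \<inter> W = {\<zero>\<^bsub>M\<^esub>}"
  obtains p where "p \<in> rhom R (sub_rmod M (V <+>\<^bsub>M\<^esub> W)) M"
    "\<And>v w. v \<in> V \<Longrightarrow> w \<in> W \<Longrightarrow> p (v \<oplus>\<^bsub>M\<^esub> w) = v"
proof -
  interpret right_module R M by fact
  note Vi = rsubmoduleD[OF V] and Wi = rsubmoduleD[OF W]
  define p where "p x = (THE v. v \<in> V \<and> (\<exists>w\<in>W. x = v \<oplus>\<^bsub>M\<^esub> w))" for x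
  have p: "p (v \<oplus>\<^bsub>M\<^esub> w) = v" if vw: "v \<in> V" "w \<in> W" for v w
    unfolding p_def
  proof (rule the_equality)
    fix v' assume "v' \<in> V \<and> (\<exists>w'\<in>W. v \<oplus>\<^bsub>M\<^esub> w = v' \<oplus>\<^bsub>M\<^esub> w')"
    then obtain w' where v': "v' \<in> V" "w' \<in> W" "v \<oplus>\<^bsub>M\<^esub> w = v' \<oplus>\<^bsub>M\<^esub> w'" by blast
    have c: "v \<in> carrier M" "w \<in> carrier M" "v' \<in> carrier M" "w' \<in> carrier M"
      using vw v' Vi(1) Wi(1) by auto
    have "v' \<ominus>\<^bsub>M\<^esub> v = w \<ominus>\<^bsub>M\<^esub> w'"
    proof -
      have "v' = (v \<oplus>\<^bsub>M\<^esub> w) \<ominus>\<^bsub>M\<^esub> w'"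
        unfolding v'(3) using c by (simp add: a_minus_def M.a_assoc M.r_neg)
      then have "v' \<ominus>\<^bsub>M\<^esub> v = (v \<oplus>\<^bsub>M\<^esub> \<ominus>\<^bsub>M\<^esub> v) \<oplus>\<^bsub>M\<^esub> (w \<ominus>\<^bsub>M\<^esub> w')"
        using c by (simp only: a_minus_def M.a_ac M.a_closed M.a_inv_closed)
      then show ?thesis using c by (simp add: M.r_neg)
    qed
    moreover have "v' \<ominus>\<^bsub>M\<^esub> v \<in> V" "w \<ominus>\<^bsub>M\<^esub> w' \<in> W" using rsubmodule_minus V W vw v'(1,2) by blast+
    ultimately have "v' \<ominus>\<^bsub>M\<^esub> v \<in> V \<inter> W" by simp
    then show "v' = v" using VW M.minus_eq_zero_iff c by auto
  qed (use vw in blast)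
  have "p \<in> rhom R (sub_rmod M (V <+>\<^bsub>M\<^esub> W)) M"
    unfolding rhom_def
  proof (intro CollectI conjI ballI Pi_I)
    fix x assume "x \<in> carrier (sub_rmod M (V <+>\<^bsub>M\<^esub> W))"
    then obtain v w where x: "v \<in> V" "w \<in> W" "x = v \<oplus>\<^bsub>M\<^esub> w" by (auto simp: sub_rmod_def set_add_def')
    have c: "v \<in> carrier M" "w \<in> carrier M" using x Vi(1) Wi(1) by auto
    show "p x \<in> carrier M" using p x c by simp
    show "p (x \<cdot>\<^bsub>sub_rmod M (V <+>\<^bsub>M\<^esub> W)\<^esub> r) = p x \<cdot>\<^bsub>M\<^esub> r" if r: "r \<in> carrier R" for r
      using p x c r Vi(4) Wi(4) by (simp add: sub_rmod_def act_l_distr)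
    fix y assume "y \<in> carrier (sub_rmod M (V <+>\<^bsub>M\<^esub> W))"
    then obtain v' w' where y: "v' \<in> V" "w' \<in> W" "y = v' \<oplus>\<^bsub>M\<^esub> w'" by (auto simp: sub_rmod_def set_add_def')
    have c': "v' \<in> carrier M" "w' \<in> carrier M" using y Vi(1) Wi(1) by auto
    have "x \<oplus>\<^bsub>M\<^esub> y = (v \<oplus>\<^bsub>M\<^esub> v') \<oplus>\<^bsub>M\<^esub> (w \<oplus>\<^bsub>M\<^esub> w')" using c c' x y by (simp add: M.a_ac)
    then show "p (x \<oplus>\<^bsub>sub_rmod M (V <+>\<^bsub>M\<^esub> W)\<^esub> y) = p x \<oplus>\<^bsub>M\<^esub> p y"
      using p x y Vi(3) Wi(3) by (simp add: sub_rmod_def)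
  qed
  then show thesis using p by (rule that) 
qed

lemma direct_sum_projection:
  fixes M :: "('r, 'm) rmod"
  assumes M: "right_module R M" and VW: "direct_sum_decomp R M V W"
  obtains p where "p \<in> rhom R M M" "\<And>x. x \<in> carrier M \<Longrightarrow> p x \<in> V"
    "\<And>x. x \<in> carrier M \<Longrightarrow> x \<ominus>\<^bsub>M\<^esub> p x \<in> W" "\<And>x. x \<in> carrier M \<Longrightarrow> p x = \<zero>\<^bsub>M\<^esub> \<longleftrightarrow> x \<in> W"
    "\<And>x. x \<in> V \<Longrightarrow> p x = x"
proof -
  interpret right_module R M by fact
  have V: "rsubmodule R M V" and W: "rsubmodule R M W" and 0: "V \<inter> W = {\<zero>\<^bsub>M\<^esub>}"
    and s: "V <+>\<^bsub>M\<^esub> W = carrier M"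
    using VW by (auto simp: direct_sum_decomp_def)
  note Vi = rsubmoduleD[OF V] and Wi = rsubmoduleD[OF W]
  obtain p where h: "p \<in> rhom R (sub_rmod M (V <+>\<^bsub>M\<^esub> W)) M"
    and p: "\<And>v w. v \<in> V \<Longrightarrow> w \<in> W \<Longrightarrow> p (v \<oplus>\<^bsub>M\<^esub> w) = v"
    using independent_sum_projection[OF M V W 0] by blast
  have ex: "\<exists>v w. v \<in> V \<and> w \<in> W \<and> x = v \<oplus>\<^bsub>M\<^esub> w" if "x \<in> carrier M" for x
    using that unfolding s[symmetric] by (auto simp: set_add_def')
  show thesis
  proof (rule that[of p])
    show "p \<in> rhom R M M" using h unfolding s by (simp add: sub_rmod_def)
    show "p x = x" if "x \<in> V" for x using p[OF that Wi(2)] Vi(1) that by auto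
    fix x assume "x \<in> carrier M"
    then obtain v w where x: "v \<in> V" "w \<in> W" "x = v \<oplus>\<^bsub>M\<^esub> w" using ex by blast
    have c: "v \<in> carrier M" "w \<in> carrier M" using x Vi(1) Wi(1) by auto
    show "p x \<in> V" using x p by simp
    have "(v \<oplus>\<^bsub>M\<^esub> w) \<ominus>\<^bsub>M\<^esub> v = w" using c by (metis M.a_comm M.a_inv_closed M.minus_eq M.a_assoc M.r_neg M.r_zero M.a_closed)
    then show xw: "x \<ominus>\<^bsub>M\<^esub> p x \<in> W" using x p by simp
    show "p x = \<zero>\<^bsub>M\<^esub> \<longleftrightarrow> x \<in> W"
    proof
      assume "p x = \<zero>\<^bsub>M\<^esub>"
      then show "x \<in> W" using p x c by simp
    next
      assume "x \<in> W"
      then have "p (\<zero>\<^bsub>M\<^esub> \<oplus>\<^bsub>M\<^esub> x) = \<zero>\<^bsub>M\<^esub>" using p Vi(2) by blast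
      then show "p x = \<zero>\<^bsub>M\<^esub>" using \<open>x \<in> W\<close> Wi(1) by auto
    qed
  qed
qed

section \<open>Uniform summands of injective modules\<close>

text \<open>Essential extensions inside an injective module split off. Let \<open>E'\<close> be a maximal essential
  extension of \<open>W\<close> in \<open>E\<close>, and \<open>D \<supseteq> C\<close> maximal with \<open>D \<inter> E' = 0\<close>. The projection \<open>E' + D \<rightarrow> E'\<close> extends to
  \<open>h : E \<rightarrow> E\<close>. The kernel of \<open>h\<close> is independent of \<open>E'\<close>, so it is \<open>D\<close>. The image of \<open>h\<close> is an essential
  extension of \<open>E'\<close>, so it is \<open>E'\<close>. Thus \<open>h\<close> is a projection onto \<open>E'\<close> with kernel \<open>D\<close>.\<close>

lemma injective_essential_closure_summand:
  fixes E :: "('r, 'e) rmod"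
  assumes E: "injective_rmod R E" and W: "rsubmodule R E W" and C: "rsubmodule R E C"
    and WC: "W \<inter> C = {\<zero>\<^bsub>E\<^esub>}"
  obtains E' D where "direct_sum_decomp R E E' D" "W \<subseteq> E'" "C \<subseteq> D"
    "\<And>x. x \<in> E' \<Longrightarrow> x \<noteq> \<zero>\<^bsub>E\<^esub> \<Longrightarrow> \<exists>r\<in>carrier R. x \<cdot>\<^bsub>E\<^esub> r \<in> W \<and> x \<cdot>\<^bsub>E\<^esub> r \<noteq> \<zero>\<^bsub>E\<^esub>"
proof -
  have E': "right_module R E" using E by (simp add: injective_rmod_def)
  interpret right_module R E by fact
  define ess where "ess V \<longleftrightarrow> (\<forall>x\<in>V. x \<noteq> \<zero>\<^bsub>E\<^esub> \<longrightarrow> (\<exists>r\<in>carrier R. x \<cdot>\<^bsub>E\<^esub> r \<in> W \<and> x \<cdot>\<^bsub>E\<^esub> r \<noteq> \<zero>\<^bsub>E\<^esub>))" for V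
  define \<F> where "\<F> = {V. rsubmodule R E V \<and> W \<subseteq> V \<and> ess V}"
  have "ess W" unfolding ess_def
  proof (intro ballI impI)
    fix x assume "x \<in> W" "x \<noteq> \<zero>\<^bsub>E\<^esub>"
    then show "\<exists>r\<in>carrier R. x \<cdot>\<^bsub>E\<^esub> r \<in> W \<and> x \<cdot>\<^bsub>E\<^esub> r \<noteq> \<zero>\<^bsub>E\<^esub>"
      using rsubmoduleD(1)[OF W] by (intro bexI[of _ "\<one>\<^bsub>R\<^esub>"]) (auto simp: subset_iff)
  qed
  then have "\<F> \<noteq> {}" using W by (auto simp: \<F>_def)
  then obtain V where V: "V \<in> \<F>" and maxV: "\<And>X. X \<in> \<F> \<Longrightarrow> V \<subseteq> X \<Longrightarrow> X = V"
  proof (rule maximal_submodule)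
    show "\<Union>\<C> \<in> \<F>" if "\<C> \<subseteq> \<F>" "\<C> \<noteq> {}" "rsubmodule R E (\<Union>\<C>)" for \<C>
      using that unfolding \<F>_def ess_def by blast
  qed (auto simp: \<F>_def)
  have rV: "rsubmodule R E V" and WV: "W \<subseteq> V" and essV: "ess V" using V by (auto simp: \<F>_def)
  note Vi = rsubmoduleD[OF rV] and Ci = rsubmoduleD[OF C] and Wi = rsubmoduleD[OF W]
  have VC: "V \<inter> C = {\<zero>\<^bsub>E\<^esub>}"
  proof (rule ccontr)
    assume "V \<inter> C \<noteq> {\<zero>\<^bsub>E\<^esub>}"
    then obtain x where x: "x \<in> V" "x \<in> C" "x \<noteq> \<zero>\<^bsub>E\<^esub>" using Vi(2) Ci(2) by blast
    then obtain r where "r \<in> carrier R" "x \<cdot>\<^bsub>E\<^esub> r \<in> W" "x \<cdot>\<^bsub>E\<^esub> r \<noteq> \<zero>\<^bsub>E\<^esub>" using essV unfolding ess_def by blast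
    then show False using Ci(4)[OF x(2)] WC by blast
  qed
  define \<G> where "\<G> = {D. rsubmodule R E D \<and> C \<subseteq> D \<and> V \<inter> D \<subseteq> {\<zero>\<^bsub>E\<^esub>}}"
  have "\<G> \<noteq> {}" using C VC by (auto simp: \<G>_def)
  then obtain D where D: "D \<in> \<G>" and maxD: "\<And>X. X \<in> \<G> \<Longrightarrow> D \<subseteq> X \<Longrightarrow> X = D"
  proof (rule maximal_submodule)
    show "\<Union>\<C> \<in> \<G>" if "\<C> \<subseteq> \<G>" "\<C> \<noteq> {}" "rsubmodule R E (\<Union>\<C>)" for \<C>
      using that unfolding \<G>_def by blast
  qed (auto simp: \<G>_def)
  have rD: "rsubmodule R E D" and CD: "C \<subseteq> D" and VD0: "V \<inter> D \<subseteq> {\<zero>\<^bsub>E\<^esub>}" using D by (auto simp: \<G>_def)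
  note Di = rsubmoduleD[OF rD]
  have VD: "V \<inter> D = {\<zero>\<^bsub>E\<^esub>}" using VD0 Vi(2) Di(2) by blast
  let ?S = "V <+>\<^bsub>E\<^esub> D"
  note S = rsubmodule_set_add[OF rV rD]
  obtain p where p: "p \<in> rhom R (sub_rmod E ?S) E"
    and pv: "\<And>v d. v \<in> V \<Longrightarrow> d \<in> D \<Longrightarrow> p (v \<oplus>\<^bsub>E\<^esub> d) = v"
    using independent_sum_projection[OF E' rV rD VD] by blast
  have "rembedding R (sub_rmod E ?S) E (\<lambda>x. x)"
    using rsubmoduleD(1)[OF S(1)] by (auto simp: rembedding_def rhom_def sub_rmod_def)
  from injective_rmod_extend[OF E right_module_sub_rmod[OF E' S(1)] E' this p]
  obtain h where h: "h \<in> rhom R E E" and hp: "\<And>x. x \<in> ?S \<Longrightarrow> h x = p x"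
    by (auto simp: sub_rmod_def)
  note hh = rhom_props[OF E' E' h]
  have hV: "h x = x" if "x \<in> V" for x
  proof -
    have "x \<in> ?S" "x \<in> carrier E" using that S(2) Vi(1) by blast+
    then show ?thesis using hp pv[OF that Di(2)] by simp
  qed
  have hD: "h x = \<zero>\<^bsub>E\<^esub>" if "x \<in> D" for x
  proof -
    have "x \<in> ?S" "x \<in> carrier E" using that S(3) Di(1) by blast+
    then show ?thesis using hp pv[OF Vi(2) that] by simp
  qed
  have ker: "{x \<in> carrier E. h x = \<zero>\<^bsub>E\<^esub>} = D"
  proof (rule maxD)
    have "rsubmodule R E {x \<in> carrier E. h x = \<zero>\<^bsub>E\<^esub>}"
      using rsubmodule_preimage[OF E' E' h rsubmodule_zero] by simp
    then show "{x \<in> carrier E. h x = \<zero>\<^bsub>E\<^esub>} \<in> \<G>" using CD Ci(1) hD hV by (auto simp: \<G>_def)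
    show "D \<subseteq> {x \<in> carrier E. h x = \<zero>\<^bsub>E\<^esub>}" using Di(1) hD by auto
  qed
  have img: "h ` carrier E = V"
  proof (rule maxV)
    show VH: "V \<subseteq> h ` carrier E"
    proof
      fix x assume "x \<in> V"
      then show "x \<in> h ` carrier E" using hV Vi(1) by (intro image_eqI[of _ _ x]) auto
    qed
    have rH: "rsubmodule R E (h ` carrier E)" by (rule rsubmodule_image[OF E' E' h rsubmodule_carrier])
    have "ess (h ` carrier E)"
      unfolding ess_def
    proof (intro ballI impI)
      fix y assume "y \<in> h ` carrier E" and y0: "y \<noteq> \<zero>\<^bsub>E\<^esub>"
      then obtain x where x: "x \<in> carrier E" "y = h x" by blast
      have yE: "y \<in> carrier E" using x hh(1) by blast
      \<comment> \<open>The preimage of \<open>yR\<close> contains \<open>D\<close> properly, so it meets \<open>V\<close>, where \<open>h\<close> is the identity.\<close>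
      let ?K = "{z \<in> carrier E. h z \<in> (\<lambda>r. y \<cdot>\<^bsub>E\<^esub> r) ` carrier R}"
      note Y = rsubmoduleD[OF rsubmodule_cyclic[OF yE]]
      have rK: "rsubmodule R E ?K" by (rule rsubmodule_preimage[OF E' E' h rsubmodule_cyclic[OF yE]])
      have "D \<subseteq> ?K" using Di(1) hD Y(2) by auto
      moreover have "x \<in> ?K" using x yE by (auto intro!: image_eqI[of _ _ "\<one>\<^bsub>R\<^esub>"])
      moreover have "x \<notin> D" using x y0 hD by auto
      ultimately have "?K \<notin> \<G>" using maxD by blast
      then have "\<not> V \<inter> ?K \<subseteq> {\<zero>\<^bsub>E\<^esub>}" using rK CD \<open>D \<subseteq> ?K\<close> unfolding \<G>_def by blast
      then obtain z where z: "z \<in> V" "z \<noteq> \<zero>\<^bsub>E\<^esub>" "h z \<in> (\<lambda>r. y \<cdot>\<^bsub>E\<^esub> r) ` carrier R" by blast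
      then obtain r where r: "r \<in> carrier R" "z = y \<cdot>\<^bsub>E\<^esub> r" using hV by auto
      obtain s where s: "s \<in> carrier R" "z \<cdot>\<^bsub>E\<^esub> s \<in> W" "z \<cdot>\<^bsub>E\<^esub> s \<noteq> \<zero>\<^bsub>E\<^esub>"
        using essV z(1,2) unfolding ess_def by blast
      have "y \<cdot>\<^bsub>E\<^esub> (r \<otimes>\<^bsub>R\<^esub> s) = z \<cdot>\<^bsub>E\<^esub> s" using yE r s(1) by (simp add: act_assoc)
      then show "\<exists>r\<in>carrier R. y \<cdot>\<^bsub>E\<^esub> r \<in> W \<and> y \<cdot>\<^bsub>E\<^esub> r \<noteq> \<zero>\<^bsub>E\<^esub>" using r(1) s by (metis R.m_closed)
    qed
    then show "h ` carrier E \<in> \<F>" using rH VH WV by (auto simp: \<F>_def)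
  qed
  have "direct_sum_decomp R E V D"
    unfolding direct_sum_decomp_def
  proof (intro conjI rV rD VD)
    show "V <+>\<^bsub>E\<^esub> D = carrier E"
    proof
      show "V <+>\<^bsub>E\<^esub> D \<subseteq> carrier E" using rsubmoduleD(1)[OF S(1)] .
      show "carrier E \<subseteq> V <+>\<^bsub>E\<^esub> D"
      proof
        fix x assume x: "x \<in> carrier E"
        have hx: "h x \<in> V" "h x \<in> carrier E" using img hh(1) x by auto
        have "h (x \<ominus>\<^bsub>E\<^esub> h x) = \<zero>\<^bsub>E\<^esub>"
          using rhom_minus[OF E' E' h x hx(2)] hV[OF hx(1)] hx(2) by (simp add: M.minus_eq_zero_iff)
        then have "x \<ominus>\<^bsub>E\<^esub> h x \<in> D" using x hx(2) unfolding ker[symmetric] by auto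
        moreover have "x = h x \<oplus>\<^bsub>E\<^esub> (x \<ominus>\<^bsub>E\<^esub> h x)"
          using x hx(2) by (metis M.a_comm M.a_inv_closed M.minus_eq M.a_assoc M.l_neg M.r_zero M.a_closed)
        ultimately show "x \<in> V <+>\<^bsub>E\<^esub> D" unfolding set_add_def' using hx(1) by blast
      qed
    qed
  qed
  then show thesis using WV CD essV unfolding ess_def by (intro that) auto
qed

lemma uniform_summand:
  fixes E :: "('r, 'e) rmod"
  assumes E: "right_module R E" and V: "rsubmodule R E V" "V \<noteq> {\<zero>\<^bsub>E\<^esub>}"
    and uni: "\<And>X x. rsubmodule R E X \<Longrightarrow> X \<subseteq> V \<Longrightarrow> X \<noteq> {\<zero>\<^bsub>E\<^esub>} \<Longrightarrow> x \<in> V \<Longrightarrow> x \<noteq> \<zero>\<^bsub>E\<^esub> \<Longrightarrow>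
      \<exists>r\<in>carrier R. x \<cdot>\<^bsub>E\<^esub> r \<in> X \<and> x \<cdot>\<^bsub>E\<^esub> r \<noteq> \<zero>\<^bsub>E\<^esub>"
  shows "uniform_module R (sub_rmod E V)" "indecomposable R (sub_rmod E V)"
proof -
  interpret S: right_module R "sub_rmod E V" by (rule right_module_sub_rmod[OF E V(1)])
  have s: "carrier (sub_rmod E V) = V" "\<zero>\<^bsub>sub_rmod E V\<^esub> = \<zero>\<^bsub>E\<^esub>" "x \<cdot>\<^bsub>sub_rmod E V\<^esub> r = x \<cdot>\<^bsub>E\<^esub> r" for x r
    by (simp_all add: sub_rmod_def)
  show u: "uniform_module R (sub_rmod E V)"
    unfolding uniform_module_def nonzero_submodule_def S.essential_submodule_iff s
    using V(2) uni unfolding rsubmodule_sub_rmod_iff[OF E V(1)] by blast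
  show "indecomposable R (sub_rmod E V)"
    unfolding indecomposable_def
  proof (intro conjI allI impI)
    show "carrier (sub_rmod E V) \<noteq> {\<zero>\<^bsub>sub_rmod E V\<^esub>}" using V(2) by (simp add: s)
    fix X Y assume XY: "direct_sum_decomp R (sub_rmod E V) X Y"
    show "X = {\<zero>\<^bsub>sub_rmod E V\<^esub>} \<or> Y = {\<zero>\<^bsub>sub_rmod E V\<^esub>}"
    proof (rule ccontr)
      assume "\<not> ?thesis"
      then have "nonzero_submodule R (sub_rmod E V) X" "nonzero_submodule R (sub_rmod E V) Y"
        using XY by (auto simp: direct_sum_decomp_def nonzero_submodule_def)
      then have "X \<inter> Y \<noteq> {\<zero>\<^bsub>sub_rmod E V\<^esub>}"
        using u unfolding uniform_module_def essential_submodule_def by blast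
      then show False using XY by (simp add: direct_sum_decomp_def)
    qed
  qed
qed

text \<open>For proper \<open>K\<close>, this says that the right module \<open>R/K\<close> is uniform.\<close>

definition meet_irreducible :: "('r, 'x) ring_scheme \<Rightarrow> 'r set \<Rightarrow> bool" where
  "meet_irreducible R K \<longleftrightarrow> (\<forall>A B. right_ideal R A \<and> right_ideal R B \<and> A \<inter> B = K \<longrightarrow> A = K \<or> B = K)"

text \<open>If \<open>E = E\<^sub>1 \<oplus> \<dots> \<oplus> E\<^sub>n\<close> with uniform summands and projections \<open>\<pi>\<^sub>i\<close>, then \<open>K\<close> is the intersection of
  the right ideals \<open>{r. \<pi>\<^sub>i(m)rT = 0}\<close>, so it is one of them. As \<open>E\<close> may need infinitely many summands, \<open>E'\<close>
  is split off directly. Call a summand \<open>C\<close> good if \<open>mrT \<subseteq> C\<close> only for \<open>r \<in> K\<close>. The zero submodule is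
  good. Take a good \<open>C\<close> that meets \<open>mR\<close> in a maximal submodule. A uniform submodule \<open>W\<close> of the image of
  \<open>mR\<close> in a complement of \<open>C\<close> gives \<open>E = E' \<oplus> D\<close> with \<open>W\<close> essential in \<open>E'\<close> and \<open>C \<subseteq> D\<close>. Since
  \<open>C = D \<inter> (E' + C)\<close>, one of \<open>D\<close> and \<open>E' + C\<close> is good. It is not \<open>E' + C\<close>, by the choice of \<open>C\<close>.\<close>

lemma uniform_summand_separating:
  fixes E :: "('r, 'e) rmod" and R (structure)
  assumes R: "right_noetherian R" and E: "injective_rmod R E" and T: "ideal T R"
    and m: "m \<in> carrier E"
  defines "K \<equiv> {r \<in> carrier R. \<forall>t\<in>T. m \<cdot>\<^bsub>E\<^esub> r \<cdot>\<^bsub>E\<^esub> t = \<zero>\<^bsub>E\<^esub>}"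
  assumes K1: "\<one> \<notin> K"
    and irr: "meet_irreducible R K"
  obtains E' D where "direct_sum_decomp R E E' D" "uniform_module R (sub_rmod E E')"
    "indecomposable R (sub_rmod E E')"
    "\<And>r. r \<in> carrier R \<Longrightarrow> (\<And>t. t \<in> T \<Longrightarrow> m \<cdot>\<^bsub>E\<^esub> r \<cdot>\<^bsub>E\<^esub> t \<in> D) \<Longrightarrow> r \<in> K"
proof -
  have mE: "right_module R E" using E by (simp add: injective_rmod_def)
  interpret right_module R E by fact
  interpret T: ideal T R by fact
  have TR: "t \<in> carrier R" if "t \<in> T" for t using that T.a_subset by blast
  define tr where "tr C = {r \<in> carrier R. m \<cdot>\<^bsub>E\<^esub> r \<in> C}" for C
  define Kt where "Kt C = {r \<in> carrier R. \<forall>t\<in>T. m \<cdot>\<^bsub>E\<^esub> r \<cdot>\<^bsub>E\<^esub> t \<in> C}" for C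
  have tr: "right_ideal R (tr C)" if "rsubmodule R E C" for C
    unfolding tr_def by (rule right_ideal_preimage[OF that m])
  have Kt: "right_ideal R (Kt C)" if "rsubmodule R E C" for C
    using right_ideal_preimage[OF rsubmodule_residual[OF T that] m] m by (simp add: Kt_def cong: conj_cong)
  have K_Kt: "K \<subseteq> Kt C" if C: "rsubmodule R E C" for C
    using rsubmoduleD(2)[OF C] by (auto simp: K_def Kt_def)
  define \<C> where "\<C> = {C. direct_summand R E C \<and> Kt C \<subseteq> K}"
  have sub: "rsubmodule R E C" if "C \<in> \<C>" for C
    using that by (auto simp: \<C>_def direct_summand_def direct_sum_decomp_def)
  have "direct_sum_decomp R E {\<zero>\<^bsub>E\<^esub>} (carrier E)"
    unfolding direct_sum_decomp_def
  proof (intro conjI rsubmodule_zero rsubmodule_carrier)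
    show "{\<zero>\<^bsub>E\<^esub>} <+>\<^bsub>E\<^esub> carrier E = carrier E" by (auto simp: set_add_def')
  qed auto
  then have "{\<zero>\<^bsub>E\<^esub>} \<in> \<C>" by (auto simp: \<C>_def direct_summand_def Kt_def K_def)
  then have "\<exists>X\<in>tr ` \<C>. \<forall>Y\<in>tr ` \<C>. X \<subseteq> Y \<longrightarrow> Y = X"
    by (intro right_noetherian_maximal[OF R]) (use sub tr in auto)
  then obtain C where C: "C \<in> \<C>" and maxC: "\<And>C'. C' \<in> \<C> \<Longrightarrow> tr C \<subseteq> tr C' \<Longrightarrow> tr C' = tr C" by blast
  have rC: "rsubmodule R E C" and KC: "Kt C \<subseteq> K" using sub[OF C] C by (auto simp: \<C>_def)
  note Ci = rsubmoduleD[OF rC]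
  obtain F where CF: "direct_sum_decomp R E C F" using C by (auto simp: \<C>_def direct_summand_def)
  have mC: "m \<notin> C"
  proof
    assume "m \<in> C"
    then have "\<one> \<in> Kt C" using m Ci(4) TR by (simp add: Kt_def)
    then show False using KC K1 by blast
  qed
  have FC: "direct_sum_decomp R E F C"
  proof -
    have "x \<in> F <+>\<^bsub>E\<^esub> C \<longleftrightarrow> x \<in> C <+>\<^bsub>E\<^esub> F" for x
    proof -
      have "F \<subseteq> carrier E" "C \<subseteq> carrier E"
        using CF rsubmoduleD(1) unfolding direct_sum_decomp_def by blast+
      then have "\<And>f c. f \<in> F \<Longrightarrow> c \<in> C \<Longrightarrow> f \<oplus>\<^bsub>E\<^esub> c = c \<oplus>\<^bsub>E\<^esub> f" by (intro M.a_comm) auto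
      then show ?thesis unfolding set_add_def' UN_iff singleton_iff by metis
    qed
    then show ?thesis using CF by (auto simp: direct_sum_decomp_def)
  qed
  obtain p where p: "p \<in> rhom R E E" and pF: "\<And>x. x \<in> carrier E \<Longrightarrow> p x \<in> F"
    and pC: "\<And>x. x \<in> carrier E \<Longrightarrow> x \<ominus>\<^bsub>E\<^esub> p x \<in> C" and p0: "\<And>x. x \<in> carrier E \<Longrightarrow> p x = \<zero>\<^bsub>E\<^esub> \<longleftrightarrow> x \<in> C"
    using direct_sum_projection[OF mE FC] by metis
  note ph = rhom_props[OF mE mE p]
  \<comment> \<open>The member \<open>N\<close> chosen below makes \<open>mN\<close> uniform modulo \<open>C\<close>, and \<open>W\<close> is its projection to \<open>F\<close>.\<close>
  define \<N> where "\<N> = {N. right_ideal R N \<and> tr C \<subset> N}"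
  have "carrier R \<in> \<N>"
  proof -
    have "\<one> \<in> carrier R - tr C" using mC m by (simp add: tr_def)
    moreover have "tr C \<subseteq> carrier R" by (auto simp: tr_def)
    ultimately show ?thesis unfolding \<N>_def by (auto simp: R.right_ideal_iff)
  qed
  then have "\<N> \<noteq> {}" by blast
  then obtain N where N: "N \<in> \<N>"
    and ess: "\<And>N' c. N' \<in> \<N> \<Longrightarrow> N' \<subseteq> N \<Longrightarrow> c \<in> N \<Longrightarrow> c \<notin> tr C \<Longrightarrow>
      \<exists>r\<in>carrier R. c \<otimes> r \<in> N' \<and> c \<otimes> r \<notin> tr C"
    by (rule right_noetherian_essential_member[OF R tr[OF rC]]) (auto simp: \<N>_def)
  have rN: "right_ideal R N" and NC: "tr C \<subset> N" using N by (auto simp: \<N>_def)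
  note Ni = R.right_idealD[OF rN]
  define W where "W = (\<lambda>n. p (m \<cdot>\<^bsub>E\<^esub> n)) ` N"
  interpret reg: right_module R "regular_rmod R" by (rule right_module_regular) (rule R.ring_axioms)
  have pm: "(\<lambda>r. p (m \<cdot>\<^bsub>E\<^esub> r)) \<in> rhom R (regular_rmod R) E"
    using act_hom[OF m] p by (auto simp: rhom_def Pi_iff regular_rmod_def)
  have rW: "rsubmodule R E W"
    unfolding W_def by (rule rsubmodule_image[OF reg.right_module_axioms mE pm rN])
  have WF: "W \<subseteq> F" using pF m Ni(1) by (auto simp: W_def)
  have W_uni: "\<exists>r\<in>carrier R. w \<cdot>\<^bsub>E\<^esub> r \<in> V \<and> w \<cdot>\<^bsub>E\<^esub> r \<noteq> \<zero>\<^bsub>E\<^esub>"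
    if V: "rsubmodule R E V" "V \<subseteq> W" "V \<noteq> {\<zero>\<^bsub>E\<^esub>}" and w: "w \<in> W" "w \<noteq> \<zero>\<^bsub>E\<^esub>" for V w
  proof -
    note Vi = rsubmoduleD[OF V(1)]
    define N' where "N' = {n \<in> N. p (m \<cdot>\<^bsub>E\<^esub> n) \<in> V}"
    have "N' = N \<inter> {r \<in> carrier (regular_rmod R). p (m \<cdot>\<^bsub>E\<^esub> r) \<in> V}"
      using Ni(1) by (auto simp: N'_def regular_rmod_def)
    then have "right_ideal R N'"
      using reg.rsubmodule_Int[OF rN rsubmodule_preimage[OF reg.right_module_axioms mE pm V(1)]] by simp
    moreover have "tr C \<subseteq> N'"
    proof
      fix r assume r: "r \<in> tr C"
      then have "p (m \<cdot>\<^bsub>E\<^esub> r) = \<zero>\<^bsub>E\<^esub>" using p0 m by (simp add: tr_def)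
      then show "r \<in> N'" using r NC Vi(2) by (auto simp: N'_def)
    qed
    moreover obtain v where v: "v \<in> V" "v \<noteq> \<zero>\<^bsub>E\<^esub>" using V(3) Vi(2) by blast
    then obtain n where n: "n \<in> N" "v = p (m \<cdot>\<^bsub>E\<^esub> n)" using V(2) by (auto simp: W_def)
    have "n \<in> N'" "n \<notin> tr C"
      using n v p0 m Ni(1) by (auto simp: N'_def tr_def)
    ultimately have N': "N' \<in> \<N>" "N' \<subseteq> N" by (auto simp: \<N>_def N'_def)
    obtain c where c: "c \<in> N" "w = p (m \<cdot>\<^bsub>E\<^esub> c)" using w by (auto simp: W_def)
    have cR: "c \<in> carrier R" using c Ni(1) by blast
    then have "c \<notin> tr C" using c w p0 m by (auto simp: tr_def)
    then obtain r where r: "r \<in> carrier R" "c \<otimes> r \<in> N'" "c \<otimes> r \<notin> tr C" using ess N' c(1) by blast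
    have wr: "w \<cdot>\<^bsub>E\<^esub> r = p (m \<cdot>\<^bsub>E\<^esub> (c \<otimes> r))" using c(2) cR r(1) m by (simp add: act_assoc ph)
    have "w \<cdot>\<^bsub>E\<^esub> r \<in> V" unfolding wr using r(2) by (simp add: N'_def)
    moreover have "w \<cdot>\<^bsub>E\<^esub> r \<noteq> \<zero>\<^bsub>E\<^esub>" unfolding wr using r(1,3) cR m p0 by (simp add: tr_def)
    ultimately show ?thesis using r(1) by blast
  qed
  have "W \<inter> C = {\<zero>\<^bsub>E\<^esub>}" using WF FC rsubmoduleD(2)[OF rW] Ci(2) by (auto simp: direct_sum_decomp_def)
  then obtain E' D where E'D: "direct_sum_decomp R E E' D" and WE': "W \<subseteq> E'" and CD: "C \<subseteq> D"
    and essW: "\<And>x. x \<in> E' \<Longrightarrow> x \<noteq> \<zero>\<^bsub>E\<^esub> \<Longrightarrow> \<exists>r\<in>carrier R. x \<cdot>\<^bsub>E\<^esub> r \<in> W \<and> x \<cdot>\<^bsub>E\<^esub> r \<noteq> \<zero>\<^bsub>E\<^esub>"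
    by (rule injective_essential_closure_summand[OF E rW rC]) blast
  have rE': "rsubmodule R E E'" and rD: "rsubmodule R E D" using E'D by (auto simp: direct_sum_decomp_def)
  obtain n where n: "n \<in> N" "n \<notin> tr C" using NC by blast
  have nR: "n \<in> carrier R" using n Ni(1) by blast
  have w0: "p (m \<cdot>\<^bsub>E\<^esub> n) \<in> W" "p (m \<cdot>\<^bsub>E\<^esub> n) \<noteq> \<zero>\<^bsub>E\<^esub>"
    using n nR m p0 by (auto simp: W_def tr_def)
  have E'0: "E' \<noteq> {\<zero>\<^bsub>E\<^esub>}" using w0 WE' by blast
  have uniE': "\<exists>r\<in>carrier R. x \<cdot>\<^bsub>E\<^esub> r \<in> X \<and> x \<cdot>\<^bsub>E\<^esub> r \<noteq> \<zero>\<^bsub>E\<^esub>"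
    if X: "rsubmodule R E X" "X \<subseteq> E'" "X \<noteq> {\<zero>\<^bsub>E\<^esub>}" and x: "x \<in> E'" "x \<noteq> \<zero>\<^bsub>E\<^esub>" for X x
  proof -
    note Xi = rsubmoduleD[OF X(1)]
    have XW: "rsubmodule R E (X \<inter> W)" by (rule rsubmodule_Int[OF X(1) rW])
    obtain y where "y \<in> X" "y \<noteq> \<zero>\<^bsub>E\<^esub>" using X(3) Xi(2) by blast
    then have "X \<inter> W \<noteq> {\<zero>\<^bsub>E\<^esub>}" using essW[of y] X(2) Xi(4) by blast
    moreover obtain r where r: "r \<in> carrier R" "x \<cdot>\<^bsub>E\<^esub> r \<in> W" "x \<cdot>\<^bsub>E\<^esub> r \<noteq> \<zero>\<^bsub>E\<^esub>" using essW x by blast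
    ultimately obtain s where s: "s \<in> carrier R" "x \<cdot>\<^bsub>E\<^esub> r \<cdot>\<^bsub>E\<^esub> s \<in> X \<inter> W" "x \<cdot>\<^bsub>E\<^esub> r \<cdot>\<^bsub>E\<^esub> s \<noteq> \<zero>\<^bsub>E\<^esub>"
      using W_uni[OF XW] by blast
    have "x \<in> carrier E" using x(1) rsubmoduleD(1)[OF rE'] by blast
    then have "x \<cdot>\<^bsub>E\<^esub> (r \<otimes> s) = x \<cdot>\<^bsub>E\<^esub> r \<cdot>\<^bsub>E\<^esub> s" using r(1) s(1) by (simp add: act_assoc)
    then show ?thesis using s r(1) by (intro bexI[of _ "r \<otimes> s"]) auto
  qed
  note u = uniform_summand[OF mE rE' E'0 uniE']
  note mod = direct_sum_modular[OF CF E'D CD]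
  let ?EC = "E' <+>\<^bsub>E\<^esub> C"
  note EC = rsubmodule_set_add[OF rE' rC]
  have "Kt D \<inter> Kt ?EC = Kt (D \<inter> ?EC)" unfolding Kt_def by blast
  then have "Kt D \<inter> Kt ?EC = K" unfolding mod(2) using KC K_Kt[OF rC] by simp
  then have "Kt D = K \<or> Kt ?EC = K" using irr Kt[OF rD] Kt[OF EC(1)] unfolding meet_irreducible_def by blast
  moreover have "Kt ?EC \<noteq> K"
  proof
    assume "Kt ?EC = K"
    then have "?EC \<in> \<C>" using mod(1) by (auto simp: \<C>_def direct_summand_def)
    moreover have "tr C \<subseteq> tr ?EC" using EC(3) by (auto simp: tr_def)
    ultimately have "tr ?EC = tr C" by (rule maxC)
    moreover have "m \<cdot>\<^bsub>E\<^esub> n \<in> ?EC"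
    proof -
      have mn: "m \<cdot>\<^bsub>E\<^esub> n \<in> carrier E" using m nR by simp
      have "m \<cdot>\<^bsub>E\<^esub> n = p (m \<cdot>\<^bsub>E\<^esub> n) \<oplus>\<^bsub>E\<^esub> (m \<cdot>\<^bsub>E\<^esub> n \<ominus>\<^bsub>E\<^esub> p (m \<cdot>\<^bsub>E\<^esub> n))"
        using mn ph(1)[OF mn] by (metis M.a_comm M.a_inv_closed M.minus_eq M.a_assoc M.l_neg M.r_zero M.a_closed)
      then show ?thesis unfolding set_add_def' using w0(1) WE' pC[OF mn] by blast
    qed
    ultimately show False using n(2) nR by (auto simp: tr_def)
  qed
  ultimately have "Kt D = K" by blast
  then show thesis using that[OF E'D u] by (auto simp: Kt_def)
qed

section \<open>Quotient modules and quotient rings\<close>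

lemma quot_rmod_props:
  assumes "right_module R M" and N: "rsubmodule R M N"
  shows carrier_quot_rmod: "carrier (quot_rmod M N) = (\<lambda>x. N +>\<^bsub>M\<^esub> x) ` carrier M"
    and add_quot_rmod: "\<And>x y. x \<in> carrier M \<Longrightarrow> y \<in> carrier M \<Longrightarrow>
      (N +>\<^bsub>M\<^esub> x) \<oplus>\<^bsub>quot_rmod M N\<^esub> (N +>\<^bsub>M\<^esub> y) = N +>\<^bsub>M\<^esub> (x \<oplus>\<^bsub>M\<^esub> y)"
    and zero_quot_rmod: "\<zero>\<^bsub>quot_rmod M N\<^esub> = N"
    and coset_self: "\<And>x. x \<in> carrier M \<Longrightarrow> x \<in> N +>\<^bsub>M\<^esub> x"
    and coset_eq_iff: "\<And>x y. x \<in> carrier M \<Longrightarrow> y \<in> carrier M \<Longrightarrow>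
      N +>\<^bsub>M\<^esub> x = N +>\<^bsub>M\<^esub> y \<longleftrightarrow> x \<ominus>\<^bsub>M\<^esub> y \<in> N"
    and coset_zero_iff: "\<And>x. x \<in> carrier M \<Longrightarrow> N +>\<^bsub>M\<^esub> x = N \<longleftrightarrow> x \<in> N"
    and mem_coset_iff: "\<And>x y. y \<in> N +>\<^bsub>M\<^esub> x \<longleftrightarrow> (\<exists>n\<in>N. y = n \<oplus>\<^bsub>M\<^esub> x)"
proof -
  interpret right_module R M by fact
  interpret S: abelian_subgroup N M
    using N by (intro abelian_subgroupI3 M.abelian_group_axioms) (auto simp: rsubmodule_def)
  note Ni = rsubmoduleD[OF N]
  show "carrier (quot_rmod M N) = (\<lambda>x. N +>\<^bsub>M\<^esub> x) ` carrier M"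
    by (auto simp: quot_rmod_def A_RCOSETS_def')
  show "\<And>x y. x \<in> carrier M \<Longrightarrow> y \<in> carrier M \<Longrightarrow>
      (N +>\<^bsub>M\<^esub> x) \<oplus>\<^bsub>quot_rmod M N\<^esub> (N +>\<^bsub>M\<^esub> y) = N +>\<^bsub>M\<^esub> (x \<oplus>\<^bsub>M\<^esub> y)"
    using S.a_rcos_sum by (simp add: quot_rmod_def)
  show "\<zero>\<^bsub>quot_rmod M N\<^esub> = N" by (simp add: quot_rmod_def)
  show self: "x \<in> N +>\<^bsub>M\<^esub> x" if "x \<in> carrier M" for x using S.a_rcos_self that .
  show mem: "y \<in> N +>\<^bsub>M\<^esub> x \<longleftrightarrow> (\<exists>n\<in>N. y = n \<oplus>\<^bsub>M\<^esub> x)" for x y by (auto simp: a_r_coset_def')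
  show eq: "N +>\<^bsub>M\<^esub> x = N +>\<^bsub>M\<^esub> y \<longleftrightarrow> x \<ominus>\<^bsub>M\<^esub> y \<in> N" if "x \<in> carrier M" "y \<in> carrier M" for x y
  proof
    assume "N +>\<^bsub>M\<^esub> x = N +>\<^bsub>M\<^esub> y"
    then have "x \<in> N +>\<^bsub>M\<^esub> y" using self[OF that(1)] by simp
    then obtain n where n: "n \<in> N" "x = n \<oplus>\<^bsub>M\<^esub> y" unfolding mem by blast
    have "n \<in> carrier M" using n Ni(1) by blast
    then have "x \<ominus>\<^bsub>M\<^esub> y = n" unfolding n(2) using that(2) by (simp add: a_minus_def M.a_assoc M.r_neg)
    then show "x \<ominus>\<^bsub>M\<^esub> y \<in> N" using n by simp
  next
    assume n: "x \<ominus>\<^bsub>M\<^esub> y \<in> N"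
    have "x = (x \<ominus>\<^bsub>M\<^esub> y) \<oplus>\<^bsub>M\<^esub> y" using that by (simp add: a_minus_def M.a_assoc M.l_neg)
    then have "x \<in> N +>\<^bsub>M\<^esub> y" unfolding mem using n by blast
    then show "N +>\<^bsub>M\<^esub> x = N +>\<^bsub>M\<^esub> y" using S.a_repr_independence'[of x y] that by simp
  qed
  show "N +>\<^bsub>M\<^esub> x = N \<longleftrightarrow> x \<in> N" if "x \<in> carrier M" for x
  proof -
    have "N +>\<^bsub>M\<^esub> \<zero>\<^bsub>M\<^esub> = N" using Ni(1) by (auto simp: a_r_coset_def' subset_iff)
    moreover have m: "\<ominus>\<^bsub>M\<^esub> \<zero>\<^bsub>M\<^esub> = \<zero>\<^bsub>M\<^esub>" by (rule M.minus_equality) auto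
    moreover have "x \<ominus>\<^bsub>M\<^esub> \<zero>\<^bsub>M\<^esub> = x" using that by (simp only: a_minus_def m M.r_zero)
    ultimately show ?thesis using eq[OF that M.zero_closed] by simp
  qed
qed

lemma (in ideal) right_ideal: "right_ideal R I"
  unfolding right_ideal_iff using a_subset by (auto intro: I_r_closed)

lemma (in ideal) Quot_props:
  shows carrier_Quot: "carrier (R Quot I) = (\<lambda>r. I +> r) ` carrier R"
    and mult_Quot: "\<And>a b. a \<in> carrier R \<Longrightarrow> b \<in> carrier R \<Longrightarrow> (I +> a) \<otimes>\<^bsub>R Quot I\<^esub> (I +> b) = I +> (a \<otimes> b)"
    and add_Quot: "\<And>a b. a \<in> carrier R \<Longrightarrow> b \<in> carrier R \<Longrightarrow> (I +> a) \<oplus>\<^bsub>R Quot I\<^esub> (I +> b) = I +> (a \<oplus> b)"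
    and zero_Quot: "\<zero>\<^bsub>R Quot I\<^esub> = I" and one_Quot: "\<one>\<^bsub>R Quot I\<^esub> = I +> \<one>"
    and Quot_zero_iff: "\<And>a. a \<in> carrier R \<Longrightarrow> I +> a = I \<longleftrightarrow> a \<in> I"
    and Quot_self: "\<And>a. a \<in> carrier R \<Longrightarrow> a \<in> I +> a"
proof -
  interpret reg: right_module R "regular_rmod R" by (rule right_module_regular) (rule ring_axioms)
  have cos: "I +>\<^bsub>regular_rmod R\<^esub> x = I +> x" for x by (simp add: a_r_coset_def' regular_rmod_def)
  note q = quot_rmod_props[OF reg.right_module_axioms right_ideal, unfolded cos]
  have c: "carrier (regular_rmod R) = carrier R" by (simp add: regular_rmod_def)
  show "carrier (R Quot I) = (\<lambda>r. I +> r) ` carrier R" by (auto simp: FactRing_def A_RCOSETS_def')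
  show "\<zero>\<^bsub>R Quot I\<^esub> = I" "\<one>\<^bsub>R Quot I\<^esub> = I +> \<one>" by (simp_all add: FactRing_def)
  fix a assume a: "a \<in> carrier R"
  show "I +> a = I \<longleftrightarrow> a \<in> I" "a \<in> I +> a" using q(6)[of a] q(4)[of a] a by (simp_all add: c)
  fix b assume b: "b \<in> carrier R"
  show "(I +> a) \<otimes>\<^bsub>R Quot I\<^esub> (I +> b) = I +> (a \<otimes> b)"
    using rcoset_mult_add[OF a b] by (simp add: FactRing_def)
  show "(I +> a) \<oplus>\<^bsub>R Quot I\<^esub> (I +> b) = I +> (a \<oplus> b)"
    using a b by (simp add: FactRing_def a_rcos_sum)
qed

lemma (in ideal) quot_regular_props:
  defines "A \<equiv> quot_rmod (regular_rmod R) I"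
  shows right_module_quot_regular: "right_module R A"
    and carrier_quot_regular: "carrier A = carrier (R Quot I)"
    and add_quot_regular: "add A = add (R Quot I)" and zero_quot_regular: "\<zero>\<^bsub>A\<^esub> = I"
    and act_quot_regular: "\<And>a r. a \<in> carrier R \<Longrightarrow> r \<in> carrier R \<Longrightarrow> (I +> a) \<cdot>\<^bsub>A\<^esub> r = I +> (a \<otimes> r)"
proof -
  interpret reg: right_module R "regular_rmod R" by (rule right_module_regular) (rule ring_axioms)
  have cos: "I +>\<^bsub>regular_rmod R\<^esub> x = I +> x" for x by (simp add: a_r_coset_def' regular_rmod_def)
  note q = right_module_quot[OF reg.right_module_axioms right_ideal, unfolded cos]
  have c: "carrier (regular_rmod R) = carrier R" "a \<cdot>\<^bsub>regular_rmod R\<^esub> r = a \<otimes> r" for a r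
    by (simp_all add: regular_rmod_def)
  show "right_module R A" unfolding A_def by (rule q(1))
  show "carrier A = carrier (R Quot I)"
    using quot_rmod_props(1)[OF reg.right_module_axioms right_ideal, unfolded cos c]
    by (simp add: A_def carrier_Quot)
  show "add A = add (R Quot I)"
    unfolding A_def by (intro ext) (simp add: quot_rmod_def FactRing_def set_add_def' regular_rmod_def)
  show "\<zero>\<^bsub>A\<^esub> = I" by (simp add: A_def quot_rmod_def)
  show "\<And>a r. a \<in> carrier R \<Longrightarrow> r \<in> carrier R \<Longrightarrow> (I +> a) \<cdot>\<^bsub>A\<^esub> r = I +> (a \<otimes> r)"
    using q(2) unfolding A_def by (simp add: c)
qed

text \<open>Representatives of a coset act alike on \<open>x\<close>, as their differences annihilate it.\<close>

lemma (in ideal) act_over_quot: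
  assumes X: "right_module R X" and 0: "\<And>a. a \<in> I \<Longrightarrow> x \<cdot>\<^bsub>X\<^esub> a = \<zero>\<^bsub>X\<^esub>"
    and x: "x \<in> carrier X" and r: "r \<in> carrier R"
  shows "x \<cdot>\<^bsub>over_quot I X\<^esub> (I +> r) = x \<cdot>\<^bsub>X\<^esub> r"
proof -
  interpret X: right_module R X by fact
  have "x \<cdot>\<^bsub>X\<^esub> s = x \<cdot>\<^bsub>X\<^esub> r" if s: "s \<in> I +> r" for s
  proof -
    obtain a where a: "a \<in> I" "s = a \<oplus> r" using s by (auto simp: a_r_coset_def')
    have "a \<in> carrier R" using a a_subset by blast
    then show ?thesis using a 0[OF a(1)] x r by (simp add: X.act_r_distr)
  qed
  then have "(\<lambda>s. x \<cdot>\<^bsub>X\<^esub> s) ` (I +> r) = {x \<cdot>\<^bsub>X\<^esub> r}" using Quot_self[OF r] by blast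
  then show ?thesis by (simp add: over_quot_def)
qed

section \<open>Extension classes\<close>

text \<open>An element \<open>y\<close> of \<open>B\<close> with \<open>yP \<subseteq> N\<close> gives a homomorphism \<open>R/P \<rightarrow> B/N\<close>; the connecting homomorphism
  sends it to a class in \<open>Ext\<^sup>1(R/P, N)\<close>, represented by the cocycle \<open>r + P \<mapsto> d(h(yr))\<close> for any
  extension \<open>h\<close> of the augmentation to \<open>B\<close>.\<close>

locale extension_classes = ideal P R + right_module R B
  for P and R :: "('r, 'x) ring_scheme" (structure) and B :: "('r, 'b) rmod" (structure) +
  fixes N :: "'b set" and J :: "('r, 'b, 'i) coresolution" and h :: "'b \<Rightarrow> 'i"
  assumes N: "rsubmodule R B N" and J: "injective_resolution R (sub_rmod B N) J"
    and h: "h \<in> rhom R B (obj J 0)" and h_aug: "\<And>n. n \<in> N \<Longrightarrow> h n = aug J n"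
begin

abbreviation "A \<equiv> quot_rmod (regular_rmod R) P"
abbreviation "H k \<equiv> hom_rmod R (\<lambda>C D. C \<otimes>\<^bsub>R Quot P\<^esub> D) A (obj J k)"

definition cocycle :: "'b \<Rightarrow> 'r set \<Rightarrow> 'i" where
  "cocycle y = (\<lambda>C\<in>carrier A. the_elem ((\<lambda>r. diff J 0 (h (y \<cdot>\<^bsub>B\<^esub> r))) ` C))"

definition ext_class :: "'b \<Rightarrow> ('r set \<Rightarrow> 'i) set" where
  "ext_class y = coboundaries R A J 1 +>\<^bsub>H 1\<^esub> cocycle y"

definition annihilated_mod :: "'b set" where
  "annihilated_mod = {y \<in> carrier B. \<forall>p\<in>P. y \<cdot>\<^bsub>B\<^esub> p \<in> N}"

lemma A_carrier: "carrier A = (\<lambda>r. P +> r) ` carrier R"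
  by (simp add: carrier_quot_regular carrier_Quot)

lemma obj: "right_module R (obj J k)"
  using J by (simp add: injective_resolution_def injective_rmod_def)

lemma diff_hom: "diff J k \<in> rhom R (obj J k) (obj J (Suc k))"
  using J by (simp add: injective_resolution_def)

lemmas diff_props = rhom_props[OF obj obj diff_hom]
lemmas h_props = rhom_props[OF right_module_axioms obj h]
lemmas N_props = rsubmoduleD[OF N]

lemma diff_diff: "x \<in> carrier (obj J k) \<Longrightarrow> diff J (Suc k) (diff J k x) = \<zero>\<^bsub>obj J (Suc (Suc k))\<^esub>"
proof -
  assume "x \<in> carrier (obj J k)"
  then have "diff J k x \<in> a_kernel (obj J (Suc k)) (obj J (Suc (Suc k))) (diff J (Suc k))"
    using J unfolding injective_resolution_def by blast
  then show ?thesis by (simp add: a_kernel_def kernel_def)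
qed

lemma diff_zero_iff:
  assumes "x \<in> carrier (obj J 0)"
  shows "diff J 0 x = \<zero>\<^bsub>obj J 1\<^esub> \<longleftrightarrow> (\<exists>n\<in>N. x = h n)"
proof -
  have "aug J ` N = a_kernel (obj J 0) (obj J 1) (diff J 0)"
    using J by (simp add: injective_resolution_def sub_rmod_def)
  then have "x \<in> aug J ` N \<longleftrightarrow> diff J 0 x = \<zero>\<^bsub>obj J 1\<^esub>" using assms by (auto simp: a_kernel_def kernel_def)
  then show ?thesis using h_aug by auto
qed

lemma h_inj_on_N: "n \<in> N \<Longrightarrow> h n = \<zero>\<^bsub>obj J 0\<^esub> \<Longrightarrow> n = \<zero>\<^bsub>B\<^esub>"
proof -
  assume n: "n \<in> N" "h n = \<zero>\<^bsub>obj J 0\<^esub>"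
  have inj: "inj_on (aug J) N"
    using J by (simp add: injective_resolution_def rembedding_def sub_rmod_def)
  have "aug J \<zero>\<^bsub>B\<^esub> = \<zero>\<^bsub>obj J 0\<^esub>" using h_aug[OF N_props(2)] h_props(4) by simp
  then show ?thesis using inj_onD[OF inj, of n "\<zero>\<^bsub>B\<^esub>"] n h_aug N_props(2) by simp
qed

lemma right_module_H: "right_module (R Quot P) (H k)"
proof -
  interpret Q: ring "R Quot P" by (rule quotient_is_ring)
  show ?thesis
  proof (rule right_module_hom[OF right_module_quot_regular obj Q.ring_axioms])
    fix s assume s: "s \<in> carrier (R Quot P)"
    have act: "(s \<otimes>\<^bsub>R Quot P\<^esub> x) \<cdot>\<^bsub>A\<^esub> r = s \<otimes>\<^bsub>R Quot P\<^esub> (x \<cdot>\<^bsub>A\<^esub> r)"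
      if "x \<in> carrier A" "r \<in> carrier R" for x r
    proof -
      obtain a where "a \<in> carrier R" "s = P +> a" using s by (auto simp: carrier_Quot)
      moreover obtain b where "b \<in> carrier R" "x = P +> b"
        using \<open>x \<in> carrier A\<close> by (auto simp: A_carrier)
      ultimately show ?thesis using that by (simp add: mult_Quot act_quot_regular m_assoc)
    qed
    show "(\<lambda>D. s \<otimes>\<^bsub>R Quot P\<^esub> D) \<in> rhom R A A"
      unfolding rhom_def using s act
      by (auto simp: carrier_quot_regular add_quot_regular Q.r_distr)
  qed (auto simp: carrier_quot_regular add_quot_regular Q.l_distr Q.m_assoc)
qed

lemma H_carrier: "f \<in> carrier (H k) \<longleftrightarrow> f \<in> rhom R A (obj J k) \<and> f \<in> extensional (carrier A)"
  by (auto simp: hom_rmod_def)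

lemma H_add: "f \<oplus>\<^bsub>H k\<^esub> g = (\<lambda>x\<in>carrier A. f x \<oplus>\<^bsub>obj J k\<^esub> g x)"
  by (simp add: hom_rmod_def)

lemma H_act: "f \<cdot>\<^bsub>H k\<^esub> s = (\<lambda>x\<in>carrier A. f (s \<otimes>\<^bsub>R Quot P\<^esub> x))"
  by (simp add: hom_rmod_def)

lemma H_zero: "\<zero>\<^bsub>H k\<^esub> = (\<lambda>x\<in>carrier A. \<zero>\<^bsub>obj J k\<^esub>)"
  by (simp add: hom_rmod_def)

text \<open>The differentials of the complex \<open>Hom(R/P, I\<^sup>\<bullet>)\<close>.\<close>

definition hom_diff :: "nat \<Rightarrow> ('r set \<Rightarrow> 'i) \<Rightarrow> 'r set \<Rightarrow> 'i" where
  "hom_diff k g = (\<lambda>x\<in>carrier A. diff J k (g x))"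

lemma hom_diff_hom: "hom_diff k \<in> rhom (R Quot P) (H k) (H (Suc k))"
proof -
  interpret A: right_module R A by (rule right_module_quot_regular)
  interpret Q: ring "R Quot P" by (rule quotient_is_ring)
  have g: "\<And>x. x \<in> carrier A \<Longrightarrow> g x \<in> carrier (obj J k)"
    "\<And>x y. x \<in> carrier A \<Longrightarrow> y \<in> carrier A \<Longrightarrow> g (x \<oplus>\<^bsub>A\<^esub> y) = g x \<oplus>\<^bsub>obj J k\<^esub> g y"
    "\<And>x r. x \<in> carrier A \<Longrightarrow> r \<in> carrier R \<Longrightarrow> g (x \<cdot>\<^bsub>A\<^esub> r) = g x \<cdot>\<^bsub>obj J k\<^esub> r"
    if "g \<in> carrier (H k)" for g
    using that rhom_props[OF right_module_quot_regular obj, of g] unfolding H_carrier by blast+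
  show ?thesis
    unfolding rhom_def
  proof (intro CollectI conjI ballI Pi_I)
    fix f assume f: "f \<in> carrier (H k)"
    show "hom_diff k f \<in> carrier (H (Suc k))"
      unfolding H_carrier using g[OF f] by (simp add: hom_diff_def rhom_def diff_props)
    show "hom_diff k (f \<cdot>\<^bsub>H k\<^esub> s) = hom_diff k f \<cdot>\<^bsub>H (Suc k)\<^esub> s" if "s \<in> carrier (R Quot P)" for s
      unfolding hom_diff_def H_act using that by (intro restrict_ext) (simp add: carrier_quot_regular)
    show "hom_diff k (f \<oplus>\<^bsub>H k\<^esub> g') = hom_diff k f \<oplus>\<^bsub>H (Suc k)\<^esub> hom_diff k g'" if "g' \<in> carrier (H k)" for g'
      unfolding hom_diff_def H_add using g(1)[OF f] g(1)[OF that] by (intro restrict_ext) (simp add: diff_props)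
  qed
qed

lemma cocycles_eq: "cocycles R A J 1 = {f \<in> carrier (H 1). hom_diff 1 f \<in> {\<zero>\<^bsub>H (Suc 1)\<^esub>}}"
proof -
  have "hom_diff 1 f = \<zero>\<^bsub>H (Suc 1)\<^esub> \<longleftrightarrow> (\<forall>x\<in>carrier A. diff J 1 (f x) = \<zero>\<^bsub>obj J (Suc 1)\<^esub>)" for f
    by (auto simp: hom_diff_def H_zero restrict_def fun_eq_iff)
  then show ?thesis by (auto simp: cocycles_def H_carrier)
qed

lemma coboundaries_eq: "coboundaries R A J 1 = hom_diff 0 ` carrier (H 0)"
  by (simp add: hom_diff_def hom_rmod_def)

lemma cocycles_rsubmodule: "rsubmodule (R Quot P) (H 1) (cocycles R A J 1)"
  unfolding cocycles_eq
  by (rule rsubmodule_preimage[OF right_module_H right_module_H hom_diff_hom])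
    (rule right_module.rsubmodule_zero[OF right_module_H])

lemma coboundaries_rsubmodule: "rsubmodule (R Quot P) (H 1) (coboundaries R A J 1)"
  unfolding coboundaries_eq
  using rsubmodule_image[OF right_module_H right_module_H hom_diff_hom
      right_module.rsubmodule_carrier[OF right_module_H], of 0] by simp

lemma coboundary_cocycle: "coboundaries R A J 1 \<subseteq> cocycles R A J 1"
proof
  fix f assume "f \<in> coboundaries R A J 1"
  then obtain g where g: "g \<in> carrier (H 0)" "f = hom_diff 0 g" unfolding coboundaries_eq by blast
  have gc: "g x \<in> carrier (obj J 0)" if "x \<in> carrier A" for x
    using g(1) rhom_props(1)[OF right_module_quot_regular obj] that unfolding H_carrier by blast
  have "f \<in> carrier (H 1)"
    using rhom_props(1)[OF right_module_H right_module_H hom_diff_hom g(1)] g(2) by simp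
  moreover have "diff J 1 (f x) = \<zero>\<^bsub>obj J (Suc 1)\<^esub>" if "x \<in> carrier A" for x
    unfolding g(2) using that diff_diff[OF gc[OF that]] by (simp add: hom_diff_def)
  ultimately show "f \<in> cocycles R A J 1" by (simp add: cocycles_def H_carrier)
qed

abbreviation "Ext1 \<equiv> Ext_quot R P J 1"

lemma Ext1_eq: "Ext1 = quot_rmod (sub_rmod (H 1) (cocycles R A J 1)) (coboundaries R A J 1)"
  by (simp add: Ext_quot_def Ext_def)

lemma right_module_cocycles: "right_module (R Quot P) (sub_rmod (H 1) (cocycles R A J 1))"
  by (rule right_module_sub_rmod[OF right_module_H cocycles_rsubmodule])

lemma coboundaries_in_cocycles: "rsubmodule (R Quot P) (sub_rmod (H 1) (cocycles R A J 1)) (coboundaries R A J 1)"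
  unfolding rsubmodule_sub_rmod_iff[OF right_module_H cocycles_rsubmodule]
  using coboundaries_rsubmodule coboundary_cocycle by blast

lemma coset_cocycles: "coboundaries R A J 1 +>\<^bsub>sub_rmod (H 1) (cocycles R A J 1)\<^esub> f = coboundaries R A J 1 +>\<^bsub>H 1\<^esub> f"
  by (simp add: a_r_coset_def' sub_rmod_def)

lemmas Ext1_props = quot_rmod_props[OF right_module_cocycles coboundaries_in_cocycles, folded Ext1_eq, unfolded coset_cocycles]
lemmas Ext1_act = right_module_quot(2)[OF right_module_cocycles coboundaries_in_cocycles, folded Ext1_eq, unfolded coset_cocycles]

lemma right_module_Ext1: "right_module (R Quot P) Ext1"
  by (rule right_module_Ext_quot[OF ideal_axioms J])

lemma cocycle_apply:
  assumes y: "y \<in> annihilated_mod" and r: "r \<in> carrier R"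
  shows "cocycle y (P +> r) = diff J 0 (h (y \<cdot>\<^bsub>B\<^esub> r))"
proof -
  interpret O: right_module R "obj J (Suc 0)" by (rule obj)
  have yB: "y \<in> carrier B" using y by (simp add: annihilated_mod_def)
  have "diff J 0 (h (y \<cdot>\<^bsub>B\<^esub> s)) = diff J 0 (h (y \<cdot>\<^bsub>B\<^esub> r))" if s: "s \<in> P +> r" for s
  proof -
    obtain p where p: "p \<in> P" "s = p \<oplus> r" using s by (auto simp: a_r_coset_def')
    have pR: "p \<in> carrier R" using p a_subset by blast
    have n: "y \<cdot>\<^bsub>B\<^esub> p \<in> N" using y p by (simp add: annihilated_mod_def)
    have c: "h (y \<cdot>\<^bsub>B\<^esub> p) \<in> carrier (obj J 0)" "h (y \<cdot>\<^bsub>B\<^esub> r) \<in> carrier (obj J 0)"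
      using h_props(1) yB pR r by auto
    have "diff J 0 (h (y \<cdot>\<^bsub>B\<^esub> p)) = \<zero>\<^bsub>obj J 1\<^esub>" using diff_zero_iff[OF c(1)] n by blast
    then show ?thesis unfolding p(2) using yB pR r c diff_props(1)[where k=0]
      by (simp add: act_r_distr h_props(2) diff_props(2)[where k=0])
  qed
  then have "(\<lambda>s. diff J 0 (h (y \<cdot>\<^bsub>B\<^esub> s))) ` (P +> r) = {diff J 0 (h (y \<cdot>\<^bsub>B\<^esub> r))}"
    using Quot_self[OF r] by blast
  then show ?thesis using r by (simp add: cocycle_def A_carrier)
qed

lemma cocycle_in_cocycles:
  assumes y: "y \<in> annihilated_mod" shows "cocycle y \<in> cocycles R A J 1"
proof -
  have yB: "y \<in> carrier B" using y by (simp add: annihilated_mod_def)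
  have c: "h (y \<cdot>\<^bsub>B\<^esub> r) \<in> carrier (obj J 0)" if "r \<in> carrier R" for r using yB that h_props(1) by simp
  have "cocycle y \<in> rhom R A (obj J 1)"
    unfolding rhom_def
  proof (intro CollectI conjI ballI Pi_I)
    fix x assume "x \<in> carrier A"
    then obtain a where a: "a \<in> carrier R" "x = P +> a" by (auto simp: A_carrier)
    show "cocycle y x \<in> carrier (obj J 1)"
      using a c diff_props(1)[where k=0] by (simp add: cocycle_apply[OF y])
    show "cocycle y (x \<cdot>\<^bsub>A\<^esub> r) = cocycle y x \<cdot>\<^bsub>obj J 1\<^esub> r" if "r \<in> carrier R" for r
      using a c that yB by (simp add: act_quot_regular cocycle_apply[OF y] act_assoc h_props(3) diff_props(3)[where k=0])
    fix z assume "z \<in> carrier A"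
    then obtain b where b: "b \<in> carrier R" "z = P +> b" by (auto simp: A_carrier)
    show "cocycle y (x \<oplus>\<^bsub>A\<^esub> z) = cocycle y x \<oplus>\<^bsub>obj J 1\<^esub> cocycle y z"
      using a b c yB by (simp add: add_quot_regular add_Quot cocycle_apply[OF y] act_r_distr h_props(2) diff_props(2)[where k=0])
  qed
  moreover have "diff J 1 (cocycle y x) = \<zero>\<^bsub>obj J (Suc 1)\<^esub>" if "x \<in> carrier A" for x
    using that c diff_diff[where k=0] by (auto simp: A_carrier cocycle_apply[OF y])
  ultimately show ?thesis by (auto simp: cocycles_def cocycle_def)
qed

lemma rsubmodule_annihilated_mod: "rsubmodule R B annihilated_mod"
  unfolding annihilated_mod_def by (rule rsubmodule_residual[OF ideal_axioms N])

lemma ext_class_closed: "y \<in> annihilated_mod \<Longrightarrow> ext_class y \<in> carrier Ext1"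
  unfolding Ext1_props(1) ext_class_def using cocycle_in_cocycles by (auto simp: sub_rmod_def)

lemma ext_class_add:
  assumes x: "x \<in> annihilated_mod" and y: "y \<in> annihilated_mod"
  shows "ext_class (x \<oplus>\<^bsub>B\<^esub> y) = ext_class x \<oplus>\<^bsub>Ext1\<^esub> ext_class y"
proof -
  have xyB: "x \<in> carrier B" "y \<in> carrier B" using x y by (auto simp: annihilated_mod_def)
  have xy: "x \<oplus>\<^bsub>B\<^esub> y \<in> annihilated_mod" using rsubmoduleD(3)[OF rsubmodule_annihilated_mod x y] .
  have "cocycle (x \<oplus>\<^bsub>B\<^esub> y) C = (cocycle x \<oplus>\<^bsub>H 1\<^esub> cocycle y) C" if "C \<in> carrier A" for C
  proof -
    obtain a where a: "a \<in> carrier R" "C = P +> a" using \<open>C \<in> carrier A\<close> by (auto simp: A_carrier)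
    have c: "h (x \<cdot>\<^bsub>B\<^esub> a) \<in> carrier (obj J 0)" "h (y \<cdot>\<^bsub>B\<^esub> a) \<in> carrier (obj J 0)"
      using h_props(1) xyB a(1) by auto
    show ?thesis using a c xyB that
      by (simp add: H_add cocycle_apply[OF x] cocycle_apply[OF y] cocycle_apply[OF xy] act_l_distr
          h_props(2) diff_props(2)[where k=0])
  qed
  then have "cocycle (x \<oplus>\<^bsub>B\<^esub> y) = cocycle x \<oplus>\<^bsub>H 1\<^esub> cocycle y"
    by (intro extensionalityI[where A="carrier A"]) (auto simp: cocycle_def H_add)
  then show ?thesis
    unfolding ext_class_def using cocycle_in_cocycles[OF x] cocycle_in_cocycles[OF y]
    by (subst Ext1_props(2)) (auto simp: sub_rmod_def)
qed

lemma ext_class_act: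
  assumes y: "y \<in> annihilated_mod" and r: "r \<in> carrier R"
  shows "ext_class (y \<cdot>\<^bsub>B\<^esub> r) = ext_class y \<cdot>\<^bsub>Ext1\<^esub> (P +> r)"
proof -
  have yB: "y \<in> carrier B" using y by (auto simp: annihilated_mod_def)
  have yr: "y \<cdot>\<^bsub>B\<^esub> r \<in> annihilated_mod" using rsubmoduleD(4)[OF rsubmodule_annihilated_mod y r] .
  have "cocycle (y \<cdot>\<^bsub>B\<^esub> r) C = (cocycle y \<cdot>\<^bsub>H 1\<^esub> (P +> r)) C" if "C \<in> carrier A" for C
  proof -
    obtain a where a: "a \<in> carrier R" "C = P +> a" using \<open>C \<in> carrier A\<close> by (auto simp: A_carrier)
    show ?thesis using a yB r that
      by (simp add: H_act mult_Quot cocycle_apply[OF y] cocycle_apply[OF yr] act_assoc)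
  qed
  then have "cocycle (y \<cdot>\<^bsub>B\<^esub> r) = cocycle y \<cdot>\<^bsub>H 1\<^esub> (P +> r)"
    by (intro extensionalityI[where A="carrier A"]) (auto simp: cocycle_def H_act)
  then show ?thesis
    unfolding ext_class_def using cocycle_in_cocycles[OF y] r
    by (subst Ext1_act) (auto simp: sub_rmod_def carrier_Quot)
qed

lemma ext_class_zero_iff: "y \<in> annihilated_mod \<Longrightarrow> ext_class y = \<zero>\<^bsub>Ext1\<^esub> \<longleftrightarrow> cocycle y \<in> coboundaries R A J 1"
  unfolding ext_class_def Ext1_props(3)
  using cocycle_in_cocycles by (subst Ext1_props(6)) (auto simp: sub_rmod_def)

text \<open>If the cocycle of \<open>y\<close> is the coboundary of \<open>g : R/P \<rightarrow> I\<^sup>0\<close>, then \<open>g(1) = h(y - n)\<close> for some \<open>n \<in> N\<close>.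
  This element is annihilated by \<open>P\<close>. When \<open>N\<close> is essential in \<open>B\<close>, \<open>h\<close> is injective, and so
  \<open>(y - n)P = 0\<close>.\<close>

lemma ext_class_zero:
  assumes y: "y \<in> annihilated_mod" and 0: "ext_class y = \<zero>\<^bsub>Ext1\<^esub>" and ess: "essential_submodule R B N"
  obtains n where "n \<in> N" "\<And>p. p \<in> P \<Longrightarrow> (y \<ominus>\<^bsub>B\<^esub> n) \<cdot>\<^bsub>B\<^esub> p = \<zero>\<^bsub>B\<^esub>"
proof -
  interpret O: right_module R "obj J 0" by (rule obj)
  interpret O1: right_module R "obj J (Suc 0)" by (rule obj)
  have yB: "y \<in> carrier B" using y by (auto simp: annihilated_mod_def)
  have h0: "x = \<zero>\<^bsub>B\<^esub>" if x: "x \<in> carrier B" "h x = \<zero>\<^bsub>obj J 0\<^esub>" for x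
  proof (rule ccontr)
    assume "x \<noteq> \<zero>\<^bsub>B\<^esub>"
    then obtain r where r: "r \<in> carrier R" "x \<cdot>\<^bsub>B\<^esub> r \<in> N" "x \<cdot>\<^bsub>B\<^esub> r \<noteq> \<zero>\<^bsub>B\<^esub>"
      using ess x(1) unfolding essential_submodule_iff by blast
    have "h (x \<cdot>\<^bsub>B\<^esub> r) = \<zero>\<^bsub>obj J 0\<^esub>" using x r(1) by (simp add: h_props(3))
    then show False using h_inj_on_N r by blast
  qed
  obtain g where g: "g \<in> carrier (H 0)" "cocycle y = hom_diff 0 g"
    using 0 unfolding ext_class_zero_iff[OF y] coboundaries_eq by blast
  have gh: "g \<in> rhom R A (obj J 0)" using g unfolding H_carrier by blast
  note gp = rhom_props[OF right_module_quot_regular obj gh]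
  define z where "z = g (P +> \<one>)"
  have z: "z \<in> carrier (obj J 0)" unfolding z_def using gp(1) by (simp add: A_carrier)
  have zp: "z \<cdot>\<^bsub>obj J 0\<^esub> p = \<zero>\<^bsub>obj J 0\<^esub>" if p: "p \<in> P" for p
  proof -
    have pR: "p \<in> carrier R" using p a_subset by blast
    have "z \<cdot>\<^bsub>obj J 0\<^esub> p = g (P +> p)"
      unfolding z_def using gp(3)[of "P +> \<one>" p] pR by (simp add: A_carrier act_quot_regular)
    also have "P +> p = \<zero>\<^bsub>A\<^esub>" using Quot_zero_iff[OF pR] p by (simp add: zero_quot_regular)
    finally show ?thesis using gp(4) by simp
  qed
  have hy: "h y \<in> carrier (obj J 0)" using h_props(1) yB .
  have "diff J 0 (h y) = cocycle y (P +> \<one>)" using cocycle_apply[OF y one_closed] yB by simp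
  also have "\<dots> = diff J 0 z" unfolding g(2) z_def by (simp add: hom_diff_def A_carrier)
  finally have dz: "diff J 0 (h y) = diff J 0 z" .
  have "diff J 0 (h y \<ominus>\<^bsub>obj J 0\<^esub> z) = \<zero>\<^bsub>obj J 1\<^esub>"
    using rhom_minus[OF obj obj diff_hom[of 0] hy z] dz diff_props(1)[where k=0] hy z
    by (simp add: O1.M.minus_eq_zero_iff)
  then obtain n where n: "n \<in> N" "h y \<ominus>\<^bsub>obj J 0\<^esub> z = h n"
    using diff_zero_iff hy z by (meson O.M.minus_closed)
  have nB: "n \<in> carrier B" using n N_props(1) by blast
  have hn: "h n \<in> carrier (obj J 0)" using h_props(1) nB .
  have "h (y \<ominus>\<^bsub>B\<^esub> n) = h y \<ominus>\<^bsub>obj J 0\<^esub> h n" by (rule rhom_minus[OF right_module_axioms obj h yB nB])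
  also have "\<dots> = h y \<ominus>\<^bsub>obj J 0\<^esub> (h y \<ominus>\<^bsub>obj J 0\<^esub> z)" unfolding n(2) ..
  also have "\<dots> = z" using hy z
    by (simp add: a_minus_def O.M.minus_add O.M.a_assoc[symmetric] O.M.r_neg)
  finally have hz: "h (y \<ominus>\<^bsub>B\<^esub> n) = z" .
  have "(y \<ominus>\<^bsub>B\<^esub> n) \<cdot>\<^bsub>B\<^esub> p = \<zero>\<^bsub>B\<^esub>" if p: "p \<in> P" for p
  proof (rule h0)
    have pR: "p \<in> carrier R" using p a_subset by blast
    show "(y \<ominus>\<^bsub>B\<^esub> n) \<cdot>\<^bsub>B\<^esub> p \<in> carrier B" using yB nB pR by simp
    show "h ((y \<ominus>\<^bsub>B\<^esub> n) \<cdot>\<^bsub>B\<^esub> p) = \<zero>\<^bsub>obj J 0\<^esub>"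
      using h_props(3)[of "y \<ominus>\<^bsub>B\<^esub> n" p] yB nB pR hz zp[OF p] by simp
  qed
  then show thesis using n(1) by (rule that[rotated])
qed

lemma ext_class_annihilated:
  assumes y: "y \<in> carrier B" and yP: "\<And>p. p \<in> P \<Longrightarrow> y \<cdot>\<^bsub>B\<^esub> p = \<zero>\<^bsub>B\<^esub>"
  shows "ext_class y = \<zero>\<^bsub>Ext1\<^esub>"
proof -
  have yd: "y \<in> annihilated_mod" using y yP N_props(2) by (simp add: annihilated_mod_def)
  define g where "g = (\<lambda>C\<in>carrier A. the_elem ((\<lambda>r. h (y \<cdot>\<^bsub>B\<^esub> r)) ` C))"
  have g: "g (P +> r) = h (y \<cdot>\<^bsub>B\<^esub> r)" if r: "r \<in> carrier R" for r
  proof -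
    have "h (y \<cdot>\<^bsub>B\<^esub> s) = h (y \<cdot>\<^bsub>B\<^esub> r)" if s: "s \<in> P +> r" for s
    proof -
      obtain p where p: "p \<in> P" "s = p \<oplus> r" using s by (auto simp: a_r_coset_def')
      have pR: "p \<in> carrier R" using p a_subset by blast
      then show ?thesis unfolding p(2) using y r yP[OF p(1)] by (simp add: act_r_distr)
    qed
    then have "(\<lambda>r. h (y \<cdot>\<^bsub>B\<^esub> r)) ` (P +> r) = {h (y \<cdot>\<^bsub>B\<^esub> r)}" using Quot_self[OF r] by blast
    then show ?thesis using r by (simp add: g_def A_carrier)
  qed
  have "g \<in> rhom R A (obj J 0)"
    unfolding rhom_def
  proof (intro CollectI conjI ballI Pi_I)
    fix x assume "x \<in> carrier A"
    then obtain a where a: "a \<in> carrier R" "x = P +> a" by (auto simp: A_carrier)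
    show "g x \<in> carrier (obj J 0)" using a y by (simp add: g h_props(1))
    show "g (x \<cdot>\<^bsub>A\<^esub> r) = g x \<cdot>\<^bsub>obj J 0\<^esub> r" if "r \<in> carrier R" for r
      using a y that by (simp add: g act_quot_regular act_assoc h_props(3))
    fix z assume "z \<in> carrier A"
    then obtain b where b: "b \<in> carrier R" "z = P +> b" by (auto simp: A_carrier)
    show "g (x \<oplus>\<^bsub>A\<^esub> z) = g x \<oplus>\<^bsub>obj J 0\<^esub> g z"
      using a b y by (simp add: g add_quot_regular add_Quot act_r_distr h_props(2))
  qed
  then have "g \<in> carrier (H 0)" by (simp add: H_carrier g_def)
  moreover have "cocycle y = hom_diff 0 g"
  proof (rule extensionalityI[where A="carrier A"])
    fix x assume "x \<in> carrier A"
    then show "cocycle y x = hom_diff 0 g x"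
      by (auto simp: hom_diff_def A_carrier g cocycle_apply[OF yd])
  qed (auto simp: cocycle_def hom_diff_def)
  ultimately show ?thesis unfolding ext_class_zero_iff[OF yd] coboundaries_eq by blast
qed

lemma ext_class_of_N:
  assumes n: "n \<in> N" shows "ext_class n = \<zero>\<^bsub>Ext1\<^esub>"
proof -
  interpret H: right_module "R Quot P" "H 1" by (rule right_module_H)
  have nB: "n \<in> carrier B" using n N_props(1) by blast
  have nr: "n \<cdot>\<^bsub>B\<^esub> r \<in> N" if "r \<in> carrier R" for r using N_props(4)[OF n that] .
  have nd: "n \<in> annihilated_mod" using nB nr a_subset by (auto simp: annihilated_mod_def)
  have "cocycle n = \<zero>\<^bsub>H 1\<^esub>"
  proof (rule extensionalityI[where A="carrier A"])
    fix x assume "x \<in> carrier A"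
    then obtain a where a: "a \<in> carrier R" "x = P +> a" by (auto simp: A_carrier)
    have "diff J 0 (h (n \<cdot>\<^bsub>B\<^esub> a)) = \<zero>\<^bsub>obj J 1\<^esub>"
      using diff_zero_iff[of "h (n \<cdot>\<^bsub>B\<^esub> a)"] h_props(1) nB a(1) nr by auto
    then show "cocycle n x = \<zero>\<^bsub>H 1\<^esub> x" using a \<open>x \<in> carrier A\<close> by (simp add: H_zero cocycle_apply[OF nd])
  qed (auto simp: cocycle_def H_zero)
  then show ?thesis unfolding ext_class_zero_iff[OF nd] using H.rsubmoduleD(2)[OF coboundaries_rsubmodule] by simp
qed

end

section \<open>Regular elements modulo a prime ideal\<close>

lemma right_noetherian_Quot:
  fixes R (structure)
  assumes R: "right_noetherian R" and I: "ideal I R"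
  shows "right_noetherian (R Quot I)"
  unfolding right_noetherian_def
proof (intro conjI allI impI)
  interpret ideal I R by fact
  show "ring (R Quot I)" by (rule quotient_is_ring)
  then interpret Q: ring "R Quot I" .
  fix X :: "nat \<Rightarrow> 'a set set"
  assume X: "\<forall>n. right_ideal (R Quot I) (X n) \<and> X n \<subseteq> X (Suc n)"
  define Y where "Y n = {r \<in> carrier R. I +> r \<in> X n}" for n
  have "right_ideal R (Y n)" for n
  proof -
    note Xn = Q.right_idealD[OF X[rule_format, THEN conjunct1, of n]]
    have z: "I +> \<zero> = I" using Quot_zero_iff[OF zero_closed] a_subset additive_subgroup.zero_closed[OF is_additive_subgroup] by simp
    show ?thesis
      unfolding right_ideal_iff
    proof (intro conjI ballI)
      show "\<zero> \<in> Y n" using Xn(2) z by (simp add: Y_def zero_Quot)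
      show "x \<oplus> y \<in> Y n" if "x \<in> Y n" "y \<in> Y n" for x y
        using that Xn(3)[of "I +> x" "I +> y"] by (simp add: Y_def add_Quot)
      show "x \<otimes> r \<in> Y n" if "x \<in> Y n" "r \<in> carrier R" for x r
        using that Xn(4)[of "I +> x" "I +> r"] by (simp add: Y_def mult_Quot carrier_Quot)
    qed (auto simp: Y_def)
  qed
  moreover have "Y n \<subseteq> Y (Suc n)" for n using X by (auto simp: Y_def)
  ultimately obtain n where n: "\<forall>m\<ge>n. Y m = Y n" using R unfolding right_noetherian_def by blast
  have XY: "X m = (\<lambda>r. I +> r) ` Y m" for m
  proof -
    have "X m \<subseteq> (\<lambda>r. I +> r) ` carrier R"
      using Q.right_idealD(1)[OF X[rule_format, THEN conjunct1, of m]] by (auto simp: carrier_Quot)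
    then show ?thesis by (auto simp: Y_def)
  qed
  show "\<exists>n. \<forall>m\<ge>n. X m = X n" using n XY by metis
qed

lemma essential_mod_regular:
  fixes R (structure)
  assumes R: "right_noetherian R" and P: "ideal P R" and c: "c \<in> carrier R"
    and reg: "P +> c \<in> regular_elements (R Quot P)" and s: "s \<in> carrier R" "s \<notin> P"
  shows "\<exists>r\<in>carrier R. \<exists>t\<in>carrier R. \<exists>p\<in>P. s \<otimes> r = p \<oplus> c \<otimes> t \<and> s \<otimes> r \<notin> P"
proof -
  interpret ideal P R by fact
  have mem: "P +> a \<in> carrier (R Quot P)" if "a \<in> carrier R" for a using that by (simp add: carrier_Quot)
  have "\<exists>r\<in>carrier (R Quot P). \<exists>t\<in>carrier (R Quot P).
    (P +> s) \<otimes>\<^bsub>R Quot P\<^esub> r = (P +> c) \<otimes>\<^bsub>R Quot P\<^esub> t \<and> (P +> s) \<otimes>\<^bsub>R Quot P\<^esub> r \<noteq> \<zero>\<^bsub>R Quot P\<^esub>"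
  proof (rule essential_principal_right_ideal[OF right_noetherian_Quot[OF R P]])
    show "P +> s \<noteq> \<zero>\<^bsub>R Quot P\<^esub>" using s Quot_zero_iff by (simp add: zero_Quot)
  qed (use mem c s reg in \<open>auto simp: regular_elements_def\<close>)
  then obtain r t where r: "r \<in> carrier R" and t: "t \<in> carrier R"
    and eq: "(P +> s) \<otimes>\<^bsub>R Quot P\<^esub> (P +> r) = (P +> c) \<otimes>\<^bsub>R Quot P\<^esub> (P +> t)"
    and ne: "(P +> s) \<otimes>\<^bsub>R Quot P\<^esub> (P +> r) \<noteq> \<zero>\<^bsub>R Quot P\<^esub>"
    by (auto simp: carrier_Quot)
  have "P +> s \<otimes> r = P +> c \<otimes> t" using eq r t s c by (simp add: mult_Quot)
  then have "s \<otimes> r \<in> P +> c \<otimes> t" using Quot_self[of "s \<otimes> r"] s r by simp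
  then have "\<exists>p\<in>P. s \<otimes> r = p \<oplus> c \<otimes> t" by (auto simp: a_r_coset_def')
  moreover have "s \<otimes> r \<notin> P" using ne r s Quot_zero_iff by (simp add: mult_Quot zero_Quot)
  ultimately show ?thesis using r t by blast
qed

lemma regular_mod_in_essential:
  fixes R (structure)
  assumes R: "right_noetherian R" and Q: "ideal Q R"
    and prime: "\<And>a b. a \<in> carrier R \<Longrightarrow> b \<in> carrier R \<Longrightarrow>
      (\<And>s. s \<in> carrier R \<Longrightarrow> a \<otimes> s \<otimes> b \<in> Q) \<Longrightarrow> a \<in> Q \<or> b \<in> Q"
    and L: "right_ideal R L"
    and ess: "\<And>s. s \<in> carrier R \<Longrightarrow> s \<notin> Q \<Longrightarrow> \<exists>r\<in>carrier R. s \<otimes> r \<in> L \<and> s \<otimes> r \<notin> Q"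
  shows "\<exists>c\<in>L. Q +> c \<in> regular_elements (R Quot Q)"
proof -
  interpret ideal Q R by fact
  interpret S: ring "R Quot Q" by (rule quotient_is_ring)
  interpret S: prime_right_noetherian "R Quot Q"
  proof
    show "right_noetherian (R Quot Q)" by (rule right_noetherian_Quot[OF R Q])
    fix a b assume ab: "a \<in> carrier (R Quot Q)" "b \<in> carrier (R Quot Q)"
      and 0: "\<And>s. s \<in> carrier (R Quot Q) \<Longrightarrow> a \<otimes>\<^bsub>R Quot Q\<^esub> s \<otimes>\<^bsub>R Quot Q\<^esub> b = \<zero>\<^bsub>R Quot Q\<^esub>"
    obtain x where x: "x \<in> carrier R" "a = Q +> x" using ab(1) by (auto simp: carrier_Quot)
    obtain y where y: "y \<in> carrier R" "b = Q +> y" using ab(2) by (auto simp: carrier_Quot)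
    have "x \<otimes> s \<otimes> y \<in> Q" if s: "s \<in> carrier R" for s
    proof -
      have "a \<otimes>\<^bsub>R Quot Q\<^esub> (Q +> s) \<otimes>\<^bsub>R Quot Q\<^esub> b = Q" using 0[of "Q +> s"] s by (simp add: carrier_Quot zero_Quot)
      then show ?thesis using x y s Quot_zero_iff by (simp add: mult_Quot)
    qed
    then have "x \<in> Q \<or> y \<in> Q" using prime x(1) y(1) by blast
    then show "a = \<zero>\<^bsub>R Quot Q\<^esub> \<or> b = \<zero>\<^bsub>R Quot Q\<^esub>" using x y Quot_zero_iff by (auto simp: zero_Quot)
  qed
  note Li = right_idealD[OF L]
  let ?L = "(\<lambda>l. Q +> l) ` L"
  have "right_ideal (R Quot Q) ?L"
    unfolding S.right_ideal_iff
  proof (intro conjI ballI)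
    show "?L \<subseteq> carrier (R Quot Q)" using Li(1) by (auto simp: carrier_Quot)
    have "Q +> \<zero> = Q" using Quot_zero_iff[OF zero_closed] additive_subgroup.zero_closed[OF is_additive_subgroup] by simp
    then show "\<zero>\<^bsub>R Quot Q\<^esub> \<in> ?L" using Li(2) by (intro image_eqI[of _ _ \<zero>]) (auto simp: zero_Quot)
    fix x assume "x \<in> ?L"
    then obtain a where a: "a \<in> L" "x = Q +> a" by blast
    show "x \<oplus>\<^bsub>R Quot Q\<^esub> y \<in> ?L" if y: "y \<in> ?L" for y
    proof -
      obtain b where b: "b \<in> L" "y = Q +> b" using y by blast
      then show ?thesis using a Li(1,3) by (simp add: add_Quot)
    qed
    show "x \<otimes>\<^bsub>R Quot Q\<^esub> y \<in> ?L" if y: "y \<in> carrier (R Quot Q)" for y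
    proof -
      obtain b where b: "b \<in> carrier R" "y = Q +> b" using y by (auto simp: carrier_Quot)
      then show ?thesis using a Li(1,4) by (simp add: mult_Quot)
    qed
  qed
  then have "\<exists>c\<in>?L. c \<in> regular_elements (R Quot Q)"
  proof (rule S.essential_right_ideal_regular_element)
    fix s assume s: "s \<in> carrier (R Quot Q)" "s \<noteq> \<zero>\<^bsub>R Quot Q\<^esub>"
    obtain x where x: "x \<in> carrier R" "s = Q +> x" using s(1) by (auto simp: carrier_Quot)
    then have "x \<notin> Q" using s(2) Quot_zero_iff by (simp add: zero_Quot)
    then obtain r where r: "r \<in> carrier R" "x \<otimes> r \<in> L" "x \<otimes> r \<notin> Q" using ess x(1) by blast
    then show "\<exists>r\<in>carrier (R Quot Q). s \<otimes>\<^bsub>R Quot Q\<^esub> r \<in> ?L \<and> s \<otimes>\<^bsub>R Quot Q\<^esub> r \<noteq> \<zero>\<^bsub>R Quot Q\<^esub>"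
      using x Quot_zero_iff by (intro bexI[of _ "Q +> r"]) (auto simp: mult_Quot zero_Quot carrier_Quot)
  qed
  then show ?thesis by blast
qed

section \<open>Affiliated series of length two\<close>

locale essential_affiliated_series = right_module R M for R (structure) and M (structure) +
  fixes U Q P
  assumes noetherian: "right_noetherian R"
    and series: "affiliated_series2 R M U Q P"
    and essential: "essential_submodule R M U"
begin

lemma ideal_Q: "ideal Q R" and ideal_P: "ideal P R"
  using series by (auto simp: affiliated_series2_def affiliated_submodule_def affiliated_prime_def)

lemma rsubmodule_U: "rsubmodule R M U"
  using essential by (simp add: essential_submodule_def)

lemmas U_props = rsubmoduleD[OF rsubmodule_U]

lemma mem_U_iff: "x \<in> U \<longleftrightarrow> x \<in> carrier M \<and> (\<forall>q\<in>Q. x \<cdot>\<^bsub>M\<^esub> q = \<zero>\<^bsub>M\<^esub>)"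
proof -
  have "U = ann_mod M Q" using series by (auto simp: affiliated_series2_def affiliated_submodule_def)
  then show ?thesis by (auto simp: ann_mod_def)
qed

lemma Q_carrier: "q \<in> Q \<Longrightarrow> q \<in> carrier R"
  using ideal.Icarr[OF ideal_Q] .

lemma P_carrier: "p \<in> P \<Longrightarrow> p \<in> carrier R"
  using ideal.Icarr[OF ideal_P] .

lemma nonzero_U: "\<exists>u\<in>U. u \<noteq> \<zero>\<^bsub>M\<^esub>"
  using series unfolding affiliated_series2_def by blast

lemma proper_U: "\<exists>m\<in>carrier M. m \<notin> U"
  using series unfolding affiliated_series2_def by blast

lemmas quot_props = quot_rmod_props[OF right_module_axioms rsubmodule_U]
lemmas quot_act = right_module_quot(2)[OF right_module_axioms rsubmodule_U]
lemmas quot_module = right_module_quot(1)[OF right_module_axioms rsubmodule_U]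

lemma act_P_in_U:
  assumes x: "x \<in> carrier M" and p: "p \<in> P" shows "x \<cdot>\<^bsub>M\<^esub> p \<in> U"
proof -
  have "carrier (quot_rmod M U) = ann_mod (quot_rmod M U) P"
    using series by (auto simp: affiliated_series2_def affiliated_submodule_def)
  then have "(U +>\<^bsub>M\<^esub> x) \<cdot>\<^bsub>quot_rmod M U\<^esub> p = U"
    using x p by (auto simp: quot_props(1,3) ann_mod_def)
  then show ?thesis using x p P_carrier quot_act quot_props(6) by simp
qed

text \<open>The submodule \<open>uR\<close> is annihilated by \<open>Q\<close>, and \<open>Q\<close> is maximal among the annihilators of nonzero
  submodules. The same holds for \<open>M/U\<close> and \<open>P\<close>.\<close>

lemma annihilator_in_U:
  assumes u: "u \<in> U" "u \<noteq> \<zero>\<^bsub>M\<^esub>" and r: "r \<in> carrier R"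
    and 0: "\<And>s. s \<in> carrier R \<Longrightarrow> u \<cdot>\<^bsub>M\<^esub> s \<cdot>\<^bsub>M\<^esub> r = \<zero>\<^bsub>M\<^esub>"
  shows "r \<in> Q"
proof -
  have uM: "u \<in> carrier M" using u U_props(1) by blast
  let ?V = "(\<lambda>s. u \<cdot>\<^bsub>M\<^esub> s) ` carrier R"
  have "u \<in> ?V" using uM by (intro image_eqI[of _ _ \<one>]) auto
  then have "nonzero_submodule R M ?V"
    using rsubmodule_cyclic[OF uM] u(2) unfolding nonzero_submodule_def by blast
  moreover have "Q \<subseteq> ann_ring R M ?V"
    using U_props(4)[OF u(1)] Q_carrier mem_U_iff by (auto simp: ann_ring_def)
  ultimately have "ann_ring R M ?V = Q"
    using series unfolding affiliated_series2_def affiliated_submodule_def affiliated_prime_def by blast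
  then show ?thesis using r 0 by (auto simp: ann_ring_def)
qed

lemma annihilator_mod_U:
  assumes x: "x \<in> carrier M" "x \<notin> U" and r: "r \<in> carrier R"
    and 0: "\<And>s. s \<in> carrier R \<Longrightarrow> x \<cdot>\<^bsub>M\<^esub> s \<cdot>\<^bsub>M\<^esub> r \<in> U"
  shows "r \<in> P"
proof -
  let ?M = "quot_rmod M U"
  interpret q: right_module R ?M by (rule quot_module)
  let ?V = "(\<lambda>s. (U +>\<^bsub>M\<^esub> x) \<cdot>\<^bsub>?M\<^esub> s) ` carrier R"
  have xq: "U +>\<^bsub>M\<^esub> x \<in> carrier ?M" using x by (simp add: quot_props(1))
  have "U +>\<^bsub>M\<^esub> x \<in> ?V" using xq by (intro image_eqI[of _ _ \<one>]) auto
  moreover have "U +>\<^bsub>M\<^esub> x \<noteq> \<zero>\<^bsub>?M\<^esub>" using x quot_props(6) by (simp add: quot_props(3))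
  ultimately have "nonzero_submodule R ?M ?V"
    using q.rsubmodule_cyclic[OF xq] unfolding nonzero_submodule_def by blast
  moreover have act: "(U +>\<^bsub>M\<^esub> x) \<cdot>\<^bsub>?M\<^esub> s \<cdot>\<^bsub>?M\<^esub> a = U +>\<^bsub>M\<^esub> (x \<cdot>\<^bsub>M\<^esub> s \<cdot>\<^bsub>M\<^esub> a)"
    if "s \<in> carrier R" "a \<in> carrier R" for s a using that x quot_act by simp
  have "P \<subseteq> ann_ring R ?M ?V"
  proof
    fix p assume p: "p \<in> P"
    then have pR: "p \<in> carrier R" by (rule P_carrier)
    have "(U +>\<^bsub>M\<^esub> x) \<cdot>\<^bsub>?M\<^esub> s \<cdot>\<^bsub>?M\<^esub> p = \<zero>\<^bsub>?M\<^esub>" if s: "s \<in> carrier R" for s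
      using act[OF s pR] act_P_in_U[OF _ p, of "x \<cdot>\<^bsub>M\<^esub> s"] x s pR quot_props(6) by (simp add: quot_props(3))
    then show "p \<in> ann_ring R ?M ?V" using pR by (auto simp: ann_ring_def)
  qed
  ultimately have "ann_ring R ?M ?V = P"
    using series unfolding affiliated_series2_def affiliated_submodule_def affiliated_prime_def by blast
  moreover have "(U +>\<^bsub>M\<^esub> x) \<cdot>\<^bsub>?M\<^esub> s \<cdot>\<^bsub>?M\<^esub> r = \<zero>\<^bsub>?M\<^esub>" if s: "s \<in> carrier R" for s
    using act[OF s r] 0[OF s] x s r quot_props(6) by (simp add: quot_props(3))
  then have "r \<in> ann_ring R ?M ?V" using r by (auto simp: ann_ring_def)
  ultimately show ?thesis by blast
qed

lemma prime_Q:
  assumes a: "a \<in> carrier R" and b: "b \<in> carrier R"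
    and ab: "\<And>s. s \<in> carrier R \<Longrightarrow> a \<otimes> s \<otimes> b \<in> Q"
  shows "a \<in> Q \<or> b \<in> Q"
proof (rule disjCI)
  assume bQ: "b \<notin> Q"
  obtain u where u: "u \<in> U" "u \<noteq> \<zero>\<^bsub>M\<^esub>" using nonzero_U by blast
  have "u \<cdot>\<^bsub>M\<^esub> s \<cdot>\<^bsub>M\<^esub> a = \<zero>\<^bsub>M\<^esub>" if s: "s \<in> carrier R" for s
  proof (rule ccontr)
    assume "u \<cdot>\<^bsub>M\<^esub> s \<cdot>\<^bsub>M\<^esub> a \<noteq> \<zero>\<^bsub>M\<^esub>"
    moreover have us: "u \<cdot>\<^bsub>M\<^esub> s \<in> U" using U_props(4) u(1) s by blast
    moreover have "u \<cdot>\<^bsub>M\<^esub> s \<cdot>\<^bsub>M\<^esub> a \<cdot>\<^bsub>M\<^esub> t \<cdot>\<^bsub>M\<^esub> b = \<zero>\<^bsub>M\<^esub>" if t: "t \<in> carrier R" for t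
    proof -
      have usM: "u \<cdot>\<^bsub>M\<^esub> s \<in> carrier M" using us U_props(1) by blast
      have "u \<cdot>\<^bsub>M\<^esub> s \<cdot>\<^bsub>M\<^esub> (a \<otimes> t \<otimes> b) = \<zero>\<^bsub>M\<^esub>" using us ab[OF t] mem_U_iff by blast
      then show ?thesis using usM a b t by (simp add: act_assoc)
    qed
    ultimately have "b \<in> Q" using annihilator_in_U U_props(4) a b by blast
    then show False using bQ by blast
  qed
  then show "a \<in> Q" using annihilator_in_U u a by blast
qed

lemma one_notin_P: "\<one> \<notin> P"
proof
  assume "\<one> \<in> P"
  obtain m where m: "m \<in> carrier M" "m \<notin> U" using proper_U by blast
  then show False using act_P_in_U[OF m(1) \<open>\<one> \<in> P\<close>] by simp
qed

text \<open>The singular submodule of \<open>U\<close> over \<open>R/Q\<close> is contained in the torsion submodule, by Goldie's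
  theorem.\<close>

lemma torsionfree_nonsingular:
  assumes tf: "torsionfree (R Quot Q) (over_quot Q (sub_rmod M U))" and u: "u \<in> U"
    and ess: "\<And>s. s \<in> carrier R \<Longrightarrow> s \<notin> Q \<Longrightarrow> \<exists>r\<in>carrier R. u \<cdot>\<^bsub>M\<^esub> (s \<otimes> r) = \<zero>\<^bsub>M\<^esub> \<and> s \<otimes> r \<notin> Q"
  shows "u = \<zero>\<^bsub>M\<^esub>"
proof -
  interpret Q: ideal Q R by (rule ideal_Q)
  have uM: "u \<in> carrier M" using u U_props(1) by blast
  let ?L = "{r \<in> carrier R. u \<cdot>\<^bsub>M\<^esub> r \<in> {\<zero>\<^bsub>M\<^esub>}}"
  have L: "right_ideal R ?L" by (rule right_ideal_preimage[OF rsubmodule_zero uM])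
  have "\<exists>c\<in>?L. Q +> c \<in> regular_elements (R Quot Q)"
  proof (rule regular_mod_in_essential[OF noetherian ideal_Q _ L])
    show "\<exists>r\<in>carrier R. s \<otimes> r \<in> ?L \<and> s \<otimes> r \<notin> Q" if "s \<in> carrier R" "s \<notin> Q" for s
      using ess[OF that] that(1) by auto
  qed (rule prime_Q)
  then obtain c where c: "c \<in> carrier R" "u \<cdot>\<^bsub>M\<^esub> c = \<zero>\<^bsub>M\<^esub>" "Q +> c \<in> regular_elements (R Quot Q)" by blast
  have "u \<cdot>\<^bsub>over_quot Q (sub_rmod M U)\<^esub> (Q +> c) = u \<cdot>\<^bsub>sub_rmod M U\<^esub> c"
    by (rule Q.act_over_quot[OF right_module_sub_rmod[OF right_module_axioms rsubmodule_U]])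
      (use u c mem_U_iff in \<open>auto simp: sub_rmod_def\<close>)
  then have "u \<in> torsion_elements (R Quot Q) (over_quot Q (sub_rmod M U))"
    using u c by (auto simp: torsion_elements_def over_quot_def sub_rmod_def)
  then show ?thesis using tf by (simp add: torsionfree_def over_quot_def sub_rmod_def)
qed

text \<open>Let \<open>xc \<in> U\<close> with \<open>c\<close> regular modulo \<open>P\<close>, and let \<open>A\<close> be the annihilator of \<open>M\<close>. Consider the
  right ideals \<open>N \<subseteq> P\<close> that contain \<open>A\<close> and some \<open>K(P \<inter> Q)\<close>, with \<open>K\<close> essential modulo \<open>P\<close>. Choose one in
  which the smaller ones are essential modulo \<open>A\<close>. For all \<open>r\<close>, the right ideal \<open>{k. xrk \<in> U}\<close> is essential
  modulo \<open>P\<close>, so \<open>{n \<in> N. xrn = 0}\<close> is such a right ideal. Hence \<open>xrN\<close> is a singular submodule of \<open>U\<close>,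
  so \<open>xrN = 0\<close> and \<open>xrK(P \<inter> Q) = 0\<close>. It follows that \<open>xrK \<subseteq> U\<close> for all \<open>r\<close>. As \<open>K\<close> is not contained in
  \<open>P\<close>, this puts \<open>x\<close> into \<open>U\<close>.\<close>

lemma torsion_mod_U:
  assumes detect: "\<And>y. y \<in> carrier M \<Longrightarrow> (\<And>z. z \<in> P \<Longrightarrow> z \<in> Q \<Longrightarrow> y \<cdot>\<^bsub>M\<^esub> z = \<zero>\<^bsub>M\<^esub>) \<Longrightarrow> y \<in> U"
    and tf: "torsionfree (R Quot Q) (over_quot Q (sub_rmod M U))"
    and x: "x \<in> carrier M" and c: "c \<in> carrier R" and reg: "P +> c \<in> regular_elements (R Quot P)"
    and xc: "x \<cdot>\<^bsub>M\<^esub> c \<in> U"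
  shows "x \<in> U"
proof (rule ccontr)
  assume xU: "x \<notin> U"
  interpret Q: ideal Q R by (rule ideal_Q)
  interpret P: ideal P R by (rule ideal_P)
  define large where "large K \<longleftrightarrow>
    (\<forall>s\<in>carrier R. s \<notin> P \<longrightarrow> (\<exists>r\<in>carrier R. s \<otimes> r \<in> K \<and> s \<otimes> r \<notin> P))" for K
  define A where "A = {a \<in> carrier R. \<forall>y\<in>carrier M. y \<cdot>\<^bsub>M\<^esub> a = \<zero>\<^bsub>M\<^esub>}"
  have A: "right_ideal R A"
    unfolding R.right_ideal_iff A_def by (auto simp: act_r_distr act_assoc)
  have AP: "A \<subseteq> P"
    using annihilator_mod_U[OF x xU] x U_props(2) by (auto simp: A_def)
  have PQA: "p \<otimes> q \<in> A" if "p \<in> P" "q \<in> Q" for p q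
    using that act_P_in_U P_carrier Q_carrier mem_U_iff by (auto simp: A_def act_assoc)
  define K where "K r = {k \<in> carrier R. x \<cdot>\<^bsub>M\<^esub> r \<cdot>\<^bsub>M\<^esub> k \<in> U}" for r
  have rK: "right_ideal R (K r)" if "r \<in> carrier R" for r
    unfolding K_def by (rule right_ideal_preimage[OF rsubmodule_U]) (use x that in simp)
  have K_large: "large (K r)" if r: "r \<in> carrier R" for r
    unfolding large_def
  proof (intro ballI impI)
    fix s assume s: "s \<in> carrier R" "s \<notin> P"
    show "\<exists>t\<in>carrier R. s \<otimes> t \<in> K r \<and> s \<otimes> t \<notin> P"
    proof (cases "r \<otimes> s \<in> P")
      case True
      then have "x \<cdot>\<^bsub>M\<^esub> (r \<otimes> s) \<in> U" using act_P_in_U x by blast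
      then have "s \<otimes> \<one> \<in> K r" using x r s(1) by (simp add: K_def act_assoc)
      then show ?thesis using s by (intro bexI[of _ \<one>]) auto
    next
      case False
      then obtain a t p where a: "a \<in> carrier R" "t \<in> carrier R" "p \<in> P"
        "r \<otimes> s \<otimes> a = p \<oplus> c \<otimes> t" "r \<otimes> s \<otimes> a \<notin> P"
        using essential_mod_regular[OF noetherian ideal_P c reg, of "r \<otimes> s"] r s(1) by auto
      have "x \<cdot>\<^bsub>M\<^esub> (r \<otimes> s \<otimes> a) = x \<cdot>\<^bsub>M\<^esub> p \<oplus>\<^bsub>M\<^esub> x \<cdot>\<^bsub>M\<^esub> c \<cdot>\<^bsub>M\<^esub> t"
        unfolding a(4) using x c a(2,3) P_carrier by (simp add: act_r_distr act_assoc)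
      then have "x \<cdot>\<^bsub>M\<^esub> (r \<otimes> s \<otimes> a) \<in> U" using act_P_in_U[OF x a(3)] U_props(3,4) xc a(2) by simp
      then have "s \<otimes> a \<in> K r" using x r s(1) a(1) by (simp add: K_def act_assoc)
      moreover have "s \<otimes> a \<notin> P" using a(1,5) r s(1) P.I_l_closed by (auto simp: R.m_assoc)
      ultimately show ?thesis using a(1) by blast
    qed
  qed
  define \<N> where "\<N> = {N. right_ideal R N \<and> A \<subseteq> N \<and> N \<subseteq> P \<and>
    (\<exists>K. right_ideal R K \<and> large K \<and> (\<forall>k\<in>K. \<forall>z\<in>P \<inter> Q. k \<otimes> z \<in> N))}"
  have "P \<in> \<N>"
    unfolding \<N>_def
  proof (intro CollectI conjI AP P.right_ideal exI[of _ "carrier R"] ballI)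
    show "right_ideal R (carrier R)" by (auto simp: R.right_ideal_iff)
    show "large (carrier R)" unfolding large_def by (auto intro: bexI[of _ \<one>])
    show "k \<otimes> z \<in> P" if "k \<in> carrier R" "z \<in> P \<inter> Q" for k z using that P.I_l_closed by blast
  qed simp
  then have "\<N> \<noteq> {}" by blast
  then obtain N where N: "N \<in> \<N>"
    and ess: "\<And>N' a. N' \<in> \<N> \<Longrightarrow> N' \<subseteq> N \<Longrightarrow> a \<in> N \<Longrightarrow> a \<notin> A \<Longrightarrow>
      \<exists>r\<in>carrier R. a \<otimes> r \<in> N' \<and> a \<otimes> r \<notin> A"
    by (rule right_noetherian_essential_member[OF noetherian A]) (auto simp: \<N>_def)
  then obtain K0 where K0: "right_ideal R K0" "large K0" and K0N: "\<And>k z. k \<in> K0 \<Longrightarrow> z \<in> P \<inter> Q \<Longrightarrow> k \<otimes> z \<in> N"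
    and rN: "right_ideal R N" and AN: "A \<subseteq> N" and NP: "N \<subseteq> P"
    by (auto simp: \<N>_def)
  note Ni = R.right_idealD[OF rN] and K0i = R.right_idealD[OF K0(1)]
  have xrN: "x \<cdot>\<^bsub>M\<^esub> r \<cdot>\<^bsub>M\<^esub> n = \<zero>\<^bsub>M\<^esub>" if r: "r \<in> carrier R" and n: "n \<in> N" for r n
  proof (rule torsionfree_nonsingular[OF tf])
    have xr: "x \<cdot>\<^bsub>M\<^esub> r \<in> carrier M" using x r by simp
    note Kri = R.right_idealD[OF rK[OF r]]
    show "x \<cdot>\<^bsub>M\<^esub> r \<cdot>\<^bsub>M\<^esub> n \<in> U" using act_P_in_U xr n NP by blast
    define N' where "N' = {n \<in> N. x \<cdot>\<^bsub>M\<^esub> r \<cdot>\<^bsub>M\<^esub> n = \<zero>\<^bsub>M\<^esub>}"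
    have N'_eq: "N' = N \<inter> {n \<in> carrier R. x \<cdot>\<^bsub>M\<^esub> r \<cdot>\<^bsub>M\<^esub> n \<in> {\<zero>\<^bsub>M\<^esub>}}"
      using Ni(1) by (auto simp: N'_def)
    have "N' \<in> \<N>"
      unfolding \<N>_def
    proof (intro CollectI conjI exI[of _ "K0 \<inter> K r"] ballI)
      show "right_ideal R N'"
        unfolding N'_eq by (rule R.right_ideal_Int[OF rN right_ideal_preimage[OF rsubmodule_zero xr]])
      show "A \<subseteq> N'" using AN xr by (auto simp: N'_def A_def)
      show "N' \<subseteq> P" using NP by (auto simp: N'_def)
      show "right_ideal R (K0 \<inter> K r)" by (rule R.right_ideal_Int[OF K0(1) rK[OF r]])
      show "large (K0 \<inter> K r)"
        unfolding large_def
      proof (intro ballI impI)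
        fix s assume s: "s \<in> carrier R" "s \<notin> P"
        obtain a where a: "a \<in> carrier R" "s \<otimes> a \<in> K0" "s \<otimes> a \<notin> P" using K0(2) s unfolding large_def by blast
        then obtain b where b: "b \<in> carrier R" "s \<otimes> a \<otimes> b \<in> K r" "s \<otimes> a \<otimes> b \<notin> P"
          using K_large[OF r] s(1) unfolding large_def by (metis R.m_closed)
        then show "\<exists>t\<in>carrier R. s \<otimes> t \<in> K0 \<inter> K r \<and> s \<otimes> t \<notin> P"
          using K0i(4)[OF a(2) b(1)] a(1) s(1) by (intro bexI[of _ "a \<otimes> b"]) (auto simp: R.m_assoc)
      qed
      fix k z assume k: "k \<in> K0 \<inter> K r" and z: "z \<in> P \<inter> Q"
      have kz: "k \<in> carrier R" "z \<in> carrier R" using k z K0i(1) Q_carrier by auto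
      have "x \<cdot>\<^bsub>M\<^esub> r \<cdot>\<^bsub>M\<^esub> k \<in> U" using k by (simp add: K_def)
      then have "x \<cdot>\<^bsub>M\<^esub> r \<cdot>\<^bsub>M\<^esub> k \<cdot>\<^bsub>M\<^esub> z = \<zero>\<^bsub>M\<^esub>" using z mem_U_iff by blast
      then show "k \<otimes> z \<in> N'" using K0N k z kz xr by (simp add: N'_def act_assoc[of "x \<cdot>\<^bsub>M\<^esub> r"])
    qed
    moreover have "N' \<subseteq> N" by (auto simp: N'_def)
    ultimately have e: "\<exists>t\<in>carrier R. a \<otimes> t \<in> N' \<and> a \<otimes> t \<notin> A" if "a \<in> N" "a \<notin> A" for a
      using ess that by blast
    fix s assume s: "s \<in> carrier R" "s \<notin> Q"
    have nR: "n \<in> carrier R" using n Ni(1) by blast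
    show "\<exists>t\<in>carrier R. x \<cdot>\<^bsub>M\<^esub> r \<cdot>\<^bsub>M\<^esub> n \<cdot>\<^bsub>M\<^esub> (s \<otimes> t) = \<zero>\<^bsub>M\<^esub> \<and> s \<otimes> t \<notin> Q"
    proof (cases "n \<otimes> s \<in> A")
      case True
      then have "x \<cdot>\<^bsub>M\<^esub> r \<cdot>\<^bsub>M\<^esub> (n \<otimes> s) = \<zero>\<^bsub>M\<^esub>" using xr by (simp add: A_def)
      then show ?thesis using s xr nR by (intro bexI[of _ \<one>]) (auto simp: act_assoc)
    next
      case False
      then obtain t where t: "t \<in> carrier R" "n \<otimes> s \<otimes> t \<in> N'" "n \<otimes> s \<otimes> t \<notin> A"
        using e Ni(4)[OF n s(1)] by blast
      have ns: "n \<otimes> s \<otimes> t = n \<otimes> (s \<otimes> t)" using nR s(1) t(1) by (simp add: R.m_assoc)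
      have "x \<cdot>\<^bsub>M\<^esub> r \<cdot>\<^bsub>M\<^esub> (n \<otimes> (s \<otimes> t)) = \<zero>\<^bsub>M\<^esub>" using t(2) unfolding ns by (simp add: N'_def)
      then have "x \<cdot>\<^bsub>M\<^esub> r \<cdot>\<^bsub>M\<^esub> n \<cdot>\<^bsub>M\<^esub> (s \<otimes> t) = \<zero>\<^bsub>M\<^esub>"
        using act_assoc[OF xr nR, of "s \<otimes> t"] s(1) t(1) by simp
      moreover have "s \<otimes> t \<notin> Q" using t(3) PQA n NP unfolding ns by blast
      ultimately show ?thesis using t(1) by blast
    qed
  qed
  have "k \<in> P" if k: "k \<in> K0" for k
  proof (rule annihilator_mod_U[OF x xU])
    show kR: "k \<in> carrier R" using K0i(1) k .
    fix r assume r: "r \<in> carrier R"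
    show "x \<cdot>\<^bsub>M\<^esub> r \<cdot>\<^bsub>M\<^esub> k \<in> U"
    proof (rule detect)
      show "x \<cdot>\<^bsub>M\<^esub> r \<cdot>\<^bsub>M\<^esub> k \<in> carrier M" using x r kR by simp
      fix z assume z: "z \<in> P" "z \<in> Q"
      then have "x \<cdot>\<^bsub>M\<^esub> r \<cdot>\<^bsub>M\<^esub> (k \<otimes> z) = \<zero>\<^bsub>M\<^esub>" using xrN[OF r] K0N[OF k] by blast
      then show "x \<cdot>\<^bsub>M\<^esub> r \<cdot>\<^bsub>M\<^esub> k \<cdot>\<^bsub>M\<^esub> z = \<zero>\<^bsub>M\<^esub>" using act_assoc[of "x \<cdot>\<^bsub>M\<^esub> r" k z] x r kR Q_carrier[OF z(2)] by simp
    qed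
  qed
  moreover obtain t where "t \<in> carrier R" "\<one> \<otimes> t \<in> K0" "\<one> \<otimes> t \<notin> P"
    using K0(2) one_notin_P unfolding large_def by blast
  ultimately show False by blast
qed

lemma over_quot_act:
  assumes x: "x \<in> carrier M" and c: "c \<in> carrier R"
  shows "(U +>\<^bsub>M\<^esub> x) \<cdot>\<^bsub>over_quot P (quot_rmod M U)\<^esub> (P +> c) = U +>\<^bsub>M\<^esub> (x \<cdot>\<^bsub>M\<^esub> c)"
proof -
  interpret P: ideal P R by (rule ideal_P)
  have "(U +>\<^bsub>M\<^esub> x) \<cdot>\<^bsub>over_quot P (quot_rmod M U)\<^esub> (P +> c) = (U +>\<^bsub>M\<^esub> x) \<cdot>\<^bsub>quot_rmod M U\<^esub> c"
  proof (rule P.act_over_quot[OF quot_module])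
    fix a assume a: "a \<in> P"
    then show "(U +>\<^bsub>M\<^esub> x) \<cdot>\<^bsub>quot_rmod M U\<^esub> a = \<zero>\<^bsub>quot_rmod M U\<^esub>"
      using act_P_in_U[OF x a] x P_carrier[OF a] quot_props(6) by (simp add: quot_act quot_props(3))
  qed (use x c in \<open>auto simp: quot_props(1)\<close>)
  then show ?thesis using x c by (simp add: quot_act)
qed

lemma torsionfree_quotient:
  assumes detect: "\<And>y. y \<in> carrier M \<Longrightarrow> (\<And>z. z \<in> P \<Longrightarrow> z \<in> Q \<Longrightarrow> y \<cdot>\<^bsub>M\<^esub> z = \<zero>\<^bsub>M\<^esub>) \<Longrightarrow> y \<in> U"
    and tf: "torsionfree (R Quot Q) (over_quot Q (sub_rmod M U))"
  shows "torsionfree (R Quot P) (over_quot P (quot_rmod M U))"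
proof -
  interpret P: ideal P R by (rule ideal_P)
  interpret S: ring "R Quot P" by (rule P.quotient_is_ring)
  interpret q: right_module R "quot_rmod M U" by (rule quot_module)
  let ?O = "over_quot P (quot_rmod M U)"
  have O: "carrier ?O = carrier (quot_rmod M U)" "\<zero>\<^bsub>?O\<^esub> = U" by (simp_all add: over_quot_def quot_props(3))
  note act = over_quot_act
  have U0: "U +>\<^bsub>M\<^esub> \<zero>\<^bsub>M\<^esub> = U" using quot_props(6) U_props(2) by simp
  have "torsion_elements (R Quot P) ?O \<subseteq> {U}"
  proof
    fix Y assume "Y \<in> torsion_elements (R Quot P) ?O"
    then obtain C where Y: "Y \<in> carrier (quot_rmod M U)" and C: "C \<in> regular_elements (R Quot P)"
      and YC: "Y \<cdot>\<^bsub>?O\<^esub> C = U" by (auto simp: torsion_elements_def O)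
    obtain x where x: "x \<in> carrier M" "Y = U +>\<^bsub>M\<^esub> x" using Y by (auto simp: quot_props(1))
    obtain c where c: "c \<in> carrier R" "C = P +> c"
      using C by (auto simp: regular_elements_def P.carrier_Quot)
    have "x \<cdot>\<^bsub>M\<^esub> c \<in> U" using YC act[OF x(1) c(1)] quot_props(6) x c by simp
    then have "x \<in> U" using torsion_mod_U[OF detect tf x(1) c(1)] C c(2) by blast
    then show "Y \<in> {U}" using quot_props(6) x by simp
  qed
  moreover have "U \<in> torsion_elements (R Quot P) ?O"
  proof -
    have "\<one>\<^bsub>R Quot P\<^esub> \<in> regular_elements (R Quot P)" by (auto simp: regular_elements_def)
    moreover have "U \<cdot>\<^bsub>?O\<^esub> \<one>\<^bsub>R Quot P\<^esub> = U" using act[of "\<zero>\<^bsub>M\<^esub>" \<one>] by (simp add: P.one_Quot U0)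
    moreover have "U \<in> carrier (quot_rmod M U)" using q.M.zero_closed by (simp add: quot_props(3))
    ultimately show ?thesis by (auto simp: torsion_elements_def O)
  qed
  ultimately show ?thesis by (auto simp: torsionfree_def O)
qed

end

section \<open>The injective hull and its annihilator submodules\<close>

locale affiliated_series_hull = essential_affiliated_series R M U Q P
  for R :: "'r ring" (structure) and M :: "('r, 'm) rmod" (structure) and U Q P +
  fixes E :: "('r, 'e) rmod" and j :: "'m \<Rightarrow> 'e" and J :: "'e set \<Rightarrow> ('r, 'e, 'i) coresolution"
  assumes hull: "injective_hull R M E j"
    and resolution: "\<And>N. rsubmodule R E N \<Longrightarrow> injective_resolution R (sub_rmod E N) (J N)"
begin

lemma injective_E: "injective_rmod R E" and j_hom: "j \<in> rhom R M E" and j_inj: "inj_on j (carrier M)"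
  using hull by (auto simp: injective_hull_def rembedding_def)

lemma module_E: "right_module R E"
  using injective_E by (simp add: injective_rmod_def)

sublocale E: right_module R E
  by (rule module_E)

lemmas j_props = rhom_props[OF right_module_axioms module_E j_hom]

lemma j_zero_iff: "x \<in> carrier M \<Longrightarrow> j x = \<zero>\<^bsub>E\<^esub> \<longleftrightarrow> x = \<zero>\<^bsub>M\<^esub>"
  using inj_onD[OF j_inj, of x "\<zero>\<^bsub>M\<^esub>"] j_props(4) by auto

lemma U_essential_in_E:
  assumes x: "x \<in> carrier E" "x \<noteq> \<zero>\<^bsub>E\<^esub>"
  shows "\<exists>r\<in>carrier R. \<exists>u\<in>U. x \<cdot>\<^bsub>E\<^esub> r = j u \<and> u \<noteq> \<zero>\<^bsub>M\<^esub>"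
proof -
  have "essential_submodule R E (j ` carrier M)" using hull by (simp add: injective_hull_def)
  then obtain r where r: "r \<in> carrier R" "x \<cdot>\<^bsub>E\<^esub> r \<in> j ` carrier M" "x \<cdot>\<^bsub>E\<^esub> r \<noteq> \<zero>\<^bsub>E\<^esub>"
    using x unfolding E.essential_submodule_iff by blast
  then obtain m where m: "m \<in> carrier M" "x \<cdot>\<^bsub>E\<^esub> r = j m" by blast
  have "m \<noteq> \<zero>\<^bsub>M\<^esub>" using m r(3) j_zero_iff by auto
  then obtain s where s: "s \<in> carrier R" "m \<cdot>\<^bsub>M\<^esub> s \<in> U" "m \<cdot>\<^bsub>M\<^esub> s \<noteq> \<zero>\<^bsub>M\<^esub>"
    using essential m(1) unfolding essential_submodule_iff by blast
  have "x \<cdot>\<^bsub>E\<^esub> (r \<otimes> s) = j (m \<cdot>\<^bsub>M\<^esub> s)" using x r(1) s(1) m j_props(3) by (simp add: E.act_assoc)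
  then show ?thesis using s r(1) by blast
qed

text \<open>As \<open>xR\<close> meets \<open>U\<close>, its annihilator lies in that of a nonzero submodule of \<open>U\<close>.\<close>

lemma annihilator_in_E:
  assumes x: "x \<in> carrier E" "x \<noteq> \<zero>\<^bsub>E\<^esub>" and r: "r \<in> carrier R"
    and 0: "\<And>s. s \<in> carrier R \<Longrightarrow> x \<cdot>\<^bsub>E\<^esub> s \<cdot>\<^bsub>E\<^esub> r = \<zero>\<^bsub>E\<^esub>"
  shows "r \<in> Q"
proof -
  obtain a u where a: "a \<in> carrier R" "u \<in> U" "x \<cdot>\<^bsub>E\<^esub> a = j u" "u \<noteq> \<zero>\<^bsub>M\<^esub>"
    using U_essential_in_E[OF x] by blast
  have uM: "u \<in> carrier M" using a U_props(1) by blast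
  show ?thesis
  proof (rule annihilator_in_U[OF a(2,4) r])
    fix s assume s: "s \<in> carrier R"
    have "j (u \<cdot>\<^bsub>M\<^esub> s \<cdot>\<^bsub>M\<^esub> r) = x \<cdot>\<^bsub>E\<^esub> (a \<otimes> s) \<cdot>\<^bsub>E\<^esub> r"
      using x a(1) s r uM by (simp add: j_props(3) a(3)[symmetric] E.act_assoc)
    also have "\<dots> = \<zero>\<^bsub>E\<^esub>" using 0 a(1) s by simp
    finally show "u \<cdot>\<^bsub>M\<^esub> s \<cdot>\<^bsub>M\<^esub> r = \<zero>\<^bsub>M\<^esub>" using j_zero_iff uM s r by simp
  qed
qed

abbreviation ann :: "'e set \<Rightarrow> 'e set" where
  "ann V \<equiv> ann_mod (sub_rmod E V) Q"

lemma ann_iff: "x \<in> ann V \<longleftrightarrow> x \<in> V \<and> (\<forall>q\<in>Q. x \<cdot>\<^bsub>E\<^esub> q = \<zero>\<^bsub>E\<^esub>)"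
  by (auto simp: ann_mod_def sub_rmod_def)

lemma sub_E: "sub_rmod E (carrier E) = E"
  by (simp add: sub_rmod_def)

lemma rsubmodule_ann:
  assumes V: "rsubmodule R E V" shows "rsubmodule R E (ann V)"
proof -
  have "ann V = V \<inter> {x \<in> carrier E. \<forall>q\<in>Q. x \<cdot>\<^bsub>E\<^esub> q \<in> {\<zero>\<^bsub>E\<^esub>}}"
    using E.rsubmoduleD(1)[OF V] by (auto simp: ann_iff)
  then show ?thesis using E.rsubmodule_Int[OF V E.rsubmodule_residual[OF ideal_Q E.rsubmodule_zero]] by simp
qed

lemma ann_essential:
  assumes V: "rsubmodule R E V" shows "essential_submodule R (sub_rmod E V) (ann V)"
proof -
  note Vi = E.rsubmoduleD[OF V]
  interpret V: right_module R "sub_rmod E V" by (rule right_module_sub_rmod[OF module_E V])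
  have s: "carrier (sub_rmod E V) = V" "\<zero>\<^bsub>sub_rmod E V\<^esub> = \<zero>\<^bsub>E\<^esub>" "x \<cdot>\<^bsub>sub_rmod E V\<^esub> r = x \<cdot>\<^bsub>E\<^esub> r" for x r
    by (simp_all add: sub_rmod_def)
  show ?thesis
    unfolding V.essential_submodule_iff s rsubmodule_sub_rmod_iff[OF module_E V]
  proof (intro conjI rsubmodule_ann[OF V] ballI impI)
    show "ann V \<subseteq> V" by (auto simp: ann_iff)
    fix x assume x: "x \<in> V" "x \<noteq> \<zero>\<^bsub>E\<^esub>"
    then obtain r u where r: "r \<in> carrier R" "u \<in> U" "x \<cdot>\<^bsub>E\<^esub> r = j u" "u \<noteq> \<zero>\<^bsub>M\<^esub>"
      using U_essential_in_E Vi(1) by blast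
    have uM: "u \<in> carrier M" using r(2) U_props(1) by blast
    have "j u \<cdot>\<^bsub>E\<^esub> q = \<zero>\<^bsub>E\<^esub>" if q: "q \<in> Q" for q
      using j_props(3)[OF uM Q_carrier[OF q]] r(2) q mem_U_iff j_props(4) by simp
    then have "x \<cdot>\<^bsub>E\<^esub> r \<in> ann V" using Vi(4)[OF x(1) r(1)] r(3) by (simp add: ann_iff)
    moreover have "x \<cdot>\<^bsub>E\<^esub> r \<noteq> \<zero>\<^bsub>E\<^esub>" using r uM j_zero_iff by simp
    ultimately show "\<exists>r\<in>carrier R. x \<cdot>\<^bsub>E\<^esub> r \<in> ann V \<and> x \<cdot>\<^bsub>E\<^esub> r \<noteq> \<zero>\<^bsub>E\<^esub>" using r(1) by blast
  qed
qed

lemma j_act_zero_iff: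
  "x \<in> carrier M \<Longrightarrow> r \<in> carrier R \<Longrightarrow> j x \<cdot>\<^bsub>E\<^esub> r = \<zero>\<^bsub>E\<^esub> \<longleftrightarrow> x \<cdot>\<^bsub>M\<^esub> r = \<zero>\<^bsub>M\<^esub>"
  by (simp add: j_props(3)[symmetric] j_zero_iff)

lemma j_ann_iff: "x \<in> carrier M \<Longrightarrow> (\<forall>q\<in>Q. j x \<cdot>\<^bsub>E\<^esub> q = \<zero>\<^bsub>E\<^esub>) \<longleftrightarrow> x \<in> U"
  using j_act_zero_iff Q_carrier by (simp add: mem_U_iff)

lemma aug_extends:
  assumes V: "rsubmodule R E V"
  shows "\<exists>h. h \<in> rhom R (sub_rmod E V) (obj (J (ann V)) 0) \<and> (\<forall>x\<in>ann V. h x = aug (J (ann V)) x)"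
proof -
  let ?J = "J (ann V)"
  have A: "rsubmodule R E (ann V)" by (rule rsubmodule_ann[OF V])
  have "injective_rmod R (obj ?J 0)" "aug ?J \<in> rhom R (sub_rmod E (ann V)) (obj ?J 0)"
    using resolution[OF A] by (auto simp: injective_resolution_def rembedding_def)
  moreover have "rembedding R (sub_rmod E (ann V)) (sub_rmod E V) (\<lambda>x. x)"
    by (auto simp: rembedding_def rhom_def sub_rmod_def ann_mod_def)
  ultimately have "\<exists>h\<in>rhom R (sub_rmod E V) (obj ?J 0). \<forall>x\<in>carrier (sub_rmod E (ann V)). h x = aug ?J x"
    using injective_rmod_extend right_module_sub_rmod[OF module_E] A V by blast
  then show ?thesis by (auto simp: sub_rmod_def)
qed

lemma extension_classes_ann:
  assumes V: "rsubmodule R E V"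
    and h: "h \<in> rhom R (sub_rmod E V) (obj (J (ann V)) 0)" "\<And>x. x \<in> ann V \<Longrightarrow> h x = aug (J (ann V)) x"
  shows "extension_classes P R (sub_rmod E V) (ann V) (J (ann V)) h"
proof (intro extension_classes.intro extension_classes_axioms.intro ideal_P h
    right_module_sub_rmod[OF module_E V])
  have A: "rsubmodule R E (ann V)" by (rule rsubmodule_ann[OF V])
  show "rsubmodule R (sub_rmod E V) (ann V)"
    unfolding rsubmodule_sub_rmod_iff[OF module_E V] using A by (auto simp: ann_iff)
  have "sub_rmod (sub_rmod E V) (ann V) = sub_rmod E (ann V)" by (simp add: sub_rmod_def)
  then show "injective_resolution R (sub_rmod (sub_rmod E V) (ann V)) (J (ann V))"
    using resolution[OF A] by simp
qed

text \<open>An element of \<open>V\<close> with trivial class is annihilated by \<open>P\<close> up to an element of \<open>ann V\<close>. If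
  \<open>P \<subseteq> Q\<close>, then \<open>P\<close> also annihilates \<open>ann V\<close>. Otherwise \<open>P\<close> annihilates no nonzero element of \<open>E\<close>.\<close>

lemma trivial_class:
  assumes V: "rsubmodule R E V"
    and h: "h \<in> rhom R (sub_rmod E V) (obj (J (ann V)) 0)" "\<And>x. x \<in> ann V \<Longrightarrow> h x = aug (J (ann V)) x"
    and y: "y \<in> extension_classes.annihilated_mod P (sub_rmod E V) (ann V)"
    and 0: "extension_classes.ext_class P R (sub_rmod E V) (J (ann V)) h y = \<zero>\<^bsub>Ext_quot R P (J (ann V)) 1\<^esub>"
    and t: "t \<in> (if P \<subseteq> Q then P else Q)"
  shows "y \<cdot>\<^bsub>E\<^esub> t = \<zero>\<^bsub>E\<^esub>"
proof -
  interpret P: ideal P R by (rule ideal_P)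
  interpret x: extension_classes P R "sub_rmod E V" "ann V" "J (ann V)" h
    by (rule extension_classes_ann[OF V h])
  note Vi = E.rsubmoduleD[OF V]
  have yV: "y \<in> V" using y by (simp add: x.annihilated_mod_def) (simp add: sub_rmod_def)
  obtain n where n: "n \<in> ann V"
    and ynP: "\<And>p. p \<in> P \<Longrightarrow> (y \<ominus>\<^bsub>sub_rmod E V\<^esub> n) \<cdot>\<^bsub>sub_rmod E V\<^esub> p = \<zero>\<^bsub>sub_rmod E V\<^esub>"
    using x.ext_class_zero[OF y 0 ann_essential[OF V]] by blast
  have nV: "n \<in> V" using n by (simp add: ann_iff)
  have yn: "y \<in> carrier E" "n \<in> carrier E" using yV nV Vi(1) by auto
  have "y \<ominus>\<^bsub>sub_rmod E V\<^esub> n = y \<ominus>\<^bsub>E\<^esub> n"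
  proof -
    have "(\<lambda>x. x) \<in> rhom R (sub_rmod E V) E" using Vi(1) by (auto simp: rhom_def sub_rmod_def)
    from rhom_minus[OF x.right_module_axioms module_E this] show ?thesis
      using yV nV by (simp add: sub_rmod_def)
  qed
  then have ynP: "(y \<ominus>\<^bsub>E\<^esub> n) \<cdot>\<^bsub>E\<^esub> p = \<zero>\<^bsub>E\<^esub>" if "p \<in> P" for p
    using ynP[OF that] by (simp add: sub_rmod_def)
  show ?thesis
  proof (cases "P \<subseteq> Q")
    case True
    then have tP: "t \<in> P" "t \<in> Q" "t \<in> carrier R" using t P_carrier by auto
    have "y = (y \<ominus>\<^bsub>E\<^esub> n) \<oplus>\<^bsub>E\<^esub> n" using yn by (simp add: a_minus_def E.M.a_assoc E.M.l_neg)
    then have "y \<cdot>\<^bsub>E\<^esub> t = (y \<ominus>\<^bsub>E\<^esub> n) \<cdot>\<^bsub>E\<^esub> t \<oplus>\<^bsub>E\<^esub> n \<cdot>\<^bsub>E\<^esub> t"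
      using E.act_l_distr[of "y \<ominus>\<^bsub>E\<^esub> n" n t] yn tP by simp
    then show ?thesis using ynP[OF tP(1)] n tP(2) by (simp add: ann_iff)
  next
    case False
    then obtain p where p: "p \<in> P" "p \<notin> Q" by blast
    have "y \<ominus>\<^bsub>E\<^esub> n = \<zero>\<^bsub>E\<^esub>"
    proof (rule ccontr)
      assume "y \<ominus>\<^bsub>E\<^esub> n \<noteq> \<zero>\<^bsub>E\<^esub>"
      then have "p \<in> Q"
      proof (rule annihilator_in_E[rotated])
        fix s assume s: "s \<in> carrier R"
        have "(y \<ominus>\<^bsub>E\<^esub> n) \<cdot>\<^bsub>E\<^esub> s \<cdot>\<^bsub>E\<^esub> p = (y \<ominus>\<^bsub>E\<^esub> n) \<cdot>\<^bsub>E\<^esub> (s \<otimes> p)"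
          using yn s P_carrier[OF p(1)] by (simp add: E.act_assoc)
        then show "(y \<ominus>\<^bsub>E\<^esub> n) \<cdot>\<^bsub>E\<^esub> s \<cdot>\<^bsub>E\<^esub> p = \<zero>\<^bsub>E\<^esub>" using ynP P.I_l_closed[OF p(1) s] by simp
      qed (use yn p P_carrier in auto)
      then show False using p(2) by blast
    qed
    then have "y = n" using yn E.M.minus_eq_zero_iff by blast
    then show ?thesis using n t False by (simp add: ann_iff)
  qed
qed

section \<open>The natural map to Ext\<close>

abbreviation natural :: "'m set \<Rightarrow> ('r set \<Rightarrow> 'i) set" where
  "natural \<equiv> natural_map R P M U E j (ann_mod E Q) (J (ann_mod E Q))"

abbreviation case_i :: bool where
  "case_i \<equiv> P \<subset> Q \<and> ann_mod (sub_rmod M U) P \<subset> ann_mod M P"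

text \<open>Outside the first case, \<open>U\<close> is the annihilator in \<open>M\<close> of \<open>P\<close> if \<open>P \<subseteq> Q\<close>, and of \<open>Q\<close> otherwise.\<close>

lemma annihilator_eq_U:
  assumes "\<not> case_i" and x: "x \<in> carrier M"
    and 0: "\<And>t. t \<in> (if P \<subseteq> Q then P else Q) \<Longrightarrow> x \<cdot>\<^bsub>M\<^esub> t = \<zero>\<^bsub>M\<^esub>"
  shows "x \<in> U"
proof (cases "P \<subseteq> Q")
  case True
  show ?thesis
  proof (rule ccontr)
    assume xU: "x \<notin> U"
    then have "P \<noteq> Q" using 0 x mem_U_iff by auto
    moreover have "ann_mod (sub_rmod M U) P \<subseteq> ann_mod M P"
      using U_props(1) by (auto simp: ann_mod_def sub_rmod_def)
    moreover have "x \<in> ann_mod M P" "x \<notin> ann_mod (sub_rmod M U) P"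
      using 0 True x xU by (auto simp: ann_mod_def sub_rmod_def)
    ultimately show False using assms(1) True by blast
  qed
qed (use 0 x mem_U_iff in auto)

text \<open>If \<open>P\<close> is not contained in \<open>Q\<close>, then \<open>yQ \<noteq> 0\<close> for \<open>y\<close> outside \<open>U\<close>, and \<open>P\<close> does not annihilate the
  nonzero submodule \<open>yQ\<close>. So \<open>yQP \<noteq> 0\<close>, and \<open>QP \<subseteq> P \<inter> Q\<close>.\<close>

lemma intersection_detects_U:
  assumes "\<not> case_i" and y: "y \<in> carrier M" and 0: "\<And>z. z \<in> P \<Longrightarrow> z \<in> Q \<Longrightarrow> y \<cdot>\<^bsub>M\<^esub> z = \<zero>\<^bsub>M\<^esub>"
  shows "y \<in> U"
proof (rule annihilator_eq_U[OF assms(1) y])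
  interpret P: ideal P R by (rule ideal_P)
  interpret Q: ideal Q R by (rule ideal_Q)
  fix t assume t: "t \<in> (if P \<subseteq> Q then P else Q)"
  show "y \<cdot>\<^bsub>M\<^esub> t = \<zero>\<^bsub>M\<^esub>"
  proof (cases "P \<subseteq> Q")
    case True
    then show ?thesis using t 0 by auto
  next
    case False
    then obtain p where p: "p \<in> P" "p \<notin> Q" by blast
    have tQ: "t \<in> Q" "t \<in> carrier R" using t False Q_carrier by auto
    show ?thesis
    proof (rule ccontr)
      assume "y \<cdot>\<^bsub>M\<^esub> t \<noteq> \<zero>\<^bsub>M\<^esub>"
      then have ne: "j (y \<cdot>\<^bsub>M\<^esub> t) \<noteq> \<zero>\<^bsub>E\<^esub>" using j_zero_iff y tQ by simp
      have "p \<in> Q"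
      proof (rule annihilator_in_E[OF _ ne])
        show "j (y \<cdot>\<^bsub>M\<^esub> t) \<in> carrier E" using j_props(1) y tQ by simp
        show "p \<in> carrier R" using p P_carrier by blast
        fix s assume s: "s \<in> carrier R"
        have pR: "p \<in> carrier R" using p P_carrier by blast
        have "t \<otimes> s \<otimes> p \<in> P" "t \<otimes> s \<otimes> p \<in> Q" using p(1) tQ s pR P.I_l_closed Q.I_r_closed by auto
        then have "y \<cdot>\<^bsub>M\<^esub> (t \<otimes> s \<otimes> p) = \<zero>\<^bsub>M\<^esub>" by (rule 0)
        then have "y \<cdot>\<^bsub>M\<^esub> t \<cdot>\<^bsub>M\<^esub> s \<cdot>\<^bsub>M\<^esub> p = \<zero>\<^bsub>M\<^esub>" using y tQ s pR by (simp add: act_assoc)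
        then show "j (y \<cdot>\<^bsub>M\<^esub> t) \<cdot>\<^bsub>E\<^esub> s \<cdot>\<^bsub>E\<^esub> p = \<zero>\<^bsub>E\<^esub>"
          using y tQ s pR j_props(4) by (simp add: j_props(3)[symmetric])
      qed
      then show False using p(2) by blast
    qed
  qed
qed

text \<open>The choice of \<open>h\<close> in the connecting homomorphism.\<close>

definition ext_map :: "'e \<Rightarrow> 'i" where
  "ext_map = (SOME h. h \<in> rhom R E (obj (J (ann_mod E Q)) 0) \<and> (\<forall>x\<in>ann_mod E Q. h x = aug (J (ann_mod E Q)) x))"

lemma ext_map: "ext_map \<in> rhom R E (obj (J (ann_mod E Q)) 0)"
    "\<And>x. x \<in> ann_mod E Q \<Longrightarrow> ext_map x = aug (J (ann_mod E Q)) x"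
  using someI_ex[OF aug_extends[OF E.rsubmodule_carrier], folded ext_map_def, unfolded sub_E]
  unfolding ext_map_def by auto

sublocale hull: extension_classes P R E "ann_mod E Q" "J (ann_mod E Q)" ext_map
  using extension_classes_ann[OF E.rsubmodule_carrier] ext_map by (simp add: sub_E)

lemma j_annihilated_mod: "x \<in> carrier M \<Longrightarrow> j x \<in> hull.annihilated_mod"
  unfolding hull.annihilated_mod_def
proof (intro CollectI conjI ballI)
  assume x: "x \<in> carrier M"
  show "j x \<in> carrier E" using j_props(1) x .
  fix p assume p: "p \<in> P"
  have "j x \<cdot>\<^bsub>E\<^esub> p = j (x \<cdot>\<^bsub>M\<^esub> p)" using j_props(3) x p P_carrier by simp
  moreover have "x \<cdot>\<^bsub>M\<^esub> p \<in> U" "x \<cdot>\<^bsub>M\<^esub> p \<in> carrier M" using act_P_in_U x p P_carrier by auto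
  ultimately show "j x \<cdot>\<^bsub>E\<^esub> p \<in> ann_mod E Q"
    using j_ann_iff j_props(1) by (simp add: ann_mod_def)
qed

lemma natural_coset:
  assumes x: "x \<in> carrier M" shows "natural (U +>\<^bsub>M\<^esub> x) = hull.ext_class (j x)"
proof -
  let ?N = "ann_mod E Q" let ?J = "J (ann_mod E Q)"
  let ?A = "quot_rmod (regular_rmod R) P"
  let ?\<phi> = "\<lambda>C\<in>carrier (R Quot P). quot_map E ?N j ((U +>\<^bsub>M\<^esub> x) \<cdot>\<^bsub>over_quot P (quot_rmod M U)\<^esub> C)"
  note N = quot_rmod_props[OF module_E hull.N]
  have "the_elem ((\<lambda>b. diff ?J 0 (ext_map b)) ` ?\<phi> C) = hull.cocycle (j x) C" if C: "C \<in> carrier ?A" for C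
  proof -
    obtain r where r: "r \<in> carrier R" "C = P +> r" using C by (auto simp: hull.A_carrier)
    have xr: "x \<cdot>\<^bsub>M\<^esub> r \<in> carrier M" using x r(1) by simp
    have "?N +>\<^bsub>E\<^esub> j y = ?N +>\<^bsub>E\<^esub> j (x \<cdot>\<^bsub>M\<^esub> r)" if y: "y \<in> U +>\<^bsub>M\<^esub> (x \<cdot>\<^bsub>M\<^esub> r)" for y
    proof -
      obtain u where u: "u \<in> U" "y = u \<oplus>\<^bsub>M\<^esub> (x \<cdot>\<^bsub>M\<^esub> r)" using y unfolding quot_props(7) by blast
      have uM: "u \<in> carrier M" using u U_props(1) by blast
      have c: "j u \<in> carrier E" "j (x \<cdot>\<^bsub>M\<^esub> r) \<in> carrier E" using j_props(1) uM xr by auto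
      have "j y \<ominus>\<^bsub>E\<^esub> j (x \<cdot>\<^bsub>M\<^esub> r) = j u"
        unfolding u(2) using j_props(2)[OF uM xr] c by (simp add: a_minus_def E.M.a_assoc E.M.r_neg)
      moreover have "j u \<in> ?N" using j_ann_iff[OF uM] u(1) c(1) by (simp add: ann_mod_def)
      ultimately show ?thesis using N(5) j_props(1) xr uM u(2) by simp
    qed
    then have "(\<lambda>y. ?N +>\<^bsub>E\<^esub> j y) ` (U +>\<^bsub>M\<^esub> (x \<cdot>\<^bsub>M\<^esub> r)) = {?N +>\<^bsub>E\<^esub> j (x \<cdot>\<^bsub>M\<^esub> r)}"
      using quot_props(4)[OF xr] by blast
    then have phi: "?\<phi> C = ?N +>\<^bsub>E\<^esub> j (x \<cdot>\<^bsub>M\<^esub> r)"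
      using r over_quot_act[OF x r(1)] by (simp add: quot_map_def hull.carrier_Quot)
    interpret O: right_module R "obj ?J (Suc 0)" by (rule hull.obj)
    have jr: "j (x \<cdot>\<^bsub>M\<^esub> r) \<in> carrier E" using j_props(1) xr by simp
    have "diff ?J 0 (ext_map b) = diff ?J 0 (ext_map (j (x \<cdot>\<^bsub>M\<^esub> r)))"
      if b: "b \<in> ?N +>\<^bsub>E\<^esub> j (x \<cdot>\<^bsub>M\<^esub> r)" for b
    proof -
      obtain n where n: "n \<in> ?N" "b = n \<oplus>\<^bsub>E\<^esub> j (x \<cdot>\<^bsub>M\<^esub> r)" using b unfolding N(7) by blast
      have nE: "n \<in> carrier E" using n by (simp add: ann_mod_def)
      have c: "ext_map n \<in> carrier (obj ?J 0)" "ext_map (j (x \<cdot>\<^bsub>M\<^esub> r)) \<in> carrier (obj ?J 0)"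
        using hull.h_props(1) nE jr by auto
      have "diff ?J 0 (ext_map n) = \<zero>\<^bsub>obj ?J 1\<^esub>" using hull.diff_zero_iff[OF c(1)] n(1) by blast
      then show ?thesis unfolding n(2) using c hull.diff_props(1)[where k=0]
        by (simp add: hull.h_props(2)[OF nE jr] hull.diff_props(2)[where k=0])
    qed
    then have "(\<lambda>b. diff ?J 0 (ext_map b)) ` (?N +>\<^bsub>E\<^esub> j (x \<cdot>\<^bsub>M\<^esub> r)) = {diff ?J 0 (ext_map (j (x \<cdot>\<^bsub>M\<^esub> r)))}"
      using N(4)[OF jr] by blast
    then show ?thesis unfolding phi unfolding r(2) using hull.cocycle_apply[OF j_annihilated_mod[OF x] r(1)] j_props(3)[OF x r(1)] by simp
  qed
  then have "(\<lambda>C\<in>carrier ?A. the_elem ((\<lambda>b. diff ?J 0 (ext_map b)) ` ?\<phi> C)) = hull.cocycle (j x)"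
    by (intro extensionalityI[where A="carrier ?A"]) (auto simp: hull.cocycle_def)
  then show ?thesis
    unfolding natural_map_def connecting_def ext_map_def[symmetric] Let_def hull.ext_class_def by simp
qed

lemma natural_hom: "natural \<in> rhom (R Quot P) (over_quot P (quot_rmod M U)) (Ext_quot R P (J (ann_mod E Q)) 1)"
proof -
  have O: "carrier (over_quot P (quot_rmod M U)) = (\<lambda>x. U +>\<^bsub>M\<^esub> x) ` carrier M"
    "add (over_quot P (quot_rmod M U)) = add (quot_rmod M U)"
    by (simp_all add: over_quot_def quot_props(1))
  show ?thesis
    unfolding rhom_def O hull.carrier_Quot
  proof (intro CollectI conjI ballI Pi_I)
    fix Y assume "Y \<in> (\<lambda>x. U +>\<^bsub>M\<^esub> x) ` carrier M"
    then obtain x where x: "x \<in> carrier M" "Y = U +>\<^bsub>M\<^esub> x" by blast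
    show "natural Y \<in> carrier (Ext_quot R P (J (ann_mod E Q)) 1)"
      using x natural_coset hull.ext_class_closed[OF j_annihilated_mod] by simp
    show "natural (Y \<cdot>\<^bsub>over_quot P (quot_rmod M U)\<^esub> C) = natural Y \<cdot>\<^bsub>Ext_quot R P (J (ann_mod E Q)) 1\<^esub> C"
      if "C \<in> (\<lambda>r. P +> r) ` carrier R" for C
    proof -
      obtain r where r: "r \<in> carrier R" "C = P +> r" using \<open>C \<in> _\<close> by blast
      have "natural (Y \<cdot>\<^bsub>over_quot P (quot_rmod M U)\<^esub> C) = hull.ext_class (j (x \<cdot>\<^bsub>M\<^esub> r))"
        using x r over_quot_act natural_coset by simp
      also have "\<dots> = hull.ext_class (j x \<cdot>\<^bsub>E\<^esub> r)" using x r j_props(3) by simp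
      finally show ?thesis using hull.ext_class_act[OF j_annihilated_mod r(1)] natural_coset x r(2) by simp
    qed
    fix Z assume "Z \<in> (\<lambda>x. U +>\<^bsub>M\<^esub> x) ` carrier M"
    then obtain z where z: "z \<in> carrier M" "Z = U +>\<^bsub>M\<^esub> z" by blast
    show "natural (Y \<oplus>\<^bsub>quot_rmod M U\<^esub> Z) = natural Y \<oplus>\<^bsub>Ext_quot R P (J (ann_mod E Q)) 1\<^esub> natural Z"
      using x z hull.ext_class_add[OF j_annihilated_mod j_annihilated_mod] by (simp add: quot_props(2) natural_coset j_props(2))
  qed
qed

text \<open>In the first case an element outside \<open>U\<close> annihilated by \<open>P\<close> gives a nonzero element of the kernel.
  Otherwise an element of the kernel is represented by some \<open>x\<close> with \<open>xP = 0\<close> or \<open>xQ = 0\<close>, according to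
  whether \<open>P \<subseteq> Q\<close>, and then \<open>x \<in> U\<close>.\<close>

lemma natural_embedding_iff:
  "rembedding (R Quot P) (over_quot P (quot_rmod M U)) (Ext_quot R P (J (ann_mod E Q)) 1) natural \<longleftrightarrow> \<not> case_i"
proof
  assume emb: "rembedding (R Quot P) (over_quot P (quot_rmod M U)) (Ext_quot R P (J (ann_mod E Q)) 1) natural"
  show "\<not> case_i"
  proof
    assume i: case_i
    then obtain x where x: "x \<in> carrier M" "x \<notin> U" and xP: "\<And>p. p \<in> P \<Longrightarrow> x \<cdot>\<^bsub>M\<^esub> p = \<zero>\<^bsub>M\<^esub>"
      by (auto simp: ann_mod_def sub_rmod_def)
    have "j x \<cdot>\<^bsub>E\<^esub> p = \<zero>\<^bsub>E\<^esub>" if "p \<in> P" for p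
      using j_act_zero_iff x(1) P_carrier xP that by simp
    then have "natural (U +>\<^bsub>M\<^esub> x) = \<zero>\<^bsub>Ext_quot R P (J (ann_mod E Q)) 1\<^esub>"
      using natural_coset x(1) hull.ext_class_annihilated j_props(1) by simp
    also have "\<dots> = natural (U +>\<^bsub>M\<^esub> \<zero>\<^bsub>M\<^esub>)"
      using natural_coset hull.ext_class_of_N[OF hull.N_props(2)] j_props(4) by simp
    finally have "U +>\<^bsub>M\<^esub> x = U +>\<^bsub>M\<^esub> \<zero>\<^bsub>M\<^esub>"
      using emb x(1) by (auto simp: rembedding_def over_quot_def quot_props(1) inj_on_def)
    then have "U +>\<^bsub>M\<^esub> x = U" using quot_props(6)[of "\<zero>\<^bsub>M\<^esub>"] U_props(2) by simp
    then show False using quot_props(6) x by simp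
  qed
next
  assume ni: "\<not> case_i"
  interpret Ex: right_module "R Quot P" "Ext_quot R P (J (ann_mod E Q)) 1" by (rule hull.right_module_Ext1)
  have "inj_on natural ((\<lambda>x. U +>\<^bsub>M\<^esub> x) ` carrier M)"
  proof (rule inj_onI)
    fix Y Z assume "Y \<in> (\<lambda>x. U +>\<^bsub>M\<^esub> x) ` carrier M" "Z \<in> (\<lambda>x. U +>\<^bsub>M\<^esub> x) ` carrier M" and eq: "natural Y = natural Z"
    then obtain x z where x: "x \<in> carrier M" "Y = U +>\<^bsub>M\<^esub> x" and z: "z \<in> carrier M" "Z = U +>\<^bsub>M\<^esub> z" by blast
    have d: "x \<ominus>\<^bsub>M\<^esub> z \<in> carrier M" using x z by simp
    have "x = (x \<ominus>\<^bsub>M\<^esub> z) \<oplus>\<^bsub>M\<^esub> z" using x(1) z(1) by (simp add: a_minus_def M.a_assoc M.l_neg)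
    then have "j x = j (x \<ominus>\<^bsub>M\<^esub> z) \<oplus>\<^bsub>E\<^esub> j z" using j_props(2)[OF d z(1)] by simp
    then have "hull.ext_class (j z) = hull.ext_class (j (x \<ominus>\<^bsub>M\<^esub> z)) \<oplus>\<^bsub>Ext_quot R P (J (ann_mod E Q)) 1\<^esub> hull.ext_class (j z)"
      using hull.ext_class_add[OF j_annihilated_mod[OF d] j_annihilated_mod[OF z(1)]] eq x z natural_coset by simp
    then have 0: "hull.ext_class (j (x \<ominus>\<^bsub>M\<^esub> z)) = \<zero>\<^bsub>Ext_quot R P (J (ann_mod E Q)) 1\<^esub>"
      using hull.ext_class_closed[OF j_annihilated_mod[OF d]] hull.ext_class_closed[OF j_annihilated_mod[OF z(1)]]
      by (metis Ex.M.add.r_cancel_one)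
    have "j (x \<ominus>\<^bsub>M\<^esub> z) \<cdot>\<^bsub>E\<^esub> t = \<zero>\<^bsub>E\<^esub>" if "t \<in> (if P \<subseteq> Q then P else Q)" for t
      using trivial_class[OF E.rsubmodule_carrier, unfolded sub_E, OF ext_map j_annihilated_mod[OF d] 0 that] .
    then have "x \<ominus>\<^bsub>M\<^esub> z \<in> U"
      using annihilator_eq_U[OF ni d] j_act_zero_iff[OF d] P_carrier Q_carrier by (metis (full_types))
    then show "Y = Z" using quot_props(5) x z by simp
  qed
  then show "rembedding (R Quot P) (over_quot P (quot_rmod M U)) (Ext_quot R P (J (ann_mod E Q)) 1) natural"
    using natural_hom by (simp add: rembedding_def over_quot_def quot_props(1))
qed

section \<open>The uniform summand\<close>

text \<open>The right ideal is the annihilator of \<open>m + U\<close>, so \<open>m\<close> generates a uniform submodule of \<open>M/U\<close>. To find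
  it, take \<open>x \<notin> U\<close> and a right ideal \<open>N\<close> that properly contains the annihilator \<open>A\<^sub>0\<close> of \<open>x + U\<close> and in
  which every smaller such right ideal is essential modulo \<open>A\<^sub>0\<close>. Then \<open>N/A\<^sub>0\<close> is uniform, and \<open>m = xn\<close>
  works for each \<open>n \<in> N\<close> outside \<open>A\<^sub>0\<close>.\<close>

lemma uniform_generator:
  "\<exists>m\<in>carrier M. m \<notin> U \<and> meet_irreducible R {r \<in> carrier R. m \<cdot>\<^bsub>M\<^esub> r \<in> U}"
proof -
  obtain x where x: "x \<in> carrier M" "x \<notin> U" using proper_U by blast
  define A0 where "A0 = {r \<in> carrier R. x \<cdot>\<^bsub>M\<^esub> r \<in> U}"
  have A0: "right_ideal R A0"
    unfolding A0_def by (rule right_ideal_preimage[OF rsubmodule_U x(1)])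
  note A0i = R.right_idealD[OF A0]
  define \<N> where "\<N> = {N. right_ideal R N \<and> A0 \<subset> N}"
  have "carrier R \<in> \<N>"
  proof -
    have "\<one> \<in> carrier R - A0" using x by (simp add: A0_def)
    then show ?thesis using A0i(1) by (auto simp: \<N>_def R.right_ideal_iff)
  qed
  then have "\<N> \<noteq> {}" by blast
  then obtain N where "N \<in> \<N>"
    and ess: "\<And>N' a. N' \<in> \<N> \<Longrightarrow> N' \<subseteq> N \<Longrightarrow> a \<in> N \<Longrightarrow> a \<notin> A0 \<Longrightarrow>
      \<exists>r\<in>carrier R. a \<otimes> r \<in> N' \<and> a \<otimes> r \<notin> A0"
    by (rule right_noetherian_essential_member[OF noetherian A0]) (auto simp: \<N>_def)
  then have N: "right_ideal R N" "A0 \<subset> N" by (auto simp: \<N>_def)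
  note Ni = R.right_idealD[OF N(1)]
  obtain n where n: "n \<in> N" "n \<notin> A0" using N(2) by blast
  have nR: "n \<in> carrier R" using n Ni(1) by blast
  define m where "m = x \<cdot>\<^bsub>M\<^esub> n"
  define K where "K = {r \<in> carrier R. m \<cdot>\<^bsub>M\<^esub> r \<in> U}"
  have mM: "m \<in> carrier M" using x nR by (simp add: m_def)
  have nK: "n \<otimes> r \<in> A0 \<longleftrightarrow> r \<in> K" if "r \<in> carrier R" for r
    using x nR that by (simp add: A0_def K_def m_def act_assoc)
  have "A = K \<or> B = K"
    if A: "right_ideal R A" and B: "right_ideal R B" and AB: "A \<inter> B = K" for A B
  proof (rule ccontr)
    assume "\<not> ?thesis"
    then obtain a b where a: "a \<in> A" "a \<notin> K" and b: "b \<in> B" "b \<notin> K" using AB by blast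
    have aR: "a \<in> carrier R" and bR: "b \<in> carrier R"
      using a b R.right_idealD(1)[OF A] R.right_idealD(1)[OF B] by auto
    let ?N = "{k \<oplus> (n \<otimes> a) \<otimes> r | k r. k \<in> A0 \<and> r \<in> carrier R}"
    have rN: "right_ideal R ?N" using R.right_ideal_add_principal[OF A0] nR aR by simp
    have A0N: "A0 \<subset> ?N"
    proof
      show "A0 \<subseteq> ?N"
      proof
        fix k assume "k \<in> A0"
        then show "k \<in> ?N" using A0i(1)[of k] nR aR by (intro CollectI exI[of _ k] exI[of _ \<zero>]) simp
      qed
      have "n \<otimes> a \<in> ?N" using A0i(2) nR aR by (intro CollectI exI[of _ \<zero>] exI[of _ \<one>]) simp
      moreover have "n \<otimes> a \<notin> A0" using nK[OF aR] a(2) by simp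
      ultimately show "A0 \<noteq> ?N" by blast
    qed
    have NN: "?N \<subseteq> N"
    proof clarify
      fix k r assume "k \<in> A0" "r \<in> carrier R"
      then show "k \<oplus> n \<otimes> a \<otimes> r \<in> N" using N(2) Ni(3) Ni(4)[OF Ni(4)[OF n(1) aR]] by blast
    qed
    have nb: "n \<otimes> b \<in> N" "n \<otimes> b \<notin> A0" using Ni(4)[OF n(1) bR] nK[OF bR] b(2) by auto
    have "?N \<in> \<N>" unfolding \<N>_def using rN A0N by (intro CollectI conjI)
    from ess[OF this NN nb] obtain r where r: "r \<in> carrier R" "n \<otimes> b \<otimes> r \<in> ?N" "n \<otimes> b \<otimes> r \<notin> A0"
      by (elim bexE conjE)
    obtain k s where k: "k \<in> A0" "s \<in> carrier R" "n \<otimes> b \<otimes> r = k \<oplus> n \<otimes> a \<otimes> s" using r(2) by blast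
    have kR: "k \<in> carrier R" using k A0i(1) by blast
    have "n \<otimes> (b \<otimes> r \<ominus> a \<otimes> s) = n \<otimes> b \<otimes> r \<ominus> n \<otimes> a \<otimes> s"
      using nR aR bR r(1) k(2) by (simp add: a_minus_def R.r_distr R.r_minus R.m_assoc)
    also have "\<dots> = k" unfolding k(3) using kR nR aR k(2) by (simp add: a_minus_def R.a_assoc R.r_neg)
    finally have "b \<otimes> r \<ominus> a \<otimes> s \<in> K" using nK[of "b \<otimes> r \<ominus> a \<otimes> s"] k(1) aR bR r(1) k(2) by simp
    then have "(b \<otimes> r \<ominus> a \<otimes> s) \<oplus> a \<otimes> s \<in> A"
      using AB R.right_idealD(3,4)[OF A] a(1) k(2) by blast
    moreover have "(b \<otimes> r \<ominus> a \<otimes> s) \<oplus> a \<otimes> s = b \<otimes> r"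
      using aR bR r(1) k(2) by (simp add: a_minus_def R.a_assoc R.l_neg)
    ultimately have "b \<otimes> r \<in> K" using AB R.right_idealD(4)[OF B b(1) r(1)] by auto
    then have "n \<otimes> (b \<otimes> r) \<in> A0" using nK bR r(1) by simp
    then show False using r(1,3) nR bR by (simp add: R.m_assoc)
  qed
  then have "meet_irreducible R K" unfolding meet_irreducible_def by blast
  moreover have "m \<notin> U" using n nR by (simp add: A0_def m_def)
  ultimately show ?thesis using mM unfolding K_def by blast
qed

lemma nc_prime_Q: "nc_prime_ideal Q R"
  unfolding nc_prime_ideal_def
proof (intro conjI allI impI ideal_Q)
  show "Q \<noteq> carrier R"
  proof
    assume "Q = carrier R"
    then have "\<one> \<in> Q" by simp
    moreover obtain u where "u \<in> U" "u \<noteq> \<zero>\<^bsub>M\<^esub>" using nonzero_U by blast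
    ultimately show False using mem_U_iff[of u] by auto
  qed
  fix A B assume *: "ideal A R \<and> ideal B R \<and> (\<forall>a\<in>A. \<forall>b\<in>B. a \<otimes> b \<in> Q)"
  interpret A: ideal A R using * by blast
  interpret B: ideal B R using * by blast
  show "A \<subseteq> Q \<or> B \<subseteq> Q"
  proof (rule ccontr)
    assume "\<not> ?thesis"
    then obtain a b where ab: "a \<in> A" "a \<notin> Q" "b \<in> B" "b \<notin> Q" by blast
    have "a \<otimes> s \<otimes> b \<in> Q" if "s \<in> carrier R" for s using * A.I_r_closed[OF ab(1) that] ab(3) by blast
    then show False using prime_Q ab A.Icarr B.Icarr by blast
  qed
qed

text \<open>Nonzero submodules of \<open>ann V\<close> have annihilator \<open>Q\<close>, and \<open>ann V\<close> is essential in \<open>V\<close>.\<close>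

lemma assassinator_Q:
  assumes V: "rsubmodule R E V" and uni: "uniform_module R (sub_rmod E V)"
  shows "has_assassinator R (sub_rmod E V) Q"
proof -
  let ?V = "sub_rmod E V"
  interpret V: right_module R ?V by (rule right_module_sub_rmod[OF module_E V])
  note Vi = E.rsubmoduleD[OF V]
  have s: "carrier ?V = V" "\<zero>\<^bsub>?V\<^esub> = \<zero>\<^bsub>E\<^esub>" "x \<cdot>\<^bsub>?V\<^esub> r = x \<cdot>\<^bsub>E\<^esub> r" for x r
    by (simp_all add: sub_rmod_def)
  have V0: "V \<noteq> {\<zero>\<^bsub>E\<^esub>}" using uni by (simp add: uniform_module_def s)
  have ess: "essential_submodule R ?V (ann V)" by (rule ann_essential[OF V])
  have annV: "rsubmodule R ?V (ann V)" using ess by (simp add: essential_submodule_def)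
  have Q: "ann_ring R ?V X = Q" if X: "nonzero_submodule R ?V X" "X \<subseteq> ann V" for X
  proof
    have rX: "rsubmodule R E X" using X(1) rsubmodule_sub_rmod_iff[OF module_E V] by (auto simp: nonzero_submodule_def)
    note Xi = E.rsubmoduleD[OF rX]
    show "Q \<subseteq> ann_ring R ?V X" using X(2) Q_carrier by (auto simp: ann_ring_def ann_iff s)
    obtain x where x: "x \<in> X" "x \<noteq> \<zero>\<^bsub>E\<^esub>" using X(1) Xi(2) by (auto simp: nonzero_submodule_def s)
    have xE: "x \<in> carrier E" using x Xi(1) by blast
    show "ann_ring R ?V X \<subseteq> Q"
    proof
      fix r assume r: "r \<in> ann_ring R ?V X"
      show "r \<in> Q"
        using annihilator_in_E[OF xE x(2), of r] Xi(4)[OF x(1)] r by (simp add: ann_ring_def s)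
    qed
  qed
  have meet: "nonzero_submodule R ?V (X \<inter> ann V)" if X: "nonzero_submodule R ?V X" for X
  proof -
    have "ann V \<inter> X \<noteq> {\<zero>\<^bsub>?V\<^esub>}" using ess X by (auto simp: essential_submodule_def)
    moreover have "rsubmodule R ?V (X \<inter> ann V)"
      using X annV V.rsubmoduleD unfolding nonzero_submodule_def by (intro V.rsubmoduleI) blast+
    ultimately show ?thesis by (simp add: nonzero_submodule_def Int_commute)
  qed
  have "nonzero_submodule R ?V V"
    using V0 V.rsubmodule_carrier by (simp add: nonzero_submodule_def s)
  then have ann0: "nonzero_submodule R ?V (ann V)" using meet[of V] by (simp add: ann_iff Int_absorb1 subset_iff)
  have "associated_prime R ?V P' \<longleftrightarrow> P' = Q" for P'
  proof
    assume "associated_prime R ?V P'"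
    then obtain X where X: "nonzero_submodule R ?V X"
      "\<And>Y. nonzero_submodule R ?V Y \<Longrightarrow> Y \<subseteq> X \<Longrightarrow> ann_ring R ?V Y = P'"
      by (auto simp: associated_prime_def)
    have "ann_ring R ?V (X \<inter> ann V) = P'" using X(2)[OF meet[OF X(1)]] by blast
    then show "P' = Q" using Q[OF meet[OF X(1)]] by blast
  next
    assume "P' = Q"
    then show "associated_prime R ?V P'"
      unfolding associated_prime_def using nc_prime_Q ann0 Q by blast
  qed
  then show ?thesis using uni by (auto simp: has_assassinator_def)
qed

text \<open>The classes of the projections of \<open>mR\<close>. The map from \<open>mR\<close> to \<open>Ext\<close> has kernel \<open>mR \<inter> U\<close> by the
  choice of the summand, so its image inherits full faithfulness from \<open>M/U\<close>.\<close>

lemma fully_faithful_summand: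
  assumes ni: "\<not> case_i"
  shows "\<exists>E'. direct_summand R E E' \<and> indecomposable R (sub_rmod E E') \<and>
    has_assassinator R (sub_rmod E E') Q \<and>
    (\<exists>X. nonzero_submodule (R Quot P) (Ext_quot R P (J (ann E')) 1) X \<and>
         fully_faithful (R Quot P) (sub_rmod (Ext_quot R P (J (ann E')) 1) X))"
proof -
  let ?T = "if P \<subseteq> Q then P else Q"
  have T: "ideal ?T R" using ideal_P ideal_Q by simp
  have TR: "t \<in> carrier R" if "t \<in> ?T" for t using that P_carrier Q_carrier by (auto split: if_splits)
  have UT: "x \<cdot>\<^bsub>M\<^esub> t = \<zero>\<^bsub>M\<^esub>" if "x \<in> U" "t \<in> ?T" for x t
    using that mem_U_iff by (auto split: if_splits)
  obtain m where m: "m \<in> carrier M" "m \<notin> U"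
    and irr: "meet_irreducible R {r \<in> carrier R. m \<cdot>\<^bsub>M\<^esub> r \<in> U}"
    using uniform_generator by blast
  have jm: "j m \<in> carrier E" using m j_props(1) by simp
  have K: "{r \<in> carrier R. \<forall>t\<in>?T. j m \<cdot>\<^bsub>E\<^esub> r \<cdot>\<^bsub>E\<^esub> t = \<zero>\<^bsub>E\<^esub>} = {r \<in> carrier R. m \<cdot>\<^bsub>M\<^esub> r \<in> U}"
  proof (intro Collect_cong conj_cong refl)
    fix r assume r: "r \<in> carrier R"
    have mr: "m \<cdot>\<^bsub>M\<^esub> r \<in> carrier M" using m r by simp
    have "(\<forall>t\<in>?T. j m \<cdot>\<^bsub>E\<^esub> r \<cdot>\<^bsub>E\<^esub> t = \<zero>\<^bsub>E\<^esub>) \<longleftrightarrow> (\<forall>t\<in>?T. m \<cdot>\<^bsub>M\<^esub> r \<cdot>\<^bsub>M\<^esub> t = \<zero>\<^bsub>M\<^esub>)"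
      using j_act_zero_iff[OF mr] j_props(3)[OF m(1) r] TR by simp
    then show "(\<forall>t\<in>?T. j m \<cdot>\<^bsub>E\<^esub> r \<cdot>\<^bsub>E\<^esub> t = \<zero>\<^bsub>E\<^esub>) \<longleftrightarrow> m \<cdot>\<^bsub>M\<^esub> r \<in> U"
      using annihilator_eq_U[OF ni mr] UT by blast
  qed
  note separating = uniform_summand_separating[OF noetherian injective_E T jm, unfolded K]
  have "\<exists>E' D. direct_sum_decomp R E E' D \<and> uniform_module R (sub_rmod E E') \<and>
    indecomposable R (sub_rmod E E') \<and>
    (\<forall>r\<in>carrier R. (\<forall>t\<in>?T. j m \<cdot>\<^bsub>E\<^esub> r \<cdot>\<^bsub>E\<^esub> t \<in> D) \<longrightarrow> m \<cdot>\<^bsub>M\<^esub> r \<in> U)"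
  proof (rule separating)
    show "\<one> \<notin> {r \<in> carrier R. m \<cdot>\<^bsub>M\<^esub> r \<in> U}" using m by simp
  next
    fix E' D
    assume *: "direct_sum_decomp R E E' D" "uniform_module R (sub_rmod E E')" "indecomposable R (sub_rmod E E')"
      and sep: "\<And>r. r \<in> carrier R \<Longrightarrow> (\<And>t. t \<in> ?T \<Longrightarrow> j m \<cdot>\<^bsub>E\<^esub> r \<cdot>\<^bsub>E\<^esub> t \<in> D) \<Longrightarrow>
        r \<in> {r \<in> carrier R. m \<cdot>\<^bsub>M\<^esub> r \<in> U}"
    have "m \<cdot>\<^bsub>M\<^esub> r \<in> U" if "r \<in> carrier R" "\<forall>t\<in>?T. j m \<cdot>\<^bsub>E\<^esub> r \<cdot>\<^bsub>E\<^esub> t \<in> D" for r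
    proof -
      have "r \<in> {r \<in> carrier R. m \<cdot>\<^bsub>M\<^esub> r \<in> U}" by (rule sep) (use that in auto)
      then show ?thesis by simp
    qed
    then show "\<exists>E' D. direct_sum_decomp R E E' D \<and> uniform_module R (sub_rmod E E') \<and>
      indecomposable R (sub_rmod E E') \<and>
      (\<forall>r\<in>carrier R. (\<forall>t\<in>?T. j m \<cdot>\<^bsub>E\<^esub> r \<cdot>\<^bsub>E\<^esub> t \<in> D) \<longrightarrow> m \<cdot>\<^bsub>M\<^esub> r \<in> U)"
      using * by (intro exI[of _ E'] exI[of _ D] conjI ballI impI) auto
  qed (rule irr)
  then obtain E' D where E'D: "direct_sum_decomp R E E' D" and u: "uniform_module R (sub_rmod E E')"
    "indecomposable R (sub_rmod E E')"
    and sep: "\<And>r. r \<in> carrier R \<Longrightarrow> \<forall>t\<in>?T. j m \<cdot>\<^bsub>E\<^esub> r \<cdot>\<^bsub>E\<^esub> t \<in> D \<Longrightarrow> m \<cdot>\<^bsub>M\<^esub> r \<in> U"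
    by blast
  have rE': "rsubmodule R E E'" using E'D by (simp add: direct_sum_decomp_def)
  note E'i = E.rsubmoduleD[OF rE']
  obtain p where p: "p \<in> rhom R E E" and pE': "\<And>x. x \<in> carrier E \<Longrightarrow> p x \<in> E'"
    and p0: "\<And>x. x \<in> carrier E \<Longrightarrow> p x = \<zero>\<^bsub>E\<^esub> \<longleftrightarrow> x \<in> D"
    using direct_sum_projection[OF module_E E'D] by metis
  note pp = rhom_props[OF module_E module_E p]
  obtain h where h: "h \<in> rhom R (sub_rmod E E') (obj (J (ann E')) 0)" "\<And>x. x \<in> ann E' \<Longrightarrow> h x = aug (J (ann E')) x"
    using aug_extends[OF rE'] by blast
  interpret x: extension_classes P R "sub_rmod E E'" "ann E'" "J (ann E')" h
    by (rule extension_classes_ann[OF rE' h])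
  let ?Ext = "Ext_quot R P (J (ann E')) 1"
  interpret Ex: right_module "R Quot P" ?Ext by (rule x.right_module_Ext1)
  define y where "y r = p (j (m \<cdot>\<^bsub>M\<^esub> r))" for r
  have mr: "m \<cdot>\<^bsub>M\<^esub> r \<in> carrier M" "j (m \<cdot>\<^bsub>M\<^esub> r) \<in> carrier E" if "r \<in> carrier R" for r
    using that m j_props(1) by auto
  have y_act: "y r \<cdot>\<^bsub>E\<^esub> s = y (r \<otimes> s)" if "r \<in> carrier R" "s \<in> carrier R" for r s
    using that mr m by (simp add: y_def pp(3)[symmetric] j_props(3)[symmetric] act_assoc)
  have y_add: "y (r \<oplus> s) = y r \<oplus>\<^bsub>E\<^esub> y s" if "r \<in> carrier R" "s \<in> carrier R" for r s
    using that mr m by (simp add: y_def pp(2) j_props(2) act_r_distr)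
  have y_ann: "y r \<in> ann E'" if r: "r \<in> carrier R" "m \<cdot>\<^bsub>M\<^esub> r \<in> U" for r
  proof -
    have "y r \<cdot>\<^bsub>E\<^esub> q = \<zero>\<^bsub>E\<^esub>" if q: "q \<in> Q" for q
    proof -
      have "j (m \<cdot>\<^bsub>M\<^esub> r) \<cdot>\<^bsub>E\<^esub> q = \<zero>\<^bsub>E\<^esub>" using j_ann_iff mr r q by blast
      then show ?thesis using pp(3)[OF mr(2)[OF r(1)] Q_carrier[OF q]] pp(4) by (simp add: y_def)
    qed
    then show ?thesis using pE' mr r(1) by (simp add: ann_iff y_def)
  qed
  have y_dom: "y r \<in> x.annihilated_mod" if r: "r \<in> carrier R" for r
  proof -
    have "y r \<cdot>\<^bsub>E\<^esub> a \<in> ann E'" if a: "a \<in> P" for a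
    proof -
      have aR: "a \<in> carrier R" using a P_carrier by blast
      have "m \<cdot>\<^bsub>M\<^esub> (r \<otimes> a) \<in> U" using act_P_in_U m(1) hull.I_l_closed[OF a r] by blast
      then show ?thesis using y_act[OF r aR] y_ann r aR by simp
    qed
    then have "y r \<in> {y \<in> E'. \<forall>a\<in>P. y \<cdot>\<^bsub>E\<^esub> a \<in> ann E'}" using pE' mr r by (simp add: y_def)
    then show ?thesis unfolding x.annihilated_mod_def by (simp add: sub_rmod_def)
  qed
  define c where "c r = x.ext_class (y r)" for r
  have c_zero: "c r = \<zero>\<^bsub>?Ext\<^esub> \<longleftrightarrow> m \<cdot>\<^bsub>M\<^esub> r \<in> U" if r: "r \<in> carrier R" for r
  proof
    assume "m \<cdot>\<^bsub>M\<^esub> r \<in> U"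
    then show "c r = \<zero>\<^bsub>?Ext\<^esub>" unfolding c_def by (intro x.ext_class_of_N y_ann r)
  next
    assume 0: "c r = \<zero>\<^bsub>?Ext\<^esub>"
    show "m \<cdot>\<^bsub>M\<^esub> r \<in> U"
    proof (rule sep[OF r], rule ballI)
      fix t assume t: "t \<in> ?T"
      have tR: "t \<in> carrier R" using TR t by blast
      have "y r \<cdot>\<^bsub>E\<^esub> t = \<zero>\<^bsub>E\<^esub>" by (rule trivial_class[OF rE' h y_dom[OF r] 0[unfolded c_def] t])
      then have "p (j (m \<cdot>\<^bsub>M\<^esub> r) \<cdot>\<^bsub>E\<^esub> t) = \<zero>\<^bsub>E\<^esub>" using pp(3)[OF mr(2)[OF r] tR] by (simp add: y_def)
      then have "j (m \<cdot>\<^bsub>M\<^esub> r) \<cdot>\<^bsub>E\<^esub> t \<in> D" using p0 mr(2)[OF r] tR by simp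
      then show "j m \<cdot>\<^bsub>E\<^esub> r \<cdot>\<^bsub>E\<^esub> t \<in> D" using j_props(3)[OF m(1) r] by simp
    qed
  qed
  have c_act: "c r \<cdot>\<^bsub>?Ext\<^esub> (P +> s) = c (r \<otimes> s)" if "r \<in> carrier R" "s \<in> carrier R" for r s
    using x.ext_class_act[OF y_dom[OF that(1)] that(2)] y_act[OF that] by (simp add: c_def sub_rmod_def)
  have c_add: "c r \<oplus>\<^bsub>?Ext\<^esub> c s = c (r \<oplus> s)" if "r \<in> carrier R" "s \<in> carrier R" for r s
    using x.ext_class_add[OF y_dom[OF that(1)] y_dom[OF that(2)]] y_add[OF that] by (simp add: c_def sub_rmod_def)
  define X where "X = c ` carrier R"
  have rX: "rsubmodule (R Quot P) ?Ext X"
  proof (rule Ex.rsubmoduleI)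
    show "X \<subseteq> carrier ?Ext" using x.ext_class_closed y_dom by (auto simp: X_def c_def)
    have "c \<zero> = \<zero>\<^bsub>?Ext\<^esub>" using c_zero[of \<zero>] m(1) U_props(2) by simp
    then show "\<zero>\<^bsub>?Ext\<^esub> \<in> X" unfolding X_def by (metis R.zero_closed imageI)
  next
    fix a b assume "a \<in> X" "b \<in> X"
    then show "a \<oplus>\<^bsub>?Ext\<^esub> b \<in> X" using c_add by (auto simp: X_def)
  next
    fix a C assume "a \<in> X" "C \<in> carrier (R Quot P)"
    then show "a \<cdot>\<^bsub>?Ext\<^esub> C \<in> X" using c_act by (auto simp: X_def hull.carrier_Quot)
  qed
  have "c \<one> \<in> X" "c \<one> \<noteq> \<zero>\<^bsub>?Ext\<^esub>" using c_zero[of \<one>] m by (auto simp: X_def)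
  then have nX: "nonzero_submodule (R Quot P) ?Ext X" using rX by (auto simp: nonzero_submodule_def)
  have "fully_faithful (R Quot P) (sub_rmod ?Ext X)"
    unfolding fully_faithful_def
  proof (intro allI impI)
    fix Y assume Y: "nonzero_submodule (R Quot P) (sub_rmod ?Ext X) Y"
    then have rY: "rsubmodule (R Quot P) ?Ext Y" "Y \<subseteq> X" "Y \<noteq> {\<zero>\<^bsub>?Ext\<^esub>}"
      unfolding nonzero_submodule_def rsubmodule_sub_rmod_iff[OF x.right_module_Ext1 rX]
      by (auto simp: sub_rmod_def)
    note Yi = Ex.rsubmoduleD[OF rY(1)]
    obtain r where r: "r \<in> carrier R" "c r \<in> Y" "c r \<noteq> \<zero>\<^bsub>?Ext\<^esub>"
      using rY(2,3) Yi(2) unfolding X_def by blast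
    have mrU: "m \<cdot>\<^bsub>M\<^esub> r \<notin> U" using c_zero r by blast
    have ann: "ann_ring (R Quot P) (sub_rmod ?Ext X) Y =
      {C \<in> carrier (R Quot P). \<forall>a\<in>Y. a \<cdot>\<^bsub>?Ext\<^esub> C = \<zero>\<^bsub>?Ext\<^esub>}"
      by (simp add: ann_ring_def sub_rmod_def)
    show "ann_ring (R Quot P) (sub_rmod ?Ext X) Y = {\<zero>\<^bsub>R Quot P\<^esub>}"
      unfolding ann
    proof (intro equalityI subsetI)
      fix C assume "C \<in> {\<zero>\<^bsub>R Quot P\<^esub>}"
      then show "C \<in> {C \<in> carrier (R Quot P). \<forall>a\<in>Y. a \<cdot>\<^bsub>?Ext\<^esub> C = \<zero>\<^bsub>?Ext\<^esub>}"
        using Yi(1) Ex.act_zero Ex.R.zero_closed by blast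
    next
      fix C assume C: "C \<in> {C \<in> carrier (R Quot P). \<forall>a\<in>Y. a \<cdot>\<^bsub>?Ext\<^esub> C = \<zero>\<^bsub>?Ext\<^esub>}"
      then obtain b where b: "b \<in> carrier R" "C = P +> b" by (auto simp: hull.carrier_Quot)
      have "b \<in> P"
      proof (rule annihilator_mod_U[OF mr(1)[OF r(1)] mrU b(1)])
        fix s assume s: "s \<in> carrier R"
        have "P +> s \<in> carrier (R Quot P)" using s by (simp add: hull.carrier_Quot)
        then have "c (r \<otimes> s) \<in> Y" using Yi(4)[OF r(2)] c_act[OF r(1) s] by metis
        then have "c (r \<otimes> s) \<cdot>\<^bsub>?Ext\<^esub> (P +> b) = \<zero>\<^bsub>?Ext\<^esub>" using C b(2) by blast
        then have "c (r \<otimes> s \<otimes> b) = \<zero>\<^bsub>?Ext\<^esub>" using c_act r(1) s b(1) by simp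
        then have "m \<cdot>\<^bsub>M\<^esub> (r \<otimes> s \<otimes> b) \<in> U" using c_zero r(1) s b(1) by simp
        then show "m \<cdot>\<^bsub>M\<^esub> r \<cdot>\<^bsub>M\<^esub> s \<cdot>\<^bsub>M\<^esub> b \<in> U" using m(1) r(1) s b(1) by (simp add: act_assoc)
      qed
      then show "C \<in> {\<zero>\<^bsub>R Quot P\<^esub>}" using b hull.Quot_zero_iff by (simp add: hull.zero_Quot)
    qed
  qed
  then show ?thesis
    using E'D u nX assassinator_Q[OF rE' u(1)] unfolding direct_summand_def by blast
qed

end

theorem theorem1p14:
  fixes R :: "'r ring"
    and M :: "('r, 'm) rmod" and U :: "'m set" and Q P :: "'r set"
    and E :: "('r, 'e) rmod" and j :: "'m \<Rightarrow> 'e"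
    and J :: "'e set \<Rightarrow> ('r, 'e, 'i) coresolution"
  assumes "right_noetherian R"
    and "right_module R M"
    and "affiliated_series2 R M U Q P"
    and "essential_submodule R M U"
    and "injective_hull R M E j"
    and "\<And>N. rsubmodule R E N \<Longrightarrow> injective_resolution R (sub_rmod E N) (J N)"
  shows
    "let case_i = (P \<subset> Q \<and> ann_mod (sub_rmod M U) P \<subset> ann_mod M P);
         case_ii =
           (rembedding (R Quot P) (over_quot P (quot_rmod M U)) (Ext_quot R P (J (ann_mod E Q)) 1)
              (natural_map R P M U E j (ann_mod E Q) (J (ann_mod E Q))) \<and>
            (\<exists>E'. direct_summand R E E' \<and> indecomposable R (sub_rmod E E') \<and>
               has_assassinator R (sub_rmod E E') Q \<and>
               (\<exists>X. nonzero_submodule (R Quot P)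
                      (Ext_quot R P (J (ann_mod (sub_rmod E E') Q)) 1) X \<and>
                    fully_faithful (R Quot P)
                      (sub_rmod (Ext_quot R P (J (ann_mod (sub_rmod E E') Q)) 1) X))))
     in (case_i \<or> case_ii) \<and> \<not> (case_i \<and> case_ii) \<and>
        (case_ii \<longrightarrow>
           torsionfree (R Quot Q) (over_quot Q (sub_rmod M U)) \<longrightarrow>
           torsionfree (R Quot P) (over_quot P (quot_rmod M U)))"
proof -
  interpret affiliated_series_hull R M U Q P E j J
    by (intro affiliated_series_hull.intro essential_affiliated_series.intro
        essential_affiliated_series_axioms.intro affiliated_series_hull_axioms.intro assms)
  show ?thesis
    unfolding Let_def natural_embedding_iff
    using fully_faithful_summand torsionfree_quotient[OF intersection_detects_U] by blast
qed

end
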